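(* Let $d\ge2$, let $\kappa=(\kappa_1,\dots,\kappa_d)$ with all $\kappa_i\ge0$, and assume $\alpha_\kappa=|\kappa|+\frac{d-2}{2}\le\frac12$. For $f\in L^1_{\mathsf{u}(\kappa)}(\mathbb{V}_0^{d+1})\cap L^1_{\mathsf{u}(\kappa),*}(\mathbb{V}_0^{d+1})$ and $g\in L^1_{u(2\alpha_\kappa)}(\mathbb{R}_+)\cap L^1_{u(2\alpha_\kappa+\frac12)}(\mathbb{R}_+)$, $$\|f*g\|_{1,\kappa}\le\|f\|_{1,\kappa}\,\|g\|_{1,u(2\alpha_\kappa)}+\|f\|_{1,\kappa}^*\,\|g\|_{1,u(2\alpha_\kappa+\frac12)}.$$
   Context: Notation: $|\kappa|=\kappa_1+\dots+\kappa_d$, $h_\kappa(x)=\prod_{i=1}^d|x_i|^{\kappa_i}$, $\mathbb{R}_+=[0,\infty)$. The conic surface is $\mathbb{V}_0^{d+1}=\{(x,t)\in\mathbb{R}^d\times\mathbb{R}_+:\|x\|=t\}$ with measure $\sigma$ given by $\int_{\mathbb{V}_0^{d+1}}f\,d\sigma=\int_0^\infty t^{d-1}\int_{\mathbb{S}^{d-1}}f(t\xi,t)\,d\sigma_{\mathbb{S}}(\xi)\,dt$, where $d\sigma_{\mathbb S}$ is the surface measure of $\mathbb{S}^{d-1}$. Put $\mathsf{w}_\kappa(x,t)=h_\kappa^2(x)t^{-1}e^{-t}$, $\mathsf{u}_\kappa(x,t)=h_\kappa^2(x)t^{-1}$, and $\mathsf{b}_\kappa=1/\int_{\mathbb{V}_0^{d+1}}\mathsf{w}_\kappa\,d\sigma$.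 Norms: $\|f\|_{1,\kappa}=\mathsf{b}_\kappa\int_{\mathbb{V}_0^{d+1}}|f(x,t)|e^{-t/2}\,\mathsf{u}_\kappa(x,t)\,d\sigma(x,t)$ and $\|f\|^*_{1,\kappa}=\mathsf{b}_\kappa\int_{\mathbb{V}_0^{d+1}}|f(x,t)|e^{-t/2}\sqrt t\,\mathsf{u}_\kappa(x,t)\,d\sigma(x,t)$; $L^1_{\mathsf{u}(\kappa)}(\mathbb{V}_0^{d+1})$ and $L^1_{\mathsf{u}(\kappa),*}(\mathbb{V}_0^{d+1})$ are the corresponding spaces. On $\mathbb{R}_+$: $\|g\|_{1,u(\alpha)}=\frac{1}{\Gamma(\alpha+1)}\int_0^\infty|g(t)|e^{-t/2}t^\alpha\,dt$, with space $L^1_{u(\alpha)}(\mathbb{R}_+)$. Generalized translation: for $g:\mathbb{R}_+\to\mathbb{R}$ and $(x,t)\in\mathbb{V}_0^{d+1}$, if $\alpha_\kappa>0$, $$\mathsf{T}_{(x,t)}g(y,s)=C_\kappa\int_{[-1,1]^d}\int_0^\pi g\big(t+s+2\rho\cos\theta\big)e^{-\rho\cos\theta}j_{\alpha_\kappa-1}(\rho\sin\theta)(\sin\theta)^{2\alpha_\kappa-1}\,d\theta\,\Phi_\kappa(u)\,du,$$ where $\rho=\rho(x,t,y,s;u)=\sqrt{\tfrac12(ts+x_1y_1u_1+\dots+x_dy_du_d)}$, $j_\alpha(z)=z^{-\alpha}J_\alpha(z)$ ($J_\alpha$ the Bessel function), $\Phi_\kappa(u)=\prod_{i=1}^d(1+u_i)(1-u_i^2)^{\kappa_i-1}$,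 $C_\kappa=\frac{2^{\alpha_\kappa-1}\Gamma(\alpha_\kappa+\frac12)}{\sqrt\pi}\prod_{i=1}^dc_{\kappa_i-\frac12}$, $c_\lambda=\frac{\Gamma(\lambda+1)}{\Gamma(\frac12)\Gamma(\lambda+\frac12)}$; if $\kappa_i=0$, then $c_{\kappa_i-\frac12}\int_{-1}^1f(u_i)(1+u_i)(1-u_i^2)^{\kappa_i-1}du_i$ is understood as its limit $f(1)$. If $\alpha_\kappa=0$ (i.e. $d=2$, $\kappa=0$), then with $\rho=\sqrt{\frac12(ts+\langle x,y\rangle)}$, $$\mathsf{T}_{(x,t)}g(y,s)=\tfrac12\big[e^{-\rho}g(t+s+2\rho)+e^{\rho}g(t+s-2\rho)\big]-\tfrac12\rho^2\int_0^\pi g(t+s+2\rho\cos\theta)e^{-\rho\cos\theta}j_1(\rho\sin\theta)\sin\theta\,d\theta.$$ Pseudo convolution: $f*g(x,t)=\mathsf{b}_\kappa\int_{\mathbb{V}_0^{d+1}}f(y,s)\,\mathsf{T}_{(x,t)}g(y,s)\,\mathsf{w}_\kappa(y,s)\,d\sigma(y,s)$. *)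

theory Defs
  imports "HOL-Probability.Probability"
begin

text \<open>
  The dimension \<open>d\<close> is \<^term>\<open>CARD('n)\<close>; a point of the conic surface is a pair of type
  \<^typ>\<open>(real ^ 'n) \<times> real\<close>. Norms are extended nonnegative integrals, and functions are
  Borel measurable representatives.
\<close>

section \<open>The conic surface and its measure\<close>

text \<open>
  Surface measure of the unit sphere in polar-coordinate form:
  \<open>A\<close> has measure \<open>d\<close> times the Lebesgue measure of \<open>{r \<xi> | 0 < r \<le> 1, \<xi> \<in> A}\<close>
  (note \<open>sgn x = x / norm x\<close>).
\<close>
definition sphere_measure :: "(real ^ 'n) measure" where
  "sphere_measure =
     scale_measure (ennreal (real CARD('n)))
       (distr (restrict_space lborel (cball 0 1 - {0})) (restrict_space borel (sphere 0 1)) sgn)"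

definition conic_surface :: "((real ^ 'n) \<times> real) set" where
  "conic_surface = {(x, t). 0 \<le> t \<and> norm x = t}"

definition conic_measure :: "((real ^ 'n) \<times> real) measure" where
  "conic_measure =
     distr
       (density (sphere_measure \<Otimes>\<^sub>M restrict_space lborel {0..})
         (\<lambda>(\<xi>, t). ennreal (t ^ (CARD('n) - 1))))
       (restrict_space borel conic_surface)
       (\<lambda>(\<xi>, t). (t *\<^sub>R \<xi>, t))"

section \<open>Weights, norms and spaces\<close>

definition alpha :: "real ^ 'n \<Rightarrow> real" where
  "alpha \<kappa> = (\<Sum>i\<in>UNIV. \<kappa> $ i) + (real CARD('n) - 2) / 2"

text \<open>The case distinction is there because \<open>0 powr 0 = 0\<close>.\<close>
definition h_weight :: "real ^ 'n \<Rightarrow> real ^ 'n \<Rightarrow> real" where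
  "h_weight \<kappa> x = (\<Prod>i\<in>UNIV. if \<kappa> $ i = 0 then 1 else \<bar>x $ i\<bar> powr (\<kappa> $ i))"

definition u_weight :: "real ^ 'n \<Rightarrow> (real ^ 'n) \<times> real \<Rightarrow> real" where
  "u_weight \<kappa> = (\<lambda>(x, t). (h_weight \<kappa> x)\<^sup>2 * inverse t)"

definition w_weight :: "real ^ 'n \<Rightarrow> (real ^ 'n) \<times> real \<Rightarrow> real" where
  "w_weight \<kappa> = (\<lambda>(x, t). (h_weight \<kappa> x)\<^sup>2 * inverse t * exp (- t))"

definition b_const :: "real ^ 'n \<Rightarrow> real" where
  "b_const \<kappa> = 1 / (LINT p|conic_measure. w_weight \<kappa> p)"

definition norm1 :: "real ^ 'n \<Rightarrow> ((real ^ 'n) \<times> real \<Rightarrow> real) \<Rightarrow> ennreal" where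
  "norm1 \<kappa> f = ennreal (b_const \<kappa>) *
     (\<integral>\<^sup>+(x, t). ennreal (\<bar>f (x, t)\<bar> * exp (- t / 2) * u_weight \<kappa> (x, t)) \<partial>conic_measure)"

definition norm1_star :: "real ^ 'n \<Rightarrow> ((real ^ 'n) \<times> real \<Rightarrow> real) \<Rightarrow> ennreal" where
  "norm1_star \<kappa> f = ennreal (b_const \<kappa>) *
     (\<integral>\<^sup>+(x, t). ennreal (\<bar>f (x, t)\<bar> * exp (- t / 2) * sqrt t * u_weight \<kappa> (x, t)) \<partial>conic_measure)"

definition L1_cone :: "real ^ 'n \<Rightarrow> ((real ^ 'n) \<times> real \<Rightarrow> real) set" where
  "L1_cone \<kappa> = {f \<in> borel_measurable conic_measure. norm1 \<kappa> f < \<infinity>}"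

definition L1_cone_star :: "real ^ 'n \<Rightarrow> ((real ^ 'n) \<times> real \<Rightarrow> real) set" where
  "L1_cone_star \<kappa> = {f \<in> borel_measurable conic_measure. norm1_star \<kappa> f < \<infinity>}"

definition norm1_half_line :: "real \<Rightarrow> (real \<Rightarrow> real) \<Rightarrow> ennreal" where
  "norm1_half_line a g = ennreal (1 / Gamma (a + 1)) *
     (\<integral>\<^sup>+t. ennreal (\<bar>g t\<bar> * exp (- t / 2) * t powr a) \<partial>restrict_space lborel {0..})"

definition L1_half_line :: "real \<Rightarrow> (real \<Rightarrow> real) set" where
  "L1_half_line a =
     {g \<in> borel_measurable (restrict_space lborel {0..}). norm1_half_line a g < \<infinity>}"

section \<open>Bessel functions\<close>

text \<open>Bessel function of the first kind, for arguments \<open>z > 0\<close>.\<close>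
definition Bessel_J :: "real \<Rightarrow> real \<Rightarrow> real" where
  "Bessel_J a z = (\<Sum>k. (-1) ^ k / (fact k * Gamma (real k + a + 1)) * (z / 2) powr (2 * real k + a))"

text \<open>The value at \<open>0\<close> is the continuous extension.\<close>
definition bessel_j :: "real \<Rightarrow> real \<Rightarrow> real" where
  "bessel_j a z = (if z = 0 then 1 / (2 powr a * Gamma (a + 1)) else z powr (- a) * Bessel_J a z)"

section \<open>Generalized translation and pseudo convolution\<close>

definition c_const :: "real \<Rightarrow> real" where
  "c_const l = Gamma (l + 1) / (Gamma (1 / 2) * Gamma (l + 1 / 2))"

text \<open>
  The probability measure \<open>c\<^bsub>k-1/2\<^esub> (1 + u) (1 - u\<^sup>2)\<^bsup>k-1\<^esup> du\<close> on \<open>[-1, 1]\<close>; for \<open>k = 0\<close> it is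
  the limiting point mass at \<open>1\<close>. The product of these over the coordinates is \<open>\<Phi>\<^sub>\<kappa>(u) du\<close>
  together with the factors \<open>c\<^bsub>\<kappa>\<^sub>i-1/2\<^esub>\<close> of the constant \<open>C\<^sub>\<kappa>\<close>.
\<close>
definition u_measure :: "real \<Rightarrow> real measure" where
  "u_measure k =
     (if k = 0 then return (restrict_space borel {-1..1}) 1
      else density (restrict_space lborel {-1..1})
        (\<lambda>u. ennreal (c_const (k - 1 / 2) * ((1 + u) * (1 - u\<^sup>2) powr (k - 1)))))"

definition Phi_measure :: "real ^ 'n \<Rightarrow> ('n \<Rightarrow> real) measure" where
  "Phi_measure \<kappa> = (\<Pi>\<^sub>M i\<in>UNIV. u_measure (\<kappa> $ i))"

definition rho :: "(real ^ 'n) \<times> real \<Rightarrow> (real ^ 'n) \<times> real \<Rightarrow> ('n \<Rightarrow> real) \<Rightarrow> real" where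
  "rho = (\<lambda>(x, t) (y, s) u. sqrt ((t * s + (\<Sum>i\<in>UNIV. x $ i * y $ i * u i)) / 2))"

definition rho_zero :: "(real ^ 'n) \<times> real \<Rightarrow> (real ^ 'n) \<times> real \<Rightarrow> real" where
  "rho_zero = (\<lambda>(x, t) (y, s). sqrt ((t * s + x \<bullet> y) / 2))"

definition theta_measure :: "real measure" where
  "theta_measure = restrict_space lborel {0..pi}"

definition trans_integrand ::
  "real ^ 'n \<Rightarrow> (real \<Rightarrow> real) \<Rightarrow> (real ^ 'n) \<times> real \<Rightarrow> (real ^ 'n) \<times> real \<Rightarrow>
   ('n \<Rightarrow> real) \<Rightarrow> real \<Rightarrow> real" where
  "trans_integrand \<kappa> g p q u \<theta> =
     (let \<rho> = rho p q u in
      g (snd p + snd q + 2 * \<rho> * cos \<theta>) * exp (- \<rho> * cos \<theta>) *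
      bessel_j (alpha \<kappa> - 1) (\<rho> * sin \<theta>) * sin \<theta> powr (2 * alpha \<kappa> - 1))"

definition trans_integrand_zero ::
  "(real \<Rightarrow> real) \<Rightarrow> (real ^ 'n) \<times> real \<Rightarrow> (real ^ 'n) \<times> real \<Rightarrow> real \<Rightarrow> real" where
  "trans_integrand_zero g p q \<theta> =
     (let \<rho> = rho_zero p q in
      g (snd p + snd q + 2 * \<rho> * cos \<theta>) * exp (- \<rho> * cos \<theta>) *
      bessel_j 1 (\<rho> * sin \<theta>) * sin \<theta>)"

definition translation ::
  "real ^ 'n \<Rightarrow> (real \<Rightarrow> real) \<Rightarrow> (real ^ 'n) \<times> real \<Rightarrow> (real ^ 'n) \<times> real \<Rightarrow> real" where
  "translation \<kappa> g p q =
     (if alpha \<kappa> = 0 then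
        let t = snd p; s = snd q; \<rho> = rho_zero p q in
        1 / 2 * (exp (- \<rho>) * g (t + s + 2 * \<rho>) + exp \<rho> * g (t + s - 2 * \<rho>))
        - 1 / 2 * \<rho>\<^sup>2 * (LINT \<theta>|theta_measure. trans_integrand_zero g p q \<theta>)
      else
        2 powr (alpha \<kappa> - 1) * Gamma (alpha \<kappa> + 1 / 2) / sqrt pi *
        (LINT u|Phi_measure \<kappa>. (LINT \<theta>|theta_measure. trans_integrand \<kappa> g p q u \<theta>)))"

definition pseudo_conv ::
  "real ^ 'n \<Rightarrow> ((real ^ 'n) \<times> real \<Rightarrow> real) \<Rightarrow> (real \<Rightarrow> real) \<Rightarrow> (real ^ 'n) \<times> real \<Rightarrow> real" where
  "pseudo_conv \<kappa> f g p =
     b_const \<kappa> * (LINT q|conic_measure. f q * translation \<kappa> g p q * w_weight \<kappa> q)"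

text \<open>
  The Bochner integral of a non-integrable function is \<open>0\<close>, so the absolute convergence of the
  integrals in \<^const>\<open>translation\<close> and \<^const>\<open>pseudo_conv\<close> is expressed separately.
\<close>
definition translation_defined ::
  "real ^ 'n \<Rightarrow> (real \<Rightarrow> real) \<Rightarrow> (real ^ 'n) \<times> real \<Rightarrow> (real ^ 'n) \<times> real \<Rightarrow> bool" where
  "translation_defined \<kappa> g p q \<longleftrightarrow>
     (if alpha \<kappa> = 0 then integrable theta_measure (trans_integrand_zero g p q)
      else integrable (Phi_measure \<kappa> \<Otimes>\<^sub>M theta_measure) (\<lambda>(u, \<theta>). trans_integrand \<kappa> g p q u \<theta>))"

definition pseudo_conv_defined ::
  "real ^ 'n \<Rightarrow> ((real ^ 'n) \<times> real \<Rightarrow> real) \<Rightarrow> (real \<Rightarrow> real) \<Rightarrow> (real ^ 'n) \<times> real \<Rightarrow> bool" where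
  "pseudo_conv_defined \<kappa> f g p \<longleftrightarrow>
     (AE q in conic_measure. translation_defined \<kappa> g p q) \<and>
     integrable conic_measure (\<lambda>q. f q * translation \<kappa> g p q * w_weight \<kappa> q)"

section \<open>The defining integration formula of the conic measure\<close>

lemma sets_sphere_measure [measurable_cong]:
  "sets (sphere_measure :: (real ^ 'n) measure) = sets (restrict_space borel (sphere 0 1))"
  by (simp add: sphere_measure_def)

lemma space_sphere_measure: "space (sphere_measure :: (real ^ 'n) measure) = sphere 0 1"
  by (simp add: sphere_measure_def space_scale_measure space_restrict_space)

lemma measurable_conic_map:
  "(\<lambda>(\<xi>, t). (t *\<^sub>R \<xi>, t)) \<in>
     (sphere_measure :: (real ^ 'n) measure) \<Otimes>\<^sub>M restrict_space lborel {0..}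
       \<rightarrow>\<^sub>M restrict_space borel conic_surface"
proof (rule measurable_restrict_space2)
  show "(\<lambda>(\<xi>, t). (t *\<^sub>R \<xi>, t)) \<in> space ((sphere_measure :: (real ^ 'n) measure) \<Otimes>\<^sub>M
      restrict_space lborel {0..}) \<rightarrow> conic_surface"
    by (auto simp: space_pair_measure space_sphere_measure space_restrict_space conic_surface_def)
  have a: "fst \<in> (sphere_measure :: (real ^ 'n) measure) \<Otimes>\<^sub>M restrict_space lborel {0::real..} \<rightarrow>\<^sub>M borel"
    by (rule measurable_compose[OF measurable_fst])
      (simp add: measurable_cong_sets[OF sets_sphere_measure refl] measurable_restrict_space1)
  have b: "snd \<in> (sphere_measure :: (real ^ 'n) measure) \<Otimes>\<^sub>M restrict_space lborel {0::real..} \<rightarrow>\<^sub>M borel"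
    by (rule measurable_compose[OF measurable_snd]) (simp add: measurable_restrict_space1)
  show "(\<lambda>(\<xi>, t). (t *\<^sub>R \<xi>, t)) \<in> (sphere_measure :: (real ^ 'n) measure) \<Otimes>\<^sub>M
      restrict_space lborel {0..} \<rightarrow>\<^sub>M borel"
    unfolding split_beta borel_prod[symmetric]
    using a b by (intro measurable_Pair borel_measurable_scaleR)
qed

lemma measurable_sgn_sphere:
  "(sgn :: real ^ 'n \<Rightarrow> real ^ 'n) \<in>
     restrict_space lborel (cball 0 1 - {0}) \<rightarrow>\<^sub>M restrict_space borel (sphere 0 1)"
proof (rule measurable_restrict_space2)
  have "(\<lambda>x :: real ^ 'n. inverse (norm x) *\<^sub>R x) \<in> borel_measurable borel"
    by measurable
  then have "(sgn :: real ^ 'n \<Rightarrow> real ^ 'n) \<in> borel_measurable lborel"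
    by (simp add: sgn_div_norm[abs_def])
  then show "(sgn :: real ^ 'n \<Rightarrow> real ^ 'n) \<in>
      borel_measurable (restrict_space lborel (cball 0 1 - {0}))"
    by (rule measurable_restrict_space1)
qed (auto simp: space_restrict_space norm_sgn)

lemma finite_measure_sphere_measure: "finite_measure (sphere_measure :: (real ^ 'n) measure)"
proof
  let ?R = "restrict_space lborel (cball 0 1 - {0 :: real ^ 'n})"
  let ?D = "distr ?R (restrict_space borel (sphere 0 1)) sgn"
  have "emeasure ?D (space ?D) = emeasure ?R (space ?R)"
    using measurable_space[OF measurable_sgn_sphere[where 'n = 'n]]
    by (subst emeasure_distr[OF measurable_sgn_sphere])
      (auto intro!: arg_cong[where f = "emeasure ?R"] simp: sets_restrict_space_iff)
  also have "\<dots> = emeasure lborel (cball 0 1 - {0 :: real ^ 'n})"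
    by (simp add: emeasure_restrict_space space_restrict_space)
  also have "\<dots> < \<infinity>"
    using emeasure_bounded_finite[of "cball 0 1 - {0} :: (real ^ 'n) set"]
    by (simp add: bounded_diff)
  finally show "emeasure (sphere_measure :: (real ^ 'n) measure) (space sphere_measure) \<noteq> \<infinity>"
    by (simp add: sphere_measure_def space_scale_measure ennreal_mult_eq_top_iff)
qed

lemma nn_integral_conic_measure:
  fixes f :: "(real ^ 'n) \<times> real \<Rightarrow> ennreal"
  assumes f: "f \<in> borel_measurable (restrict_space borel conic_surface)"
  shows "(\<integral>\<^sup>+p. f p \<partial>conic_measure) =
    (\<integral>\<^sup>+t. ennreal (t ^ (CARD('n) - 1)) * (\<integral>\<^sup>+\<xi>. f (t *\<^sub>R \<xi>, t) \<partial>sphere_measure)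
       \<partial>restrict_space lborel {0..})"
proof -
  let ?L = "restrict_space lborel {0::real..}"
  let ?S = "sphere_measure :: (real ^ 'n) measure"
  interpret S: finite_measure ?S by (rule finite_measure_sphere_measure)
  interpret L: sigma_finite_measure ?L
    by (rule sigma_finite_measure_restrict_space) (auto simp: sigma_finite_lborel)
  interpret P: pair_sigma_finite ?S ?L by standard
  have m: "(\<lambda>(\<xi>, t). (t *\<^sub>R \<xi>, t)) \<in> ?S \<Otimes>\<^sub>M ?L \<rightarrow>\<^sub>M restrict_space borel conic_surface"
    by (rule measurable_conic_map)
  have g: "(\<lambda>z. f (snd z *\<^sub>R fst z, snd z)) \<in> borel_measurable (?S \<Otimes>\<^sub>M ?L)"
    using measurable_compose[OF m f] by (simp add: split_beta)
  have w: "(\<lambda>z. ennreal (snd z ^ (CARD('n) - 1))) \<in> borel_measurable (?S \<Otimes>\<^sub>M ?L)"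
    by (rule measurable_compose[OF measurable_snd]) (simp add: measurable_restrict_space1)
  have "(\<integral>\<^sup>+p. f p \<partial>conic_measure) =
      (\<integral>\<^sup>+z. ennreal (snd z ^ (CARD('n) - 1)) * f (snd z *\<^sub>R fst z, snd z) \<partial>(?S \<Otimes>\<^sub>M ?L))"
    unfolding conic_measure_def using m f g w
    by (simp add: nn_integral_distr nn_integral_density split_beta)
  also have "\<dots> = (\<integral>\<^sup>+t. (\<integral>\<^sup>+\<xi>. ennreal (t ^ (CARD('n) - 1)) * f (t *\<^sub>R \<xi>, t) \<partial>?S) \<partial>?L)"
    using P.nn_integral_snd[OF borel_measurable_times_ennreal[OF w g]] by simp
  also have "\<dots> = (\<integral>\<^sup>+t. ennreal (t ^ (CARD('n) - 1)) * (\<integral>\<^sup>+\<xi>. f (t *\<^sub>R \<xi>, t) \<partial>?S) \<partial>?L)"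
  proof (intro nn_integral_cong nn_integral_cmult)
    fix t :: real assume t: "t \<in> space ?L"
    show "(\<lambda>\<xi>. f (t *\<^sub>R \<xi>, t)) \<in> borel_measurable ?S"
      using measurable_compose[OF measurable_Pair2'[OF t] g] by simp
  qed
  finally show ?thesis .
qed

end

theory Submission
  imports Defs
begin

text \<open>
  Fix \<open>q = (y, s)\<close> with \<open>s > 0\<close> and put \<open>c = \<surd>s\<close>, \<open>a = \<alpha>\<^sub>\<kappa>\<close>. By Fubini it suffices to bound the integral of
  \<open>|T\<^sub>p g(q)| e\<^bsup>-t/2\<^esup>\<close> against \<open>u\<^sub>\<kappa> d\<sigma>\<close> over \<open>p = (x, t)\<close>. Let \<open>V = \<Sum> x\<^sub>i y\<^sub>i u\<^sub>i / s\<close>. Splitting each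
  \<open>x\<^sub>i\<^sup>2\<close> into \<open>(x\<^sub>i u\<^sub>i)\<^sup>2\<close> and \<open>x\<^sub>i\<^sup>2 (1 - u\<^sub>i\<^sup>2)\<close> turns the weights into independent power laws, and after a
  rotation \<open>P = (t + V)/2\<close> and \<open>Q = (t - V)/2\<close> become independent, both with density proportional to
  \<open>r\<^bsup>a - 1/2\<^esup>\<close>. Since \<open>\<rho> = c \<surd>P\<close>, in the variables \<open>X = \<surd>P cos \<theta>\<close> and \<open>Y = P sin\<^sup>2 \<theta>\<close> the
  argument of \<open>g\<close> is \<open>(X + c)\<^sup>2 + Y + Q\<close>, the exponentials combine to \<open>e\<^bsup>s/2\<^esup> exp (- ((X + c)\<^sup>2 + Y + Q)/2)\<close>,
  and the measure is \<open>Y\<^bsup>a - 1\<^esup> Q\<^bsup>a - 1/2\<^esup> dX dY dQ\<close>. Translation invariance in \<open>X\<close> removes the shift by \<open>c\<close>, and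
  convolving the power laws leaves the weight \<open>\<tau>\<^bsup>2a\<^esup>\<close>. Only the Bessel factor, evaluated at \<open>c \<surd>Y\<close>, remains:
  the normalised function satisfies \<open>|j(z)| \<le> 1 + z \<Gamma>(a) / \<Gamma>(a + 1/2)\<close> for \<open>0 < a \<le> 1/2\<close>, which gives the two
  terms of the estimate with constant \<open>1\<close>. For \<open>a = 0\<close> the boundary terms give the first norm and
  \<open>z |j\<^sub>1(z)| \<le> 1\<close> the second.
\<close>

section \<open>Power-law measures on the half-line\<close>

text \<open>The Bessel factor decides the form of the estimate. For \<open>a < 1/2\<close> the
  function j of order \<open>a - 1\<close> is unbounded, so a bound linear in the argument takes the
  place of a constant one. The argument factors as \<open>c * sqrt Y\<close>: the part c = sqrt s
  goes to f and creates the starred norm, while sqrt Y goes to g and raises the exponent of its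
  power law by 1/2. Passing from \<open>riesz a\<close> to \<open>riesz (a + 1/2)\<close> costs
  Gamma (a + 1/2) / Gamma a, the reciprocal of the slope in the Bessel bound; this is why the second
  constant is 1 as well. P and Q are independent because t^2 - V^2 = 4 P Q: a power of the left side
  is a product of powers of P and Q. Planar changes of variables are done as shears in one real
  variable with Tonelli in between, and all integrals are extended nonnegative ones. Convergence of
  the translation and of the convolution is then a consequence of the bound and not a preparation
  for it.\<close>

lemma nn_integral_swap:
  assumes "sigma_finite_measure M" "sigma_finite_measure N"
    and "(\<lambda>(x, y). f x y) \<in> borel_measurable (M \<Otimes>\<^sub>M N)"
  shows "(\<integral>\<^sup>+x. \<integral>\<^sup>+y. f x y \<partial>N \<partial>M) = (\<integral>\<^sup>+y. \<integral>\<^sup>+x. f x y \<partial>M \<partial>N)"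
proof -
  interpret pair_sigma_finite M N
    using assms by (simp add: pair_sigma_finite_def)
  show ?thesis using Fubini'[OF assms(3)] by simp
qed

text \<open>Normalised so that \<open>riesz a\<close> and \<open>riesz b\<close> convolve to \<open>riesz (a + b)\<close>, with the point mass at \<open>0\<close> as unit.\<close>
definition riesz :: "real \<Rightarrow> real measure" where
  "riesz a = (if a = 0 then return borel 0
     else density lborel (\<lambda>y. ennreal (if 0 < y then y powr (a - 1) / Gamma a else 0)))"

lemma sets_riesz [simp, measurable_cong]: "sets (riesz a) = sets borel"
  by (simp add: riesz_def)

lemma space_riesz [simp]: "space (riesz a) = UNIV"
  by (simp add: riesz_def)

lemma sigma_finite_riesz: "sigma_finite_measure (riesz a)"
proof (cases "a = 0")
  case True
  interpret prob_space "return borel (0::real)" by (rule prob_space_return) simp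
  show ?thesis unfolding riesz_def using True sigma_finite_measure_axioms by simp
next
  case False
  then have g: "riesz a = density lborel (\<lambda>y. ennreal (if 0 < y then y powr (a - 1) / Gamma a else 0))"
    by (simp add: riesz_def)
  show ?thesis unfolding g
    by (subst sigma_finite_measure.sigma_finite_iff_density_finite[OF sigma_finite_lborel]) auto
qed

lemma nn_integral_riesz_0:
  "F \<in> borel_measurable borel \<Longrightarrow> (\<integral>\<^sup>+y. F y \<partial>riesz 0) = F 0"
  by (simp add: riesz_def nn_integral_return)

lemma nn_integral_riesz_pos:
  assumes "0 < a" "F \<in> borel_measurable borel"
  shows "(\<integral>\<^sup>+y. F y \<partial>riesz a)
    = (\<integral>\<^sup>+y. ennreal (if 0 < y then y powr (a - 1) / Gamma a else 0) * F y \<partial>lborel)"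
  using assms by (simp add: riesz_def nn_integral_density)

lemma Beta_convolution:
  fixes a b t :: real
  assumes "0 < a" "0 < b" "0 < t"
  shows "(\<integral>\<^sup>+x. ennreal (if 0 < x \<and> x < t then x powr (a - 1) * (t - x) powr (b - 1) else 0) \<partial>lborel)
    = ennreal (Beta a b * t powr (a + b - 1))"
proof -
  have *: "(\<integral>\<^sup>+x. ennreal (if 0 < x \<and> x < 1 then x powr (a - 1) * (1 - x) powr (b - 1) else 0) \<partial>lborel) = ennreal (Beta a b)"
  proof -
    have "(\<integral>\<^sup>+x\<in>{0..1}. ennreal (x powr (a - 1) * (1 - x) powr (b - 1)) \<partial>lborel) = ennreal (Beta a b)"
      by (rule nn_integral_has_integral_lebesgue'[OF _ has_integral_Beta_real[OF assms(1,2)]]) simp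
    moreover have "(\<integral>\<^sup>+x\<in>{0..1}. ennreal (x powr (a - 1) * (1 - x) powr (b - 1)) \<partial>lborel)
      = (\<integral>\<^sup>+x. ennreal (if 0 < x \<and> x < 1 then x powr (a - 1) * (1 - x) powr (b - 1) else 0) \<partial>lborel)"
      by (rule nn_integral_cong_AE, rule eventually_mono[OF AE_conjI[OF AE_lborel_singleton[of 0] AE_lborel_singleton[of 1]]])
        (auto simp: indicator_def)
    ultimately show ?thesis by simp
  qed
  have "(\<integral>\<^sup>+x. ennreal (if 0 < x \<and> x < t then x powr (a - 1) * (t - x) powr (b - 1) else 0) \<partial>lborel)
      = ennreal t * (\<integral>\<^sup>+x. ennreal (if 0 < t * x \<and> t * x < t then (t * x) powr (a - 1) * (t - t * x) powr (b - 1) else 0) \<partial>lborel)"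
    using assms by (subst nn_integral_real_affine[where t = 0 and c = t]) (simp_all cong: if_cong)
  also have "\<dots> = ennreal t * (\<integral>\<^sup>+x. ennreal (t powr (a + b - 2)) * ennreal (if 0 < x \<and> x < 1 then x powr (a - 1) * (1 - x) powr (b - 1) else 0) \<partial>lborel)"
  proof (intro arg_cong2[where f = "(*)"] refl nn_integral_cong)
    fix x :: real
    have "(t * x) powr (a - 1) * (t - t * x) powr (b - 1) = t powr (a + b - 2) * (x powr (a - 1) * (1 - x) powr (b - 1))"
      if "0 < x" "x < 1"
    proof -
      have "(t - t * x) = t * (1 - x)" by (simp add: algebra_simps)
      then show ?thesis using assms that
        by (simp add: powr_mult powr_add[symmetric] mult_ac)
    qed
    then show "ennreal (if 0 < t * x \<and> t * x < t then (t * x) powr (a - 1) * (t - t * x) powr (b - 1) else 0) = ennreal (t powr (a + b - 2)) * ennreal (if 0 < x \<and> x < 1 then x powr (a - 1) * (1 - x) powr (b - 1) else 0)"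
      using assms by (auto simp: ennreal_mult zero_less_mult_iff)
  qed
  also have "\<dots> = ennreal t * (ennreal (t powr (a + b - 2)) * ennreal (Beta a b))"
    by (subst nn_integral_cmult) (simp_all add: *)
  also have "\<dots> = ennreal (Beta a b * t powr (a + b - 1))"
  proof -
    have "0 \<le> Beta a b" using assms by (simp add: Beta_def Gamma_real_pos less_imp_le)
    moreover have "t * t powr (a + b - 2) = t powr (a + b - 1)"
      using assms powr_add[of t 1 "a + b - 2"] by simp
    ultimately show ?thesis using assms
      by (simp add: ennreal_mult[symmetric] mult_ac)
  qed
  finally show ?thesis .
qed

lemma riesz_convolution:
  assumes "0 \<le> a" "0 \<le> b" and [measurable]: "F \<in> borel_measurable borel"
  shows "(\<integral>\<^sup>+x. \<integral>\<^sup>+y. F (x + y) \<partial>riesz b \<partial>riesz a) = (\<integral>\<^sup>+t. F t \<partial>riesz (a + b))"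
proof -
  interpret gb: sigma_finite_measure "riesz b" by (rule sigma_finite_riesz)
  consider "a = 0" | "b = 0" | "0 < a" "0 < b" using assms by linarith
  then show ?thesis
  proof cases
    case 1
    then show ?thesis by (simp add: nn_integral_riesz_0)
  next
    case 2
    have "(\<lambda>y. F (x + y)) \<in> borel_measurable borel" for x by measurable
    then show ?thesis using 2 by (simp add: nn_integral_riesz_0)
  next
    case 3
    define k where "k c y = ennreal (if 0 < y then y powr (c - 1) / Gamma c else 0)" for c y :: real
    have [measurable]: "k c \<in> borel_measurable borel" for c unfolding k_def by measurable
    have G: "0 < Gamma a" "0 < Gamma b" "0 < Gamma (a+b)" using 3 by (auto intro: Gamma_real_pos)
    have "(\<integral>\<^sup>+x. \<integral>\<^sup>+y. F (x + y) \<partial>riesz b \<partial>riesz a)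
        = (\<integral>\<^sup>+x. k a x * (\<integral>\<^sup>+y. k b y * F (x + y) \<partial>lborel) \<partial>lborel)"
      unfolding k_def using 3 by (simp add: nn_integral_riesz_pos)
    also have "\<dots> = (\<integral>\<^sup>+x. \<integral>\<^sup>+y. k a x * (k b y * F (x + y)) \<partial>lborel \<partial>lborel)"
      by (intro nn_integral_cong nn_integral_cmult[symmetric]) measurable
    also have "\<dots> = (\<integral>\<^sup>+x. \<integral>\<^sup>+t. k a x * (k b (t - x) * F t) \<partial>lborel \<partial>lborel)"
    proof (rule nn_integral_cong)
      fix x :: real
      show "(\<integral>\<^sup>+y. k a x * (k b y * F (x + y)) \<partial>lborel) = (\<integral>\<^sup>+t. k a x * (k b (t - x) * F t) \<partial>lborel)"
        by (subst nn_integral_real_affine[where t = "-x" and c = 1]) (simp_all add: algebra_simps)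
    qed
    also have "\<dots> = (\<integral>\<^sup>+t. \<integral>\<^sup>+x. k a x * (k b (t - x) * F t) \<partial>lborel \<partial>lborel)"
      by (intro nn_integral_swap) (auto intro: lborel.sigma_finite_measure_axioms)
    also have "\<dots> = (\<integral>\<^sup>+t. k (a + b) t * F t \<partial>lborel)"
    proof (rule nn_integral_cong)
      fix t :: real
      have "(\<integral>\<^sup>+x. k a x * (k b (t - x) * F t) \<partial>lborel) = (\<integral>\<^sup>+x. k a x * k b (t - x) \<partial>lborel) * F t"
        by (subst nn_integral_multc[symmetric]) (auto simp: mult.assoc)
      \<comment> \<open>For fixed t this is \<open>Beta a b\<close> times t^(a + b - 1); the two
        Gamma factors turn \<open>Beta a b\<close> into 1 / Gamma (a + b).\<close>
      also have "(\<integral>\<^sup>+x. k a x * k b (t - x) \<partial>lborel)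
          = (\<integral>\<^sup>+x. ennreal (1 / (Gamma a * Gamma b)) * ennreal (if 0 < x \<and> x < t then x powr (a - 1) * (t - x) powr (b - 1) else 0) \<partial>lborel)"
        using G by (intro nn_integral_cong) (auto simp: k_def ennreal_mult'[symmetric])
      also have "\<dots> = ennreal (1 / (Gamma a * Gamma b)) * (\<integral>\<^sup>+x. ennreal (if 0 < x \<and> x < t then x powr (a - 1) * (t - x) powr (b - 1) else 0) \<partial>lborel)"
        by (rule nn_integral_cmult) measurable
      also have "\<dots> = k (a + b) t"
      proof (cases "0 < t")
        case True
        have "Beta a b / (Gamma a * Gamma b) = 1 / Gamma (a + b)"
          using G by (simp add: Beta_def)
        then show ?thesis unfolding Beta_convolution[OF 3 True] using G True
          by (simp add: k_def ennreal_mult'[symmetric] Beta_def)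
      next
        case False
        then have "(\<lambda>x. ennreal (if 0 < x \<and> x < t then x powr (a - 1) * (t - x) powr (b - 1) else 0)) = (\<lambda>_. 0)"
          by auto
        then show ?thesis using False by (simp add: k_def)
      qed
      finally show "(\<integral>\<^sup>+x. k a x * (k b (t - x) * F t) \<partial>lborel) = k (a + b) t * F t" .
    qed
    also have "\<dots> = (\<integral>\<^sup>+t. F t \<partial>riesz (a + b))"
      unfolding k_def using 3 by (simp add: nn_integral_riesz_pos)
    finally show ?thesis .
  qed
qed

text \<open>Euler's integral for Gamma. The test function exp (- y) later fixes the normalisations:
  the total mass of \<open>u_measure\<close> and the value of \<open>b_const\<close>.\<close>

lemma nn_integral_riesz_exp:
  assumes "0 \<le> a"
  shows "(\<integral>\<^sup>+y. ennreal (exp (- y)) \<partial>riesz a) = 1"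
proof (cases "a = 0")
  case True then show ?thesis by (simp add: nn_integral_riesz_0)
next
  case False
  then have a: "0 < a" "0 < Gamma a" using assms by (auto intro: Gamma_real_pos)
  have "(\<integral>\<^sup>+y. ennreal (exp (- y)) \<partial>riesz a)
      = (\<integral>\<^sup>+y. ennreal (1 / Gamma a) * (ennreal (y powr (a - 1) / exp y) * indicator {0..} y) \<partial>lborel)"
    using a by (subst nn_integral_riesz_pos)
      (auto intro!: nn_integral_cong_AE eventually_mono[OF AE_lborel_singleton[of 0]] simp: indicator_def ennreal_mult'[symmetric] exp_minus field_simps)
  also have "\<dots> = ennreal (1 / Gamma a) * (\<integral>\<^sup>+y\<in>{0..}. ennreal (y powr (a - 1) / exp y) \<partial>lborel)"
    by (rule nn_integral_cmult) measurable
  also have "(\<integral>\<^sup>+y\<in>{0..}. ennreal (y powr (a - 1) / exp y) \<partial>lborel) = ennreal (Gamma a)"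
    by (rule nn_integral_has_integral_lebesgue'[OF _ Gamma_integral_real[OF a(1)]]) simp
  finally show ?thesis using a by (simp add: ennreal_mult'[symmetric])
qed

section \<open>Squaring as a change of variables on the line\<close>

lemma nn_integral_atLeast_SUP:
  fixes h :: "real \<Rightarrow> ennreal"
  assumes [measurable]: "h \<in> borel_measurable borel"
  shows "(\<integral>\<^sup>+x\<in>{0..}. h x \<partial>lborel) = (SUP n::nat. \<integral>\<^sup>+x\<in>{0..real n}. h x \<partial>lborel)"
proof -
  have "(SUP n::nat. h x * indicator {0..real n} x) = h x * indicator {0..} x" for x
  proof (cases "0 \<le> x")
    case True
    obtain N :: nat where "x \<le> real N" using real_arch_simple by blast
    then have "h x * indicator {0..} x = h x * indicator {0..real N} x" using True by simp
    also have "\<dots> \<le> (SUP n::nat. h x * indicator {0..real n} x)" by (rule SUP_upper) simp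
    finally show ?thesis
      by (intro antisym SUP_least) (auto simp: indicator_def)
  next
    case False
    then show ?thesis by simp
  qed
  then have "(\<integral>\<^sup>+x\<in>{0..}. h x \<partial>lborel) = (\<integral>\<^sup>+x. (SUP n::nat. h x * indicator {0..real n} x) \<partial>lborel)"
    by simp
  also have "\<dots> = (SUP n::nat. \<integral>\<^sup>+x\<in>{0..real n}. h x \<partial>lborel)"
    by (rule nn_integral_monotone_convergence_SUP)
      (auto simp: incseq_def le_fun_def indicator_def)
  finally show ?thesis .
qed

text \<open>The substitution rule acts on compact intervals; both sides then exhaust the half-line,
  the left one along the intervals from 0 to n^2.\<close>

lemma nn_integral_square_substitution:
  fixes F :: "real \<Rightarrow> ennreal"
  assumes [measurable]: "F \<in> borel_measurable borel"
  shows "(\<integral>\<^sup>+y\<in>{0..}. F y \<partial>lborel) = (\<integral>\<^sup>+x\<in>{0..}. F (x\<^sup>2) * ennreal (2 * x) \<partial>lborel)"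
proof -
  have sub: "(\<integral>\<^sup>+y\<in>{0..(real n)\<^sup>2}. F y \<partial>lborel) = (\<integral>\<^sup>+x\<in>{0..real n}. F (x\<^sup>2) * ennreal (2 * x) \<partial>lborel)" for n :: nat
  proof (cases "n = 0")
    \<comment> \<open>The substitution rule asks for a nondegenerate interval; at n = 0 both
      intervals are a single point.\<close>
    case True
    have "AE y in lborel. F y * indicator {0..0} y = 0"
      by (rule eventually_mono[OF AE_lborel_singleton[of 0]]) (simp add: indicator_def)
    moreover have "AE x in lborel. F (x\<^sup>2) * ennreal (2 * x) * indicator {0..0} x = 0"
      by (rule eventually_mono[OF AE_lborel_singleton[of 0]]) (simp add: indicator_def)
    ultimately show ?thesis using True
      using nn_integral_cong_AE[of "\<lambda>y. F y * indicator {0..0} y" "\<lambda>_. 0" lborel]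
        nn_integral_cong_AE[of "\<lambda>x. F (x\<^sup>2) * ennreal (2 * x) * indicator {0..0} x" "\<lambda>_. 0" lborel]
      by simp
  next
    case False
    have "((\<lambda>x. x\<^sup>2) has_real_derivative 2 * x) (at x)" for x :: real
      by (auto intro!: derivative_eq_intros)
    with False show ?thesis
      using nn_integral_substitution_aux[of F 0 "real n" "\<lambda>x. x\<^sup>2" "\<lambda>x. 2 * x"]
      by (auto intro!: continuous_intros)
  qed
  have "(\<integral>\<^sup>+y\<in>{0..}. F y \<partial>lborel) = (SUP n::nat. \<integral>\<^sup>+y\<in>{0..real n}. F y \<partial>lborel)"
    by (rule nn_integral_atLeast_SUP) simp
  also have "\<dots> = (SUP n::nat. \<integral>\<^sup>+y\<in>{0..(real n)\<^sup>2}. F y \<partial>lborel)"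
  proof (rule SUP_eq)
    fix n :: nat
    have "x \<le> (real n)\<^sup>2" if "x \<le> real n" for x
    proof -
      have "n \<le> n\<^sup>2" by (rule power2_nat_le_imp_le) simp
      then have "real n \<le> (real n)\<^sup>2" by (metis of_nat_le_iff of_nat_power)
      with that show ?thesis by linarith
    qed
    then show "\<exists>m\<in>UNIV. (\<integral>\<^sup>+y\<in>{0..real n}. F y \<partial>lborel) \<le> (\<integral>\<^sup>+y\<in>{0..(real m)\<^sup>2}. F y \<partial>lborel)"
      by (intro bexI[of _ n] nn_integral_mono mult_left_mono) (auto simp: indicator_def)
    show "\<exists>m\<in>UNIV. (\<integral>\<^sup>+y\<in>{0..(real n)\<^sup>2}. F y \<partial>lborel) \<le> (\<integral>\<^sup>+y\<in>{0..real m}. F y \<partial>lborel)"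
      by (intro bexI[of _ "n ^ 2"]) auto
  qed
  also have "\<dots> = (SUP n::nat. \<integral>\<^sup>+x\<in>{0..real n}. F (x\<^sup>2) * ennreal (2 * x) \<partial>lborel)"
    by (simp add: sub)
  also have "\<dots> = (\<integral>\<^sup>+x\<in>{0..}. F (x\<^sup>2) * ennreal (2 * x) \<partial>lborel)"
    by (rule nn_integral_atLeast_SUP[symmetric]) simp
  finally show ?thesis .
qed

lemma nn_integral_real_split:
  fixes F :: "real \<Rightarrow> ennreal"
  assumes [measurable]: "F \<in> borel_measurable borel"
  shows "(\<integral>\<^sup>+x. F x \<partial>lborel) = (\<integral>\<^sup>+x\<in>{0..}. F x + F (- x) \<partial>lborel)"
proof -
  have "(\<integral>\<^sup>+x. F x \<partial>lborel) = (\<integral>\<^sup>+x. F x * indicator {0..} x + F x * indicator {..0} x \<partial>lborel)"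
    by (rule nn_integral_cong_AE, rule eventually_mono[OF AE_lborel_singleton[of 0]])
      (simp add: indicator_def)
  also have "\<dots> = (\<integral>\<^sup>+x. F x * indicator {0..} x \<partial>lborel) + (\<integral>\<^sup>+x. F x * indicator {..0} x \<partial>lborel)"
    by (rule nn_integral_add) measurable
  also have "(\<integral>\<^sup>+x. F x * indicator {..0} x \<partial>lborel) = (\<integral>\<^sup>+x. F (-x) * indicator {0..} x \<partial>lborel)"
    by (subst nn_integral_real_affine[where t = 0 and c = "-1"]) (auto simp: indicator_def)
  also have "(\<integral>\<^sup>+x. F x * indicator {0..} x \<partial>lborel) + (\<integral>\<^sup>+x. F (-x) * indicator {0..} x \<partial>lborel)
      = (\<integral>\<^sup>+x\<in>{0..}. F x + F (- x) \<partial>lborel)"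
    by (subst nn_integral_add[symmetric]) (auto simp: distrib_right)
  finally show ?thesis .
qed

text \<open>One factor of \<open>h\<^sub>\<kappa>\<^sup>2\<close>; the case distinction is there because \<open>0 powr 0 = 0\<close>.\<close>
definition coord_weight :: "real \<Rightarrow> real \<Rightarrow> real" where
  "coord_weight k x = (if k = 0 then 1 else \<bar>x\<bar> powr k)\<^sup>2"

lemma coord_weight_measurable [measurable]: "coord_weight k \<in> borel_measurable borel"
  unfolding coord_weight_def by measurable

lemma coord_weight_nonneg [simp]: "0 \<le> coord_weight k x"
  by (simp add: coord_weight_def)

lemma coord_weight_minus [simp]: "coord_weight k (- x) = coord_weight k x"
  by (simp add: coord_weight_def)

lemma coord_weight_pos: "0 < x \<Longrightarrow> coord_weight k x = x powr (2 * k)"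
  by (simp add: coord_weight_def powr_power mult.commute)

text \<open>The image of |x|^(2k) dx under squaring: with y = x^2 each half-line contributes y^k /
  (2 sqrt y), and the two signs add up to y^(k - 1/2).\<close>

lemma nn_integral_weighted_square:
  fixes F :: "real \<Rightarrow> ennreal"
  assumes k: "0 \<le> k" and [measurable]: "F \<in> borel_measurable borel"
  shows "(\<integral>\<^sup>+x. ennreal (coord_weight k x) * F (x\<^sup>2) \<partial>lborel)
    = ennreal (Gamma (k + 1/2)) * (\<integral>\<^sup>+y. F y \<partial>riesz (k + 1/2))"
proof -
  have G: "0 < Gamma (k + 1/2)" using k by (intro Gamma_real_pos) simp
  have "ennreal (Gamma (k + 1/2)) * (\<integral>\<^sup>+y. F y \<partial>riesz (k + 1/2))
      = (\<integral>\<^sup>+y. ennreal (Gamma (k + 1/2)) * (ennreal (if 0 < y then y powr (k + 1/2 - 1) / Gamma (k + 1/2) else 0) * F y) \<partial>lborel)"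
    using k by (subst nn_integral_cmult) (simp_all add: nn_integral_riesz_pos cong: if_cong)
  also have "\<dots> = (\<integral>\<^sup>+y\<in>{0..}. ennreal (y powr (k - 1 / 2)) * F y \<partial>lborel)"
    by (rule nn_integral_cong_AE, rule eventually_mono[OF AE_lborel_singleton[of 0]])
      (use G in \<open>auto simp: indicator_def ennreal_mult'[symmetric] mult.assoc[symmetric]\<close>)
  also have "\<dots> = (\<integral>\<^sup>+x\<in>{0..}. ennreal ((x\<^sup>2) powr (k - 1 / 2)) * F (x\<^sup>2) * ennreal (2 * x) \<partial>lborel)"
    by (rule nn_integral_square_substitution) measurable
  also have "\<dots> = (\<integral>\<^sup>+x\<in>{0..}. ennreal (coord_weight k x) * F (x\<^sup>2) + ennreal (coord_weight k (-x)) * F ((-x)\<^sup>2) \<partial>lborel)"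
  proof (rule nn_integral_cong_AE, rule eventually_mono[OF AE_lborel_singleton[of 0]])
    fix x :: real assume x: "x \<noteq> 0"
    have "ennreal ((x\<^sup>2) powr (k - 1 / 2)) * F (x\<^sup>2) * ennreal (2 * x)
        = ennreal (coord_weight k x) * F (x\<^sup>2) + ennreal (coord_weight k (-x)) * F ((-x)\<^sup>2)" if "0 \<le> x"
    proof -
      have "(x\<^sup>2) powr (k - 1 / 2) * (2 * x) = 2 * x powr (2 * k)"
      proof -
        have "(x\<^sup>2) powr (k - 1 / 2) = x powr (2 * (k - 1/2))"
          using x that powr_powr[of x 2 "k - 1/2"] by simp
        also have "\<dots> * x = x powr (2 * (k - 1/2) + 1)"
          using x that by (subst powr_add) simp
        finally show ?thesis by (simp add: algebra_simps)
      qed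
      also have "\<dots> = 2 * coord_weight k x"
        using that x by (simp add: coord_weight_pos)
      finally have "(x\<^sup>2) powr (k - 1 / 2) * (2 * x) = 2 * coord_weight k x" .
      moreover have "ennreal ((x\<^sup>2) powr (k - 1 / 2)) * ennreal (2 * x) = ennreal ((x\<^sup>2) powr (k - 1 / 2) * (2 * x))"
        using that by (intro ennreal_mult[symmetric]) auto
      moreover have "ennreal (2 * coord_weight k x) = 2 * ennreal (coord_weight k x)"
        by (simp add: ennreal_mult)
      ultimately have e: "ennreal ((x\<^sup>2) powr (k - 1 / 2)) * ennreal (2 * x) = 2 * ennreal (coord_weight k x)"
        by (simp only:)
      have "ennreal ((x\<^sup>2) powr (k - 1 / 2)) * F (x\<^sup>2) * ennreal (2 * x)
          = (ennreal ((x\<^sup>2) powr (k - 1 / 2)) * ennreal (2 * x)) * F (x\<^sup>2)"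
        by (simp only: mult_ac)
      also have "\<dots> = 2 * (ennreal (coord_weight k x) * F (x\<^sup>2))" by (simp only: e mult.assoc)
      finally show ?thesis by (simp only: mult_2 power2_minus coord_weight_minus)
    qed
    then show "ennreal ((x\<^sup>2) powr (k - 1 / 2)) * F (x\<^sup>2) * ennreal (2 * x) * indicator {0..} x
      = (ennreal (coord_weight k x) * F (x\<^sup>2) + ennreal (coord_weight k (-x)) * F ((-x)\<^sup>2)) * indicator {0..} x"
      by (simp add: indicator_def)
  qed
  also have "\<dots> = (\<integral>\<^sup>+x. ennreal (coord_weight k x) * F (x\<^sup>2) \<partial>lborel)"
    by (rule nn_integral_real_split[symmetric]) measurable
  finally show ?thesis by simp
qed

lemma nn_integral_square_riesz:
  fixes F :: "real \<Rightarrow> ennreal"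
  assumes "F \<in> borel_measurable borel"
  shows "(\<integral>\<^sup>+x. F (x\<^sup>2) \<partial>lborel) = ennreal (sqrt pi) * (\<integral>\<^sup>+y. F y \<partial>riesz (1/2))"
  using nn_integral_weighted_square[of 0 F] assms
  by (simp add: coord_weight_def Gamma_one_half_real)

section \<open>The coordinate measures\<close>

lemma nn_integral_u_measure:
  assumes k: "0 < k" and F [measurable]: "F \<in> borel_measurable borel"
  shows "(\<integral>\<^sup>+u. F u \<partial>u_measure k)
    = (\<integral>\<^sup>+u. ennreal (if \<bar>u\<bar> < 1 then c_const (k - 1 / 2) * ((1 + u) * (1 - u\<^sup>2) powr (k - 1)) else 0) * F u \<partial>lborel)"
proof -
  have "(\<integral>\<^sup>+u. F u \<partial>u_measure k)
      = (\<integral>\<^sup>+u. ennreal (c_const (k - 1 / 2) * ((1 + u) * (1 - u\<^sup>2) powr (k - 1))) * F u \<partial>restrict_space lborel {-1..1})"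
    using k by (simp add: u_measure_def nn_integral_density measurable_restrict_space1)
  also have "\<dots> = (\<integral>\<^sup>+u. ennreal (c_const (k - 1 / 2) * ((1 + u) * (1 - u\<^sup>2) powr (k - 1))) * F u * indicator {-1..1} u \<partial>lborel)"
    by (rule nn_integral_restrict_space) simp
  also have "\<dots> = (\<integral>\<^sup>+u. ennreal (if \<bar>u\<bar> < 1 then c_const (k - 1 / 2) * ((1 + u) * (1 - u\<^sup>2) powr (k - 1)) else 0) * F u \<partial>lborel)"
    by (rule nn_integral_cong_AE,
        rule eventually_mono[OF AE_conjI[OF AE_lborel_singleton[of "-1"] AE_lborel_singleton[of 1]]])
      (auto simp: indicator_def)
  finally show ?thesis .
qed

lemma nn_integral_u_measure_0:
  assumes [measurable]: "F \<in> borel_measurable borel"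
  shows "(\<integral>\<^sup>+u. F u \<partial>u_measure 0) = F 1"
  by (simp add: u_measure_def nn_integral_return measurable_restrict_space1 space_restrict_space)

text \<open>
  The substitution \<open>z = x u\<close>, \<open>c = x\<^sup>2 - z\<^sup>2\<close>; summing over the sign of \<open>x\<close> replaces the factor \<open>1 + u\<close> of the
  density of \<^const>\<open>u_measure\<close> by \<open>2\<close>.
\<close>
lemma coordinate_formula:
  fixes H :: "real \<times> real \<Rightarrow> ennreal"
  assumes k: "0 \<le> k" and [measurable]: "H \<in> borel_measurable (borel \<Otimes>\<^sub>M borel)"
  shows "(\<integral>\<^sup>+x. ennreal (coord_weight k x) * (\<integral>\<^sup>+u. H (x\<^sup>2, x * u) \<partial>u_measure k) \<partial>lborel)
    = ennreal (Gamma (k + 1/2) / sqrt pi) * (\<integral>\<^sup>+z. \<integral>\<^sup>+c. H (z\<^sup>2 + c, z) \<partial>riesz k \<partial>lborel)"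
proof (cases "k = 0")
  case True
  then show ?thesis
    by (simp add: nn_integral_riesz_0 nn_integral_u_measure_0 coord_weight_def Gamma_one_half_real)
next
  case False
  with k have k: "0 < k" by simp
  have G: "0 < Gamma k" "0 < Gamma (k + 1/2)" using k by (auto intro!: Gamma_real_pos)
  define c where "c = c_const (k - 1/2)"
  have c: "c = Gamma (k + 1/2) / (sqrt pi * Gamma k)"
    by (simp add: c_def c_const_def Gamma_one_half_real add.commute)
  then have c0: "0 \<le> c" using G by simp
  define \<phi> where "\<phi> u = ennreal (if \<bar>u\<bar> < 1 then c * ((1 + u) * (1 - u\<^sup>2) powr (k - 1)) else 0)" for u :: real
  have [measurable]: "\<phi> \<in> borel_measurable borel" unfolding \<phi>_def by measurable
  define D where "D t z = ennreal (if z\<^sup>2 < t then c * (t - z\<^sup>2) powr (k - 1) else 0) * H (t, z)" for t z :: real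
  have [measurable]: "(\<lambda>(t, z). D t z) \<in> borel_measurable (borel \<Otimes>\<^sub>M borel)" unfolding D_def by measurable
  have "(\<integral>\<^sup>+x. ennreal (coord_weight k x) * (\<integral>\<^sup>+u. H (x\<^sup>2, x * u) \<partial>u_measure k) \<partial>lborel)
      = (\<integral>\<^sup>+x. ennreal (coord_weight k x) * (\<integral>\<^sup>+u. \<phi> u * H (x\<^sup>2, x * u) \<partial>lborel) \<partial>lborel)"
    using k by (simp add: nn_integral_u_measure \<phi>_def c_def cong: if_cong)
  also have "\<dots> = (\<integral>\<^sup>+x\<in>{0..}. ennreal (coord_weight k x) * (\<integral>\<^sup>+u. \<phi> u * H (x\<^sup>2, x * u) \<partial>lborel)
      + ennreal (coord_weight k (-x)) * (\<integral>\<^sup>+u. \<phi> u * H ((-x)\<^sup>2, (-x) * u) \<partial>lborel) \<partial>lborel)"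
    by (rule nn_integral_real_split) measurable
  also have "\<dots> = (\<integral>\<^sup>+x\<in>{0..}. (\<integral>\<^sup>+z. D (x\<^sup>2) z * ennreal (2 * x) \<partial>lborel) \<partial>lborel)"
  proof (rule nn_integral_cong_AE, rule eventually_mono[OF AE_lborel_singleton[of 0]])
    fix x :: real assume x: "x \<noteq> 0"
    have "ennreal (coord_weight k x) * (\<integral>\<^sup>+u. \<phi> u * H (x\<^sup>2, x * u) \<partial>lborel)
      + ennreal (coord_weight k (-x)) * (\<integral>\<^sup>+u. \<phi> u * H ((-x)\<^sup>2, (-x) * u) \<partial>lborel)
      = (\<integral>\<^sup>+z. D (x\<^sup>2) z * ennreal (2 * x) \<partial>lborel)" if "0 \<le> x"
    proof -
      have x: "0 < x" using x that by simp
      \<comment> \<open>Reflecting u moves the sign of x from H into \<phi>, so both half-lines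
        share the same H.\<close>
      have "(\<integral>\<^sup>+u. \<phi> u * H ((-x)\<^sup>2, (-x) * u) \<partial>lborel) = (\<integral>\<^sup>+u. \<phi> (-u) * H (x\<^sup>2, x * u) \<partial>lborel)"
        by (subst nn_integral_real_affine[where t = 0 and c = "-1"]) simp_all
      then have "ennreal (coord_weight k x) * (\<integral>\<^sup>+u. \<phi> u * H (x\<^sup>2, x * u) \<partial>lborel)
          + ennreal (coord_weight k (-x)) * (\<integral>\<^sup>+u. \<phi> u * H ((-x)\<^sup>2, (-x) * u) \<partial>lborel)
          = ennreal (coord_weight k x) * ((\<integral>\<^sup>+u. \<phi> u * H (x\<^sup>2, x * u) \<partial>lborel) + (\<integral>\<^sup>+u. \<phi> (-u) * H (x\<^sup>2, x * u) \<partial>lborel))"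
        by (simp add: distrib_left)
      also have "\<dots> = ennreal (coord_weight k x) * (\<integral>\<^sup>+u. \<phi> u * H (x\<^sup>2, x * u) + \<phi> (-u) * H (x\<^sup>2, x * u) \<partial>lborel)"
        by (subst nn_integral_add) simp_all
      also have "\<dots> = ennreal (coord_weight k x) * (ennreal (1/x) * (\<integral>\<^sup>+z. \<phi> (z/x) * H (x\<^sup>2, z) + \<phi> (-(z/x)) * H (x\<^sup>2, z) \<partial>lborel))"
        using x by (subst nn_integral_real_affine[where t = 0 and c = "1/x"]) simp_all
      also have "\<dots> = (\<integral>\<^sup>+z. ennreal (coord_weight k x) * (ennreal (1/x) * (\<phi> (z/x) * H (x\<^sup>2, z) + \<phi> (-(z/x)) * H (x\<^sup>2, z))) \<partial>lborel)"
        by (simp add: nn_integral_cmult)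
      also have "\<dots> = (\<integral>\<^sup>+z. D (x\<^sup>2) z * ennreal (2 * x) \<partial>lborel)"
      proof (rule nn_integral_cong)
        fix z :: real
        have lt: "\<bar>z / x\<bar> < 1 \<longleftrightarrow> z\<^sup>2 < x\<^sup>2"
          using x abs_square_less_1[of "z / x"] by (simp add: power_divide divide_simps)
        \<comment> \<open>The powers of x collapse: x^(2k) from the weight, 1/x from dz = x du and
          x^(-2(k - 1)) from 1 - (z/x)^2 leave x. The factor \<open>2 * x\<close> is the Jacobian
          that the substitution t = x^2 absorbs below.\<close>
        have "ennreal (coord_weight k x) * (ennreal (1/x) * (\<phi> (z/x) + \<phi> (-(z/x))))
            = ennreal (if z\<^sup>2 < x\<^sup>2 then c * (x\<^sup>2 - z\<^sup>2) powr (k - 1) else 0) * ennreal (2 * x)"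
        proof (cases "z\<^sup>2 < x\<^sup>2")
          case True
          then have "\<bar>z/x\<bar> < 1" using lt by simp
          then have z: "-1 < z/x" "z/x < 1" by linarith+
          define w where "w = z / x"
          have w: "\<phi> w = ennreal (c * ((1 + w) * (1 - w\<^sup>2) powr (k - 1)))"
            "\<phi> (- w) = ennreal (c * ((1 - w) * (1 - w\<^sup>2) powr (k - 1)))"
            "0 \<le> 1 + w" "0 \<le> 1 - w"
            using True lt z unfolding \<phi>_def w_def by auto
          have "\<phi> w + \<phi> (- w) = ennreal (c * ((1 + w) * (1 - w\<^sup>2) powr (k - 1)) + c * ((1 - w) * (1 - w\<^sup>2) powr (k - 1)))"
            unfolding w(1,2) using w(3,4) c0
            by (intro ennreal_plus[symmetric] mult_nonneg_nonneg) auto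
          then have "\<phi> (z/x) + \<phi> (-(z/x)) = ennreal (2 * c * (1 - (z/x)\<^sup>2) powr (k - 1))"
            unfolding w_def[symmetric] by (simp add: algebra_simps)
          moreover have "(1 - (z/x)\<^sup>2) powr (k - 1) = (x\<^sup>2 - z\<^sup>2) powr (k - 1) / x powr (2 * (k - 1))"
          proof -
            have "1 - (z/x)\<^sup>2 = (x\<^sup>2 - z\<^sup>2) / x\<^sup>2" using x by (simp add: field_simps power_divide)
            moreover have "(x\<^sup>2) powr (k - 1) = x powr (2 * (k - 1))"
              using x powr_powr[of x 2 "k - 1"] by simp
            ultimately show ?thesis using True by (simp add: powr_divide)
          qed
          moreover have "x powr (2 * k) = x powr (2 * (k - 1)) * x\<^sup>2"
            using x powr_add[of x "2 * (k - 1)" 2] by (simp add: algebra_simps)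
          ultimately have "x powr (2 * k) * (1/x * (2 * c * (1 - (z/x)\<^sup>2) powr (k - 1))) = c * (x\<^sup>2 - z\<^sup>2) powr (k - 1) * (2 * x)"
            and "\<phi> (z/x) + \<phi> (-(z/x)) = ennreal (2 * c * (1 - (z/x)\<^sup>2) powr (k - 1))"
            using x by (simp_all add: power2_eq_square)
          then show ?thesis using True x c0
            by (simp only: coord_weight_pos if_True ennreal_mult[symmetric] zero_le_mult_iff powr_ge_zero zero_le_numeral
               zero_le_divide_1_iff less_imp_le simp_thms mult_nonneg_nonneg)
        next
          case False
          then show ?thesis using lt by (simp add: \<phi>_def)
        qed
        then show "ennreal (coord_weight k x) * (ennreal (1/x) * (\<phi> (z/x) * H (x\<^sup>2, z) + \<phi> (-(z/x)) * H (x\<^sup>2, z)))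
          = D (x\<^sup>2) z * ennreal (2 * x)"
        proof -
          assume e: "ennreal (coord_weight k x) * (ennreal (1/x) * (\<phi> (z/x) + \<phi> (-(z/x))))
            = ennreal (if z\<^sup>2 < x\<^sup>2 then c * (x\<^sup>2 - z\<^sup>2) powr (k - 1) else 0) * ennreal (2 * x)"
          have "ennreal (coord_weight k x) * (ennreal (1/x) * (\<phi> (z/x) * H (x\<^sup>2, z) + \<phi> (-(z/x)) * H (x\<^sup>2, z)))
            = (ennreal (coord_weight k x) * (ennreal (1/x) * (\<phi> (z/x) + \<phi> (-(z/x))))) * H (x\<^sup>2, z)"
            by (simp only: distrib_right[symmetric] mult.assoc)
          also have "\<dots> = D (x\<^sup>2) z * ennreal (2 * x)"
            unfolding e D_def by (simp only: mult_ac)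
          finally show ?thesis .
        qed
      qed
      finally show ?thesis .
    qed
    then show "(ennreal (coord_weight k x) * (\<integral>\<^sup>+u. \<phi> u * H (x\<^sup>2, x * u) \<partial>lborel)
      + ennreal (coord_weight k (-x)) * (\<integral>\<^sup>+u. \<phi> u * H ((-x)\<^sup>2, (-x) * u) \<partial>lborel)) * indicator {0..} x
      = (\<integral>\<^sup>+z. D (x\<^sup>2) z * ennreal (2 * x) \<partial>lborel) * indicator {0..} x"
      by (simp add: indicator_def)
  qed
  also have "\<dots> = (\<integral>\<^sup>+x. (\<integral>\<^sup>+z. D (x\<^sup>2) z * ennreal (2 * x) * indicator {0..} x \<partial>lborel) \<partial>lborel)"
    by (simp add: nn_integral_multc)
  also have "\<dots> = (\<integral>\<^sup>+z. (\<integral>\<^sup>+x. D (x\<^sup>2) z * ennreal (2 * x) * indicator {0..} x \<partial>lborel) \<partial>lborel)"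
    by (intro nn_integral_swap sigma_finite_lborel) measurable
  also have "\<dots> = (\<integral>\<^sup>+z. (\<integral>\<^sup>+t. D t z * indicator {0..} t \<partial>lborel) \<partial>lborel)"
    by (intro nn_integral_cong nn_integral_square_substitution[symmetric]) measurable
  \<comment> \<open>Shifting t by z^2 makes the density depend on t alone. The constant c splits
    into the 1 / Gamma k of \<open>riesz k\<close> and the factor Gamma (k + 1/2) / sqrt pi.\<close>
  also have "\<dots> = (\<integral>\<^sup>+z. (\<integral>\<^sup>+t. ennreal (Gamma (k + 1/2) / sqrt pi) * (ennreal (if 0 < t then t powr (k - 1) / Gamma k else 0) * H (z\<^sup>2 + t, z)) \<partial>lborel) \<partial>lborel)"
  proof (rule nn_integral_cong)
    fix z :: real
    have "(\<integral>\<^sup>+t. D t z * indicator {0..} t \<partial>lborel) = (\<integral>\<^sup>+t. D (z\<^sup>2 + t) z * indicator {0..} (z\<^sup>2 + t) \<partial>lborel)"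
      by (subst nn_integral_real_affine[where t = "z\<^sup>2" and c = 1]) simp_all
    also have "\<dots> = (\<integral>\<^sup>+t. ennreal (Gamma (k + 1/2) / sqrt pi) * (ennreal (if 0 < t then t powr (k - 1) / Gamma k else 0) * H (z\<^sup>2 + t, z)) \<partial>lborel)"
    proof (rule nn_integral_cong)
      fix t :: real
      show "D (z\<^sup>2 + t) z * indicator {0..} (z\<^sup>2 + t)
        = ennreal (Gamma (k + 1/2) / sqrt pi) * (ennreal (if 0 < t then t powr (k - 1) / Gamma k else 0) * H (z\<^sup>2 + t, z))"
      proof (cases "0 < t")
        case True
        have "c * t powr (k - 1) = Gamma (k + 1/2) / sqrt pi * (t powr (k - 1) / Gamma k)"
          by (simp add: c)
        then have "ennreal (c * t powr (k - 1)) = ennreal (Gamma (k + 1/2) / sqrt pi) * ennreal (t powr (k - 1) / Gamma k)"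
          using G by (simp only:) (intro ennreal_mult divide_nonneg_nonneg; simp)
        moreover have "0 \<le> z\<^sup>2 + t" using True by (intro add_nonneg_nonneg) auto
        ultimately show ?thesis using True by (simp add: D_def mult.assoc)
      qed (simp add: D_def)
    qed
    finally show "(\<integral>\<^sup>+t. D t z * indicator {0..} t \<partial>lborel) = \<dots>" .
  qed
  also have "\<dots> = ennreal (Gamma (k + 1/2) / sqrt pi) * (\<integral>\<^sup>+z. \<integral>\<^sup>+c. H (z\<^sup>2 + c, z) \<partial>riesz k \<partial>lborel)"
    using k by (simp add: nn_integral_cmult nn_integral_riesz_pos)
  finally show ?thesis .
qed

text \<open>The mass is read off from \<open>coordinate_formula\<close> for exp (- t). A function of
  t alone does not see u, so the left side is Gamma (k + 1/2) times the mass; the right side is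
  Gamma (k + 1/2). The point mass k = 0 is covered by the same computation.\<close>

lemma prob_space_u_measure:
  assumes k: "0 \<le> k"
  shows "prob_space (u_measure k)"
proof
  have G: "0 < Gamma (k + 1/2)" using k by (auto intro!: Gamma_real_pos)
  define E where "E = emeasure (u_measure k) (space (u_measure k))"
  have e1: "(\<integral>\<^sup>+x. ennreal (coord_weight k x) * ennreal (exp (- x\<^sup>2)) \<partial>lborel) = ennreal (Gamma (k + 1/2))"
    using k nn_integral_weighted_square[of k "\<lambda>y. ennreal (exp (-y))"] by (simp add: nn_integral_riesz_exp)
  have "ennreal (Gamma (k + 1/2)) * E = (\<integral>\<^sup>+x. ennreal (coord_weight k x) * (\<integral>\<^sup>+u. ennreal (exp (- x\<^sup>2)) \<partial>u_measure k) \<partial>lborel)"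
    unfolding e1[symmetric] by (subst nn_integral_multc[symmetric]) (simp_all add: E_def mult.assoc)
  also have "\<dots> = ennreal (Gamma (k + 1/2) / sqrt pi) * (\<integral>\<^sup>+z. \<integral>\<^sup>+c. ennreal (exp (-(z\<^sup>2 + c))) \<partial>riesz k \<partial>lborel)"
    using coordinate_formula[OF k, of "\<lambda>(t, z). ennreal (exp (- t))"] by simp
  also have "(\<integral>\<^sup>+z. \<integral>\<^sup>+c. ennreal (exp (-(z\<^sup>2 + c))) \<partial>riesz k \<partial>lborel) = (\<integral>\<^sup>+z. ennreal (exp (-z\<^sup>2)) \<partial>lborel)"
  proof (rule nn_integral_cong)
    fix z :: real
    have "(\<integral>\<^sup>+c. ennreal (exp (-(z\<^sup>2 + c))) \<partial>riesz k) = (\<integral>\<^sup>+c. ennreal (exp (-z\<^sup>2)) * ennreal (exp (-c)) \<partial>riesz k)"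
      by (simp add: ennreal_mult[symmetric] exp_add[symmetric])
    also have "\<dots> = ennreal (exp (-z\<^sup>2))"
      using k by (simp add: nn_integral_cmult nn_integral_riesz_exp)
    finally show "(\<integral>\<^sup>+c. ennreal (exp (-(z\<^sup>2 + c))) \<partial>riesz k) = ennreal (exp (-z\<^sup>2))" .
  qed
  also have "\<dots> = ennreal (sqrt pi)"
    using nn_integral_square_riesz[of "\<lambda>y. ennreal (exp (-y))"] by (simp add: nn_integral_riesz_exp)
  also have "ennreal (Gamma (k + 1/2) / sqrt pi) * ennreal (sqrt pi) = ennreal (Gamma (k + 1/2))"
    using G by (simp add: ennreal_mult[symmetric])
  finally have "ennreal (Gamma (k + 1/2)) * E = ennreal (Gamma (k + 1/2)) * 1" by simp
  then show "emeasure (u_measure k) (space (u_measure k)) = 1"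
    unfolding E_def[symmetric] ennreal_mult_cancel_left using G by auto
qed

section \<open>Rotation of the plane\<close>

text \<open>The rotation that aligns the linear form with the first axis, written as two shears: x =
  (r v - b y) / a for fixed y, then y = (b v + a w) / r for fixed v. The Jacobians |r / a| and |a /
  r| cancel.\<close>

lemma rotation_formula:
  fixes H :: "real \<times> real \<Rightarrow> ennreal"
  assumes [measurable]: "H \<in> borel_measurable (borel \<Otimes>\<^sub>M borel)"
  shows "(\<integral>\<^sup>+x. \<integral>\<^sup>+y. H (x\<^sup>2 + y\<^sup>2, a * x + b * y) \<partial>lborel \<partial>lborel)
    = (\<integral>\<^sup>+v. \<integral>\<^sup>+w. H (v\<^sup>2 + w\<^sup>2, sqrt (a\<^sup>2 + b\<^sup>2) * v) \<partial>lborel \<partial>lborel)"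
proof (cases "a = 0")
  \<comment> \<open>The first shear divides by \<open>a\<close>. If a = 0 the form sees only y, and
    exchanging the variables, with a reflection for negative b, suffices.\<close>
  case True
  have "(\<integral>\<^sup>+x. \<integral>\<^sup>+y. H (x\<^sup>2 + y\<^sup>2, a * x + b * y) \<partial>lborel \<partial>lborel)
      = (\<integral>\<^sup>+v. \<integral>\<^sup>+w. H (w\<^sup>2 + v\<^sup>2, b * v) \<partial>lborel \<partial>lborel)"
    unfolding True by (subst nn_integral_swap) (simp_all add: sigma_finite_lborel)
  also have "\<dots> = (\<integral>\<^sup>+v. \<integral>\<^sup>+w. H (v\<^sup>2 + w\<^sup>2, \<bar>b\<bar> * v) \<partial>lborel \<partial>lborel)"
  proof (cases "0 \<le> b")
    case True then show ?thesis by (simp add: add.commute)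
  next
    case False then show ?thesis
      by (subst nn_integral_real_affine[where t = 0 and c = "-1"]) (simp_all add: add.commute)
  qed
  finally show ?thesis using True by simp
next
  case False
  define r where "r = sqrt (a\<^sup>2 + b\<^sup>2)"
  have r: "0 < r" "r\<^sup>2 = a\<^sup>2 + b\<^sup>2" using False by (auto simp: r_def add_pos_nonneg)
  have "(\<integral>\<^sup>+x. \<integral>\<^sup>+y. H (x\<^sup>2 + y\<^sup>2, a * x + b * y) \<partial>lborel \<partial>lborel)
      = (\<integral>\<^sup>+y. \<integral>\<^sup>+x. H (x\<^sup>2 + y\<^sup>2, a * x + b * y) \<partial>lborel \<partial>lborel)"
    by (intro nn_integral_swap sigma_finite_lborel) measurable
  also have "\<dots> = (\<integral>\<^sup>+y. ennreal \<bar>r / a\<bar> * (\<integral>\<^sup>+v. H (((r * v - b * y) / a)\<^sup>2 + y\<^sup>2, r * v) \<partial>lborel) \<partial>lborel)"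
  proof (rule nn_integral_cong)
    fix y :: real
    have "-(b * y / a) + r / a * v = (r * v - b * y) / a" for v by (simp add: diff_divide_distrib)
    then show "(\<integral>\<^sup>+x. H (x\<^sup>2 + y\<^sup>2, a * x + b * y) \<partial>lborel) = ennreal \<bar>r / a\<bar> * (\<integral>\<^sup>+v. H (((r * v - b * y) / a)\<^sup>2 + y\<^sup>2, r * v) \<partial>lborel)"
      using False r by (subst nn_integral_real_affine[where t = "-(b * y / a)" and c = "r / a"]) simp_all
  qed
  also have "\<dots> = (\<integral>\<^sup>+y. (\<integral>\<^sup>+v. ennreal \<bar>r / a\<bar> * H (((r * v - b * y) / a)\<^sup>2 + y\<^sup>2, r * v) \<partial>lborel) \<partial>lborel)"
    by (simp add: nn_integral_cmult)
  also have "\<dots> = (\<integral>\<^sup>+v. (\<integral>\<^sup>+y. ennreal \<bar>r / a\<bar> * H (((r * v - b * y) / a)\<^sup>2 + y\<^sup>2, r * v) \<partial>lborel) \<partial>lborel)"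
    by (intro nn_integral_swap sigma_finite_lborel) measurable
  also have "\<dots> = (\<integral>\<^sup>+v. \<integral>\<^sup>+w. H (v\<^sup>2 + w\<^sup>2, r * v) \<partial>lborel \<partial>lborel)"
  proof (rule nn_integral_cong)
    fix v :: real
    have eq: "((r * v - b * (b * v / r + a * w / r)) / a)\<^sup>2 + (b * v / r + a * w / r)\<^sup>2 = v\<^sup>2 + w\<^sup>2" for w
    proof -
      have "r * v - b * (b * v / r + a * w / r) = (r\<^sup>2 * v - b\<^sup>2 * v - a * b * w) / r"
        using r(1) by (simp add: field_simps power2_eq_square)
      also have "\<dots> = a * ((a * v - b * w) / r)"
        unfolding r by (simp add: algebra_simps power2_eq_square)
      finally have "(r * v - b * (b * v / r + a * w / r)) / a = (a * v - b * w) / r"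
        using False by simp
      moreover have "b * v / r + a * w / r = (b * v + a * w) / r" by (simp add: add_divide_distrib)
      moreover have "((a * v - b * w) / r)\<^sup>2 + ((b * v + a * w) / r)\<^sup>2 = (a\<^sup>2 + b\<^sup>2) * (v\<^sup>2 + w\<^sup>2) / r\<^sup>2"
        by (simp add: power_divide add_divide_distrib[symmetric]) (simp add: power2_eq_square algebra_simps)
      ultimately show ?thesis using r False by simp
    qed
    have "(\<integral>\<^sup>+y. ennreal \<bar>r / a\<bar> * H (((r * v - b * y) / a)\<^sup>2 + y\<^sup>2, r * v) \<partial>lborel)
        = ennreal \<bar>a / r\<bar> * (\<integral>\<^sup>+w. ennreal \<bar>r / a\<bar> * H (v\<^sup>2 + w\<^sup>2, r * v) \<partial>lborel)"
      using False r by (subst nn_integral_real_affine[where t = "b * v / r" and c = "a / r"]) (simp_all add: eq)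
    also have "\<dots> = (\<integral>\<^sup>+w. H (v\<^sup>2 + w\<^sup>2, r * v) \<partial>lborel)"
      using False r by (simp add: nn_integral_cmult mult.assoc[symmetric] ennreal_mult[symmetric] abs_mult[symmetric])
    finally show "(\<integral>\<^sup>+y. ennreal \<bar>r / a\<bar> * H (((r * v - b * y) / a)\<^sup>2 + y\<^sup>2, r * v) \<partial>lborel)
        = (\<integral>\<^sup>+w. H (v\<^sup>2 + w\<^sup>2, r * v) \<partial>lborel)" .
  qed
  finally show ?thesis by (simp add: r_def)
qed

section \<open>Polar coordinates on the cone\<close>

lemma nn_integral_scale_lborel:
  fixes f :: "'a::euclidean_space \<Rightarrow> ennreal"
  assumes [measurable]: "f \<in> borel_measurable borel" and "c \<noteq> 0"
  shows "(\<integral>\<^sup>+x. f x \<partial>lborel) = ennreal (\<bar>c\<bar> ^ DIM('a)) * (\<integral>\<^sup>+x. f (c *\<^sub>R x) \<partial>lborel)"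
  by (subst lborel_affine[OF assms(2), of 0])
    (simp add: nn_integral_density nn_integral_distr nn_integral_cmult)

text \<open>The radial integral left over in \<open>nn_integral_conic_lborel\<close>; there its
  value cancels the factor norm x ^ n.\<close>

lemma nn_integral_tail_power:
  assumes "0 < a" "0 < n"
  shows "(\<integral>\<^sup>+r. ennreal (if a \<le> r then real n * r powr (- real n - 1) else 0) \<partial>lborel) = ennreal (a powr (- real n))"
proof -
  have "(\<integral>\<^sup>+r. ennreal (if a \<le> r then real n * r powr (- real n - 1) else 0) \<partial>lborel)
      = (\<integral>\<^sup>+r\<in>{a..}. ennreal (real n * r powr (- real n - 1)) \<partial>lborel)"
    by (intro nn_integral_cong) (simp add: indicator_def)
  also have "\<dots> = ennreal (0 - (- (a powr (- real n))))"
  proof (rule nn_integral_FTC_atLeast[where F = "\<lambda>x. - (x powr (- real n))"])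
    fix x assume "a \<le> x"
    then show "((\<lambda>x. - (x powr (- real n))) has_real_derivative real n * x powr (- real n - 1)) (at x)"
      using assms by (auto intro!: derivative_eq_intros)
  next
    have "((\<lambda>x. x powr (- real n)) \<longlongrightarrow> 0) at_top"
      using assms by (intro tendsto_neg_powr filterlim_ident) auto
    then show "((\<lambda>x. - (x powr (- real n))) \<longlongrightarrow> 0) at_top"
      using tendsto_minus by fastforce
  qed auto
  finally show ?thesis by simp
qed

lemma conic_map_measurable:
  "(\<lambda>x :: real ^ 'n. (x, norm x)) \<in> borel \<rightarrow>\<^sub>M restrict_space borel conic_surface"
  by (rule measurable_restrict_space2) (auto simp: conic_surface_def)

text \<open>Polar coordinates: the cone is the graph of the norm, and its measure is Lebesgue
  measure in x. The sphere measure is built from the unit ball, so a ball variable x and a radius t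
  are present at once. Putting t = r norm x makes r x the argument, rescaling x by r removes r from
  the argument, and the integral over r can then be carried out.\<close>

lemma nn_integral_conic_lborel:
  fixes f :: "(real ^ 'n) \<times> real \<Rightarrow> ennreal"
  assumes f: "f \<in> borel_measurable (restrict_space borel conic_surface)"
  shows "(\<integral>\<^sup>+p. f p \<partial>conic_measure) = (\<integral>\<^sup>+x. f (x, norm x) \<partial>lborel)"
proof -
  let ?n = "CARD('n)"
  define F where "F x = f (x, norm x)" for x
  have F [measurable]: "F \<in> borel_measurable borel"
    unfolding F_def using measurable_compose[OF conic_map_measurable f] .
  have n: "0 < ?n" by simp
  let ?K = "\<lambda>(x :: real ^ 'n) t :: real. if 0 \<le> t \<and> 0 < norm x \<and> norm x \<le> 1 then ennreal (real ?n * t ^ (?n - 1)) * F ((t / norm x) *\<^sub>R x) else 0"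
  have 1: "(\<integral>\<^sup>+\<xi>. f (t *\<^sub>R \<xi>, t) \<partial>sphere_measure)
      = ennreal (real ?n) * (\<integral>\<^sup>+x. (if 0 < norm x \<and> norm x \<le> 1 then F ((t / norm x) *\<^sub>R x) else 0) \<partial>lborel)" if t: "0 \<le> t" for t
  proof -
    have m: "(\<lambda>\<xi>. f (t *\<^sub>R \<xi>, t)) \<in> borel_measurable (restrict_space borel (sphere 0 1))"
    proof (rule measurable_compose[OF _ f], rule measurable_restrict_space2)
      show "(\<lambda>\<xi> :: real ^ 'n. (t *\<^sub>R \<xi>, t)) \<in> space (restrict_space borel (sphere 0 1)) \<rightarrow> conic_surface"
        using t by (auto simp: conic_surface_def space_restrict_space)
      show "(\<lambda>\<xi> :: real ^ 'n. (t *\<^sub>R \<xi>, t)) \<in> borel_measurable (restrict_space borel (sphere 0 1))"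
        by (rule measurable_restrict_space1) measurable
    qed
    have "(\<integral>\<^sup>+\<xi>. f (t *\<^sub>R \<xi>, t) \<partial>sphere_measure)
        = ennreal (real ?n) * (\<integral>\<^sup>+x. f (t *\<^sub>R sgn x, t) \<partial>restrict_space lborel (cball 0 1 - {0}))"
      unfolding sphere_measure_def
      by (simp add: nn_integral_scale_measure nn_integral_distr[OF measurable_sgn_sphere] m)
    also have "(\<integral>\<^sup>+x. f (t *\<^sub>R sgn x, t) \<partial>restrict_space lborel (cball 0 1 - {0}))
        = (\<integral>\<^sup>+x. f (t *\<^sub>R sgn x, t) * indicator (cball 0 1 - {0}) x \<partial>lborel)"
      by (rule nn_integral_restrict_space) simp
    also have "\<dots> = (\<integral>\<^sup>+x. (if 0 < norm x \<and> norm x \<le> 1 then F ((t / norm x) *\<^sub>R x) else 0) \<partial>lborel)"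
    proof (rule nn_integral_cong)
      fix x :: "real ^ 'n"
      have "F ((t / norm x) *\<^sub>R x) = f (t *\<^sub>R sgn x, t)" if "x \<noteq> 0"
        using t that by (simp add: F_def sgn_div_norm divide_inverse mult.assoc)
      then show "f (t *\<^sub>R sgn x, t) * indicator (cball 0 1 - {0}) x = (if 0 < norm x \<and> norm x \<le> 1 then F ((t / norm x) *\<^sub>R x) else 0)"
        by (auto simp: indicator_def)
    qed
    finally show ?thesis .
  qed
  have "(\<integral>\<^sup>+p. f p \<partial>conic_measure)
      = (\<integral>\<^sup>+t. ennreal (t ^ (?n - 1)) * (\<integral>\<^sup>+\<xi>. f (t *\<^sub>R \<xi>, t) \<partial>sphere_measure) * indicator {0..} t \<partial>lborel)"
    unfolding nn_integral_conic_measure[OF f] by (rule nn_integral_restrict_space) simp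
  also have "\<dots> = (\<integral>\<^sup>+t. \<integral>\<^sup>+x. ?K x t \<partial>lborel \<partial>lborel)"
  proof (rule nn_integral_cong)
    fix t :: real
    show "ennreal (t ^ (?n - 1)) * (\<integral>\<^sup>+\<xi>. f (t *\<^sub>R \<xi>, t) \<partial>sphere_measure) * indicator {0..} t
        = (\<integral>\<^sup>+x. ?K x t \<partial>lborel)"
    proof (cases "0 \<le> t")
      case True
      have "ennreal (t ^ (?n - 1)) * (\<integral>\<^sup>+\<xi>. f (t *\<^sub>R \<xi>, t) \<partial>sphere_measure)
         = ennreal (real ?n * t ^ (?n - 1)) * (\<integral>\<^sup>+x. (if 0 < norm x \<and> norm x \<le> 1 then F ((t / norm x) *\<^sub>R x) else 0) \<partial>lborel)"
        unfolding 1[OF True] using True by (simp add: ennreal_mult mult_ac)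
      also have "\<dots> = (\<integral>\<^sup>+x. ennreal (real ?n * t ^ (?n - 1)) * (if 0 < norm x \<and> norm x \<le> 1 then F ((t / norm x) *\<^sub>R x) else 0) \<partial>lborel)"
        by (rule nn_integral_cmult[symmetric]) measurable
      finally show ?thesis using True by (auto intro!: nn_integral_cong)
    qed simp
  qed
  also have "\<dots> = (\<integral>\<^sup>+x. \<integral>\<^sup>+t. ?K x t \<partial>lborel \<partial>lborel)"
    by (intro nn_integral_swap sigma_finite_lborel) measurable
  \<comment> \<open>Here t = r norm x. The condition norm x \<le> 1 is written as norm (r x) \<le>
    r, so that everything but r itself depends on r x only.\<close>
  also have "\<dots> = (\<integral>\<^sup>+x. \<integral>\<^sup>+r. (if 0 < r \<and> 0 < norm (r *\<^sub>R x) \<and> norm (r *\<^sub>R x) \<le> r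
      then ennreal (real ?n * r powr (- 1) * norm (r *\<^sub>R x) ^ ?n) * F (r *\<^sub>R x) else 0) \<partial>lborel \<partial>lborel)"
  proof (rule nn_integral_cong)
    fix x :: "real ^ 'n"
    show "(\<integral>\<^sup>+t. ?K x t \<partial>lborel) = (\<integral>\<^sup>+r. (if 0 < r \<and> 0 < norm (r *\<^sub>R x) \<and> norm (r *\<^sub>R x) \<le> r
      then ennreal (real ?n * r powr (- 1) * norm (r *\<^sub>R x) ^ ?n) * F (r *\<^sub>R x) else 0) \<partial>lborel)"
    proof (cases "x = 0")
      case False
      have "(\<integral>\<^sup>+t. ?K x t \<partial>lborel) = ennreal (norm x) * (\<integral>\<^sup>+r. ?K x (norm x * r) \<partial>lborel)"
        using False by (subst nn_integral_real_affine[where t = 0 and c = "norm x"]) (simp_all cong: if_cong)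
      also have "\<dots> = (\<integral>\<^sup>+r. ennreal (norm x) * ?K x (norm x * r) \<partial>lborel)"
        by (rule nn_integral_cmult[symmetric]) measurable
      also have "\<dots> = (\<integral>\<^sup>+r. (if 0 < r \<and> 0 < norm (r *\<^sub>R x) \<and> norm (r *\<^sub>R x) \<le> r
        then ennreal (real ?n * r powr (- 1) * norm (r *\<^sub>R x) ^ ?n) * F (r *\<^sub>R x) else 0) \<partial>lborel)"
      proof (rule nn_integral_cong_AE, rule eventually_mono[OF AE_lborel_singleton[of 0]])
        fix r :: real assume r0: "r \<noteq> 0"
        show "ennreal (norm x) * ?K x (norm x * r) = (if 0 < r \<and> 0 < norm (r *\<^sub>R x) \<and> norm (r *\<^sub>R x) \<le> r
          then ennreal (real ?n * r powr (- 1) * norm (r *\<^sub>R x) ^ ?n) * F (r *\<^sub>R x) else 0)"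
        proof (cases "0 < r \<and> norm x \<le> 1")
          case True
          then have r: "0 < r" by simp
          have "r ^ ?n = r * r ^ (?n - 1)" "norm x ^ ?n = norm x * norm x ^ (?n - 1)"
            using n by (simp_all add: power_eq_if[of _ "CARD('n)"])
          moreover have "r powr (- 1) = 1 / r" using r by (simp add: powr_minus_divide)
          ultimately have e: "norm x * (real ?n * (norm x * r) ^ (?n - 1)) = real ?n * r powr (- 1) * norm (r *\<^sub>R x) ^ ?n"
            using r by (simp only: power_mult_distrib norm_scaleR abs_of_pos) (simp only: times_divide_eq_left times_divide_eq_right, simp)
          have "?K x (norm x * r) = ennreal (real ?n * (norm x * r) ^ (?n - 1)) * F (r *\<^sub>R x)"
            using True False by simp
          moreover have "0 < norm (r *\<^sub>R x)" "norm (r *\<^sub>R x) \<le> r" using True False by (simp_all add: mult_left_le)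
          moreover have "ennreal (norm x) * (ennreal (real ?n * (norm x * r) ^ (?n - 1)) * F (r *\<^sub>R x))
              = ennreal (norm x * (real ?n * (norm x * r) ^ (?n - 1))) * F (r *\<^sub>R x)"
            using r by (subst ennreal_mult) (simp_all only: mult.assoc norm_ge_zero mult_nonneg_nonneg of_nat_0_le_iff zero_le_power less_imp_le)
          ultimately show ?thesis unfolding e[symmetric] using r
            by (simp only: simp_thms if_True)
        next
          case *: False
          then show ?thesis using False r0
            by (auto simp: zero_le_mult_iff)
        qed
      qed
      finally show ?thesis .
    qed simp
  qed
  also have "\<dots> = (\<integral>\<^sup>+r. \<integral>\<^sup>+x. (if 0 < r \<and> 0 < norm (r *\<^sub>R x) \<and> norm (r *\<^sub>R x) \<le> r
      then ennreal (real ?n * r powr (- 1) * norm (r *\<^sub>R x) ^ ?n) * F (r *\<^sub>R x) else 0) \<partial>lborel \<partial>lborel)"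
    by (intro nn_integral_swap sigma_finite_lborel) measurable
  \<comment> \<open>Replacing r x by x for fixed r contributes r^(-n), hence the exponent - n -
    1.\<close>
  also have "\<dots> = (\<integral>\<^sup>+r. \<integral>\<^sup>+x. ennreal (if norm x \<le> r then real ?n * r powr (- real ?n - 1) else 0) * (ennreal (norm x ^ ?n) * F x) \<partial>lborel \<partial>lborel)"
  proof (rule nn_integral_cong)
    fix r :: real
    show "(\<integral>\<^sup>+x. (if 0 < r \<and> 0 < norm (r *\<^sub>R x) \<and> norm (r *\<^sub>R x) \<le> r
      then ennreal (real ?n * r powr (- 1) * norm (r *\<^sub>R x) ^ ?n) * F (r *\<^sub>R x) else 0) \<partial>lborel)
      = (\<integral>\<^sup>+x. ennreal (if norm x \<le> r then real ?n * r powr (- real ?n - 1) else 0) * (ennreal (norm x ^ ?n) * F x) \<partial>lborel)"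
    proof (cases "0 < r")
      case True
      have "(\<integral>\<^sup>+x. ennreal (if norm x \<le> r then real ?n * r powr (- real ?n - 1) else 0) * (ennreal (norm x ^ ?n) * F x) \<partial>lborel)
         = ennreal (r ^ ?n) * (\<integral>\<^sup>+x. ennreal (if norm (r *\<^sub>R x) \<le> r then real ?n * r powr (- real ?n - 1) else 0) * (ennreal (norm (r *\<^sub>R x) ^ ?n) * F (r *\<^sub>R x)) \<partial>lborel)"
        using True by (subst nn_integral_scale_lborel[where c = r]) simp_all
      also have "\<dots> = (\<integral>\<^sup>+x. ennreal (r ^ ?n) * (ennreal (if norm (r *\<^sub>R x) \<le> r then real ?n * r powr (- real ?n - 1) else 0) * (ennreal (norm (r *\<^sub>R x) ^ ?n) * F (r *\<^sub>R x))) \<partial>lborel)"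
        by (rule nn_integral_cmult[symmetric]) measurable
      also have "\<dots> = (\<integral>\<^sup>+x. (if 0 < r \<and> 0 < norm (r *\<^sub>R x) \<and> norm (r *\<^sub>R x) \<le> r
          then ennreal (real ?n * r powr (- 1) * norm (r *\<^sub>R x) ^ ?n) * F (r *\<^sub>R x) else 0) \<partial>lborel)"
      proof (rule nn_integral_cong)
        fix x :: "real ^ 'n"
        have "r ^ ?n * r powr (- real ?n - 1) = r powr (-1)"
          using True by (simp add: powr_realpow[symmetric] powr_add[symmetric])
        then have e: "r ^ ?n * (real ?n * r powr (- real ?n - 1) * norm (r *\<^sub>R x) ^ ?n) = real ?n * r powr (- 1) * norm (r *\<^sub>R x) ^ ?n"
          by (metis (no_types, opaque_lifting) mult.assoc mult.commute)
        have "ennreal (r ^ ?n) * (ennreal (real ?n * r powr (- real ?n - 1)) * (ennreal (norm (r *\<^sub>R x) ^ ?n) * F (r *\<^sub>R x)))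
          = ennreal (real ?n * r powr (- 1) * norm (r *\<^sub>R x) ^ ?n) * F (r *\<^sub>R x)"
          unfolding e[symmetric] using True
          by (subst ennreal_mult, simp, simp, subst ennreal_mult, simp, simp) (simp only: mult.assoc)
        then show "ennreal (r ^ ?n) * (ennreal (if norm (r *\<^sub>R x) \<le> r then real ?n * r powr (- real ?n - 1) else 0) * (ennreal (norm (r *\<^sub>R x) ^ ?n) * F (r *\<^sub>R x)))
          = (if 0 < r \<and> 0 < norm (r *\<^sub>R x) \<and> norm (r *\<^sub>R x) \<le> r
          then ennreal (real ?n * r powr (- 1) * norm (r *\<^sub>R x) ^ ?n) * F (r *\<^sub>R x) else 0)"
          using True by (cases "x = 0") (simp_all add: power_0_left)
      qed
      finally show ?thesis by simp
    next
      case False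
      \<comment> \<open>For r \<le> 0 the condition norm x \<le> r leaves at most the
        origin.\<close>
      have "AE x :: real ^ 'n in lborel. (if norm x \<le> r then real ?n * r powr (- real ?n - 1) else 0) = 0"
      proof (rule eventually_mono[OF AE_lborel_singleton[of "0 :: real ^ 'n"]])
        fix x :: "real ^ 'n" assume "x \<noteq> 0"
        then have "0 < norm x" by simp
        then have "\<not> norm x \<le> r" using False by linarith
        then show "(if norm x \<le> r then real ?n * r powr (- real ?n - 1) else 0) = 0" by simp
      qed
      then have "(\<integral>\<^sup>+x. ennreal (if norm x \<le> r then real ?n * r powr (- real ?n - 1) else 0) * (ennreal (norm x ^ ?n) * F x) \<partial>lborel)
        = (\<integral>\<^sup>+x. 0 \<partial>(lborel :: (real ^ 'n) measure))"
        by (intro nn_integral_cong_AE) (erule eventually_mono, simp only: ennreal_0 mult_zero_left)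
      then show ?thesis using False by simp
    qed
  qed
  also have "\<dots> = (\<integral>\<^sup>+x. \<integral>\<^sup>+r. ennreal (if norm x \<le> r then real ?n * r powr (- real ?n - 1) else 0) * (ennreal (norm x ^ ?n) * F x) \<partial>lborel \<partial>lborel)"
    by (intro nn_integral_swap sigma_finite_lborel) measurable
  also have "\<dots> = (\<integral>\<^sup>+x. F x \<partial>lborel)"
  proof (rule nn_integral_cong_AE, rule eventually_mono[OF AE_lborel_singleton[of 0]])
    fix x :: "real ^ 'n" assume x: "x \<noteq> 0"
    have "(\<integral>\<^sup>+r. ennreal (if norm x \<le> r then real ?n * r powr (- real ?n - 1) else 0) * (ennreal (norm x ^ ?n) * F x) \<partial>lborel)
      = ennreal (norm x powr (- real ?n)) * (ennreal (norm x ^ ?n) * F x)"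
      using x by (simp add: nn_integral_multc nn_integral_tail_power)
    also have "\<dots> = F x"
      using x by (simp add: mult.assoc[symmetric] ennreal_mult[symmetric] powr_minus powr_realpow)
    finally show "(\<integral>\<^sup>+r. ennreal (if norm x \<le> r then real ?n * r powr (- real ?n - 1) else 0) * (ennreal (norm x ^ ?n) * F x) \<partial>lborel) = F x" .
  qed
  finally show ?thesis by (simp add: F_def)
qed

section \<open>Reduction of the cone to independent power laws\<close>

text \<open>With \<open>t\<^sup>2 = v\<^sup>2 + c\<close> the right-hand side uses the null coordinates \<open>P = (t + v)/2\<close>, \<open>Q = (t - v)/2\<close>, where \<open>c = 4 P Q\<close>.\<close>
lemma nn_integral_light_cone:
  fixes H :: "real \<times> real \<Rightarrow> ennreal"
  assumes a: "0 < a" and [measurable]: "H \<in> borel_measurable (borel \<Otimes>\<^sub>M borel)"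
  shows "(\<integral>\<^sup>+v. \<integral>\<^sup>+c. ennreal (inverse (sqrt (v\<^sup>2 + c))) * H (sqrt (v\<^sup>2 + c), v) \<partial>riesz a \<partial>lborel)
    = ennreal (4 powr a * Gamma a) * (\<integral>\<^sup>+P. \<integral>\<^sup>+Q. H (P + Q, P - Q) \<partial>riesz a \<partial>riesz a)"
proof -
  have G: "0 < Gamma a" using a by (rule Gamma_real_pos)
  interpret g: sigma_finite_measure "riesz a" by (rule sigma_finite_riesz)
  define k where "k y = ennreal (if 0 < y then y powr (a - 1) / Gamma a else 0)" for y :: real
  have [measurable]: "k \<in> borel_measurable borel" unfolding k_def by measurable
  have gk: "(\<integral>\<^sup>+y. F y \<partial>riesz a) = (\<integral>\<^sup>+y. k y * F y \<partial>lborel)"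
    if "F \<in> borel_measurable borel" for F
    unfolding k_def by (rule nn_integral_riesz_pos[OF a that])
  define J where "J t v = ennreal (if \<bar>v\<bar> < t then 2 * (t\<^sup>2 - v\<^sup>2) powr (a - 1) / Gamma a else 0) * H (t, v)" for t v :: real
  have [measurable]: "(\<lambda>(t, v). J t v) \<in> borel_measurable (borel \<Otimes>\<^sub>M borel)" unfolding J_def by measurable
  have "(\<integral>\<^sup>+v. \<integral>\<^sup>+c. ennreal (inverse (sqrt (v\<^sup>2 + c))) * H (sqrt (v\<^sup>2 + c), v) \<partial>riesz a \<partial>lborel)
      = (\<integral>\<^sup>+v. \<integral>\<^sup>+t. J t v \<partial>lborel \<partial>lborel)"
  proof (rule nn_integral_cong)
    fix v :: real
    have "(\<integral>\<^sup>+c. ennreal (inverse (sqrt (v\<^sup>2 + c))) * H (sqrt (v\<^sup>2 + c), v) \<partial>riesz a)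
        = (\<integral>\<^sup>+c. k c * (ennreal (inverse (sqrt (v\<^sup>2 + c))) * H (sqrt (v\<^sup>2 + c), v)) \<partial>lborel)"
      by (rule gk) measurable
    also have "\<dots> = (\<integral>\<^sup>+s. k (s - v\<^sup>2) * (ennreal (inverse (sqrt s)) * H (sqrt s, v)) \<partial>lborel)"
      by (subst (2) nn_integral_real_affine[where t = "v\<^sup>2" and c = 1]) simp_all
    also have "\<dots> = (\<integral>\<^sup>+s\<in>{0..}. k (s - v\<^sup>2) * (ennreal (inverse (sqrt s)) * H (sqrt s, v)) \<partial>lborel)"
    proof (rule nn_integral_cong)
      fix s :: real
      have "k (s - v\<^sup>2) = 0" if "s < 0"
      proof -
        have "s - v\<^sup>2 < 0" using that by (smt (verit) zero_le_power2)
        then show ?thesis by (simp add: k_def)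
      qed
      then show "k (s - v\<^sup>2) * (ennreal (inverse (sqrt s)) * H (sqrt s, v))
          = k (s - v\<^sup>2) * (ennreal (inverse (sqrt s)) * H (sqrt s, v)) * indicator {0..} s"
        by (cases "s < 0") simp_all
    qed
    also have "\<dots> = (\<integral>\<^sup>+t\<in>{0..}. k (t\<^sup>2 - v\<^sup>2) * (ennreal (inverse (sqrt (t\<^sup>2))) * H (sqrt (t\<^sup>2), v)) * ennreal (2 * t) \<partial>lborel)"
      by (rule nn_integral_square_substitution) measurable
    also have "\<dots> = (\<integral>\<^sup>+t. J t v \<partial>lborel)"
    proof (rule nn_integral_cong_AE, rule eventually_mono[OF AE_lborel_singleton[of 0]])
      fix t :: real assume t: "t \<noteq> 0"
      show "k (t\<^sup>2 - v\<^sup>2) * (ennreal (inverse (sqrt (t\<^sup>2))) * H (sqrt (t\<^sup>2), v)) * ennreal (2 * t) * indicator {0..} t = J t v"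
      proof (cases "0 < t")
        case True
        have lt: "v\<^sup>2 < t\<^sup>2 \<longleftrightarrow> \<bar>v\<bar> < t" using True abs_le_square_iff[of t v] by (simp add: not_le[symmetric])
        have "k (t\<^sup>2 - v\<^sup>2) * ennreal (inverse t) * ennreal (2 * t) = k (t\<^sup>2 - v\<^sup>2) * 2"
        proof -
          have "inverse t * (2 * t) = 2" using True by simp
          moreover have "ennreal (inverse t) * ennreal (2 * t) = ennreal (inverse t * (2 * t))"
            using True by (intro ennreal_mult[symmetric]) simp_all
          ultimately have "ennreal (inverse t) * ennreal (2 * t) = 2" by (simp only:) simp
          then show ?thesis by (simp only: mult.assoc)
        qed
        also have "\<dots> = ennreal (if \<bar>v\<bar> < t then 2 * (t\<^sup>2 - v\<^sup>2) powr (a - 1) / Gamma a else 0)"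
        proof (cases "\<bar>v\<bar> < t")
          case *: True
          have "ennreal ((t\<^sup>2 - v\<^sup>2) powr (a - 1) / Gamma a) * ennreal 2 = ennreal (2 * (t\<^sup>2 - v\<^sup>2) powr (a - 1) / Gamma a)"
            using G by (subst ennreal_mult[symmetric]) (simp_all add: mult.commute)
          then show ?thesis using * lt by (simp add: k_def)
        qed (use lt in \<open>simp add: k_def\<close>)
        finally have e: "k (t\<^sup>2 - v\<^sup>2) * ennreal (inverse t) * ennreal (2 * t)
          = ennreal (if \<bar>v\<bar> < t then 2 * (t\<^sup>2 - v\<^sup>2) powr (a - 1) / Gamma a else 0)" .
        have "k (t\<^sup>2 - v\<^sup>2) * (ennreal (inverse t) * H (t, v)) * ennreal (2 * t) = (k (t\<^sup>2 - v\<^sup>2) * ennreal (inverse t) * ennreal (2 * t)) * H (t, v)"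
          by (simp only: mult_ac)
        then show ?thesis using True unfolding J_def e by simp
      next
        case False
        then have "\<not> \<bar>v\<bar> < t" by linarith
        then show ?thesis using False t by (simp add: J_def)
      qed
    qed
    finally show "(\<integral>\<^sup>+c. ennreal (inverse (sqrt (v\<^sup>2 + c))) * H (sqrt (v\<^sup>2 + c), v) \<partial>riesz a) = (\<integral>\<^sup>+t. J t v \<partial>lborel)" .
  qed
  \<comment> \<open>The null coordinates are introduced one at a time: t = v + 2 Q for fixed v, with
    Jacobian 2, and then v = P - Q for fixed Q.\<close>
  also have "\<dots> = (\<integral>\<^sup>+v. \<integral>\<^sup>+Q. 2 * J (v + 2 * Q) v \<partial>lborel \<partial>lborel)"
  proof (rule nn_integral_cong)
    fix v :: real
    show "(\<integral>\<^sup>+t. J t v \<partial>lborel) = (\<integral>\<^sup>+Q. 2 * J (v + 2 * Q) v \<partial>lborel)"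
      by (subst nn_integral_real_affine[where t = v and c = 2]) (simp_all add: nn_integral_cmult)
  qed
  also have "\<dots> = (\<integral>\<^sup>+Q. \<integral>\<^sup>+v. 2 * J (v + 2 * Q) v \<partial>lborel \<partial>lborel)"
    by (intro nn_integral_swap sigma_finite_lborel) measurable
  also have "\<dots> = (\<integral>\<^sup>+Q. \<integral>\<^sup>+P. 2 * J (P + Q) (P - Q) \<partial>lborel \<partial>lborel)"
  proof (rule nn_integral_cong)
    fix Q :: real
    show "(\<integral>\<^sup>+v. 2 * J (v + 2 * Q) v \<partial>lborel) = (\<integral>\<^sup>+P. 2 * J (P + Q) (P - Q) \<partial>lborel)"
      by (subst nn_integral_real_affine[where t = "-Q" and c = 1]) (simp_all add: algebra_simps)
  qed
  also have "\<dots> = (\<integral>\<^sup>+P. \<integral>\<^sup>+Q. 2 * J (P + Q) (P - Q) \<partial>lborel \<partial>lborel)"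
    by (intro nn_integral_swap sigma_finite_lborel) measurable
  \<comment> \<open>The 4^(a - 1) of (4 P Q)^(a - 1), a 2 from the substitution t^2 and a 2 from t =
    v + 2 Q make 4^a. One \<open>riesz a\<close> has become two, which leaves a factor Gamma
    a.\<close>
  also have "\<dots> = (\<integral>\<^sup>+P. \<integral>\<^sup>+Q. ennreal (4 powr a * Gamma a) * (k P * (k Q * H (P + Q, P - Q))) \<partial>lborel \<partial>lborel)"
  proof (intro nn_integral_cong)
    fix P Q :: real
    have pos: "\<bar>P - Q\<bar> < P + Q \<longleftrightarrow> 0 < P \<and> 0 < Q" by (auto simp: abs_if)
    show "2 * J (P + Q) (P - Q) = ennreal (4 powr a * Gamma a) * (k P * (k Q * H (P + Q, P - Q)))"
    proof (cases "0 < P \<and> 0 < Q")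
      case True
      have "(P + Q)\<^sup>2 - (P - Q)\<^sup>2 = 4 * (P * Q)" by (simp add: power2_eq_square algebra_simps)
      moreover have "(4 * (P * Q)) powr (a - 1) = 4 powr (a - 1) * (P powr (a - 1) * Q powr (a - 1))"
        using True by (simp add: powr_mult)
      moreover have "(4::real) powr a = 4 powr (a - 1) * 4" using powr_add[of 4 "a - 1" 1] by simp
      ultimately have "2 * (2 * ((P + Q)\<^sup>2 - (P - Q)\<^sup>2) powr (a - 1) / Gamma a)
          = 4 powr a * Gamma a * (P powr (a - 1) / Gamma a * (Q powr (a - 1) / Gamma a))"
        using G by simp
      then have "ennreal 2 * ennreal (2 * ((P + Q)\<^sup>2 - (P - Q)\<^sup>2) powr (a - 1) / Gamma a)
          = ennreal (4 powr a * Gamma a) * (ennreal (P powr (a - 1) / Gamma a) * ennreal (Q powr (a - 1) / Gamma a))"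
        using G by (simp only: ennreal_mult[symmetric] mult_nonneg_nonneg divide_nonneg_nonneg powr_ge_zero less_imp_le zero_le_numeral)
      then have "2 * ennreal (2 * ((P + Q)\<^sup>2 - (P - Q)\<^sup>2) powr (a - 1) / Gamma a) * H (P + Q, P - Q)
          = ennreal (4 powr a * Gamma a) * (ennreal (P powr (a - 1) / Gamma a) * ennreal (Q powr (a - 1) / Gamma a)) * H (P + Q, P - Q)"
        by simp
      then show ?thesis using True pos by (simp only: J_def k_def if_True mult.assoc simp_thms)
    qed (use pos in \<open>auto simp: J_def k_def\<close>)
  qed
  also have "\<dots> = (\<integral>\<^sup>+P. ennreal (4 powr a * Gamma a) * (k P * (\<integral>\<^sup>+Q. H (P + Q, P - Q) \<partial>riesz a)) \<partial>lborel)"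
  proof (rule nn_integral_cong)
    fix P :: real
    have "(\<integral>\<^sup>+Q. ennreal (4 powr a * Gamma a) * (k P * (k Q * H (P + Q, P - Q))) \<partial>lborel)
      = ennreal (4 powr a * Gamma a) * (\<integral>\<^sup>+Q. k P * (k Q * H (P + Q, P - Q)) \<partial>lborel)"
      by (rule nn_integral_cmult) measurable
    also have "(\<integral>\<^sup>+Q. k P * (k Q * H (P + Q, P - Q)) \<partial>lborel) = k P * (\<integral>\<^sup>+Q. k Q * H (P + Q, P - Q) \<partial>lborel)"
      by (rule nn_integral_cmult) measurable
    also have "(\<integral>\<^sup>+Q. k Q * H (P + Q, P - Q) \<partial>lborel) = (\<integral>\<^sup>+Q. H (P + Q, P - Q) \<partial>riesz a)"
      by (rule gk[symmetric]) measurable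
    finally show "(\<integral>\<^sup>+Q. ennreal (4 powr a * Gamma a) * (k P * (k Q * H (P + Q, P - Q))) \<partial>lborel)
      = ennreal (4 powr a * Gamma a) * (k P * (\<integral>\<^sup>+Q. H (P + Q, P - Q) \<partial>riesz a))" .
  qed
  also have "\<dots> = ennreal (4 powr a * Gamma a) * (\<integral>\<^sup>+P. k P * (\<integral>\<^sup>+Q. H (P + Q, P - Q) \<partial>riesz a) \<partial>lborel)"
    by (rule nn_integral_cmult) measurable
  also have "(\<integral>\<^sup>+P. k P * (\<integral>\<^sup>+Q. H (P + Q, P - Q) \<partial>riesz a) \<partial>lborel) = (\<integral>\<^sup>+P. \<integral>\<^sup>+Q. H (P + Q, P - Q) \<partial>riesz a \<partial>riesz a)"
    by (rule gk[symmetric]) measurable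
  finally show ?thesis .
qed

section \<open>Product structure over the coordinates\<close>

lemma measurable_vec_lambda:
  "(\<lambda>f. \<chi> i. f i) \<in> (\<Pi>\<^sub>M i\<in>(UNIV :: 'n::finite set). (lborel :: real measure)) \<rightarrow>\<^sub>M borel"
proof (subst borel_measurable_euclidean_space, rule ballI)
  fix b :: "real ^ 'n" assume "b \<in> Basis"
  then obtain i where b: "b = axis i 1" by (auto simp: Basis_vec_def)
  show "(\<lambda>f. (\<chi> i. f i) \<bullet> b) \<in> borel_measurable (\<Pi>\<^sub>M i\<in>(UNIV :: 'n set). (lborel :: real measure))"
    unfolding b using measurable_component_singleton[of i UNIV "\<lambda>_. lborel :: real measure"] by (simp add: inner_axis)
qed

text \<open>Agreement on boxes determines the measure. The induction over coordinates takes place on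
  functions over a finite index set, while the cone lives in \<open>real ^ 'n\<close>; this connects
  the two.\<close>

lemma lborel_vec:
  "distr (\<Pi>\<^sub>M i\<in>(UNIV :: 'n::finite set). (lborel :: real measure)) borel (\<lambda>f. \<chi> i. f i) = lborel"
    (is "distr ?P borel ?v = _")
proof (rule lborel_eqI[symmetric])
  interpret product_sigma_finite "\<lambda>_::'n. lborel :: real measure" by standard
  have m: "?v \<in> ?P \<rightarrow>\<^sub>M borel" by (rule measurable_vec_lambda)
  fix l u :: "real ^ 'n" assume le: "\<And>b. b \<in> Basis \<Longrightarrow> l \<bullet> b \<le> u \<bullet> b"
  have "emeasure (distr ?P borel ?v) (box l u) = emeasure ?P (?v -` box l u \<inter> space ?P)"
    by (rule emeasure_distr[OF m]) simp
  also have "?v -` box l u \<inter> space ?P = (\<Pi>\<^sub>E i\<in>UNIV. {l $ i<..<u $ i})"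
    by (auto simp: mem_box_cart space_PiM PiE_iff)
  also have "emeasure ?P \<dots> = (\<Prod>i\<in>UNIV. emeasure lborel {l $ i<..<u $ i})"
    by (rule emeasure_PiM) auto
  also have "\<dots> = ennreal (\<Prod>i\<in>UNIV. u $ i - l $ i)"
  proof -
    have "l $ i \<le> u $ i" for i
      using le[of "axis i 1"] by (simp add: inner_axis)
    then show ?thesis by (simp add: prod_ennreal)
  qed
  also have "(\<Prod>i\<in>UNIV. u $ i - l $ i) = prod ((\<bullet>) (u - l)) Basis"
    by (simp add: Basis_vec_def cart_eq_inner_axis axis_eq_axis prod.UNION_disjoint inner_diff_left)
  finally show "emeasure (distr ?P borel ?v) (box l u) = ennreal (prod ((\<bullet>) (u - l)) Basis)" .
qed simp

lemma measurable_ident_u_measure: "(\<lambda>u. u) \<in> borel_measurable (u_measure k)"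
  by (cases "k = 0") (simp_all add: u_measure_def measurable_restrict_space1)

lemma measurable_u_measure_component:
  assumes "i \<in> I"
  shows "(\<lambda>u. u i) \<in> borel_measurable (\<Pi>\<^sub>M i\<in>I. u_measure (\<kappa> i))"
  by (rule measurable_compose[where g = "\<lambda>u. u", OF measurable_component_singleton[OF assms] measurable_ident_u_measure])

text \<open>The inductive step of \<open>product_formula\<close>. The two power laws merge by
  \<open>riesz_convolution\<close>; rotating (w, z) leaves a linear form in v alone, and the square
  of the other coordinate joins the power law as \<open>riesz (1/2)\<close>, at the price of sqrt
  pi.\<close>

lemma riesz_rotation:
  fixes G :: "real \<times> real \<Rightarrow> ennreal"
  assumes k: "0 \<le> k" and a: "0 \<le> a" and [measurable]: "G \<in> borel_measurable (borel \<Otimes>\<^sub>M borel)"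
  shows "(\<integral>\<^sup>+w. \<integral>\<^sup>+b. (\<integral>\<^sup>+z. \<integral>\<^sup>+c. G ((w\<^sup>2 + b) + (z\<^sup>2 + c), e * w + N * z) \<partial>riesz a \<partial>lborel) \<partial>riesz k \<partial>lborel)
    = ennreal (sqrt pi) * (\<integral>\<^sup>+v. \<integral>\<^sup>+c. G (v\<^sup>2 + c, sqrt (e\<^sup>2 + N\<^sup>2) * v) \<partial>riesz (1/2 + (k + a)) \<partial>lborel)"
proof -
  interpret g: sigma_finite_measure "riesz b" for b by (rule sigma_finite_riesz)
  define K where "K s t = (\<integral>\<^sup>+c. G (s + c, t) \<partial>riesz (k + a))" for s t
  have Km [measurable]: "(\<lambda>(s, t). K s t) \<in> borel_measurable (borel \<Otimes>\<^sub>M borel)" unfolding K_def by measurable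
  have Kg: "(\<integral>\<^sup>+b. K (v\<^sup>2 + b) (sqrt (e\<^sup>2 + N\<^sup>2) * v) \<partial>riesz (1/2))
      = (\<integral>\<^sup>+c. G (v\<^sup>2 + c, sqrt (e\<^sup>2 + N\<^sup>2) * v) \<partial>riesz (1/2 + (k + a)))" for v
    using riesz_convolution[of "1/2" "k + a" "\<lambda>c. G (v\<^sup>2 + c, sqrt (e\<^sup>2 + N\<^sup>2) * v)"] a k
    by (simp add: K_def add.assoc)
  have "(\<integral>\<^sup>+b. (\<integral>\<^sup>+z. \<integral>\<^sup>+c. G ((w\<^sup>2 + b) + (z\<^sup>2 + c), e * w + N * z) \<partial>riesz a \<partial>lborel) \<partial>riesz k)
      = (\<integral>\<^sup>+z. K (w\<^sup>2 + z\<^sup>2) (e * w + N * z) \<partial>lborel)" for w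
  proof -
    have "(\<integral>\<^sup>+b. \<integral>\<^sup>+c. G ((w\<^sup>2 + b) + (z\<^sup>2 + c), e * w + N * z) \<partial>riesz a \<partial>riesz k) = K (w\<^sup>2 + z\<^sup>2) (e * w + N * z)" for z
      using riesz_convolution[OF k a, of "\<lambda>c. G ((w\<^sup>2 + z\<^sup>2) + c, e * w + N * z)"]
      by (simp add: K_def algebra_simps)
    then show ?thesis
      by (subst nn_integral_swap) (simp_all add: sigma_finite_lborel sigma_finite_riesz)
  qed
  then have "(\<integral>\<^sup>+w. \<integral>\<^sup>+b. (\<integral>\<^sup>+z. \<integral>\<^sup>+c. G ((w\<^sup>2 + b) + (z\<^sup>2 + c), e * w + N * z) \<partial>riesz a \<partial>lborel) \<partial>riesz k \<partial>lborel)
      = (\<integral>\<^sup>+v. \<integral>\<^sup>+w. K (v\<^sup>2 + w\<^sup>2) (sqrt (e\<^sup>2 + N\<^sup>2) * v) \<partial>lborel \<partial>lborel)"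
    using rotation_formula[of "\<lambda>(s, t). K s t" e N] by simp
  also have "\<dots> = (\<integral>\<^sup>+v. ennreal (sqrt pi) * (\<integral>\<^sup>+b. K (v\<^sup>2 + b) (sqrt (e\<^sup>2 + N\<^sup>2) * v) \<partial>riesz (1/2)) \<partial>lborel)"
    by (intro nn_integral_cong nn_integral_square_riesz) measurable
  also have "\<dots> = ennreal (sqrt pi) * (\<integral>\<^sup>+v. (\<integral>\<^sup>+b. K (v\<^sup>2 + b) (sqrt (e\<^sup>2 + N\<^sup>2) * v) \<partial>riesz (1/2)) \<partial>lborel)"
    by (rule nn_integral_cmult) measurable
  finally show ?thesis by (simp only: Kg)
qed

text \<open>Induction on the coordinates. The invariant is that the squared radius and the linear
  form are distributed like v^2 + c and N v, where v is Lebesgue, c follows an independent power law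
  and N is the length of \<eta>. A new coordinate has this shape by
  \<open>coordinate_formula\<close>, and \<open>riesz_rotation\<close> merges the two pairs. The
  exponent is \<kappa> i for one coordinate and grows by \<kappa> i + 1/2 with each further
  one.\<close>

lemma product_formula:
  fixes \<kappa> \<eta> :: "'i \<Rightarrow> real" and G :: "real \<times> real \<Rightarrow> ennreal"
  assumes "finite I" "I \<noteq> {}" and \<kappa>: "\<And>i. 0 \<le> \<kappa> i" and "G \<in> borel_measurable (borel \<Otimes>\<^sub>M borel)"
  shows "(\<integral>\<^sup>+x. \<integral>\<^sup>+u. ennreal (\<Prod>i\<in>I. coord_weight (\<kappa> i) (x i)) * G (\<Sum>i\<in>I. (x i)\<^sup>2, \<Sum>i\<in>I. \<eta> i * (x i * u i))
      \<partial>(\<Pi>\<^sub>M i\<in>I. u_measure (\<kappa> i)) \<partial>(\<Pi>\<^sub>M i\<in>I. lborel))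
    = ennreal ((\<Prod>i\<in>I. Gamma (\<kappa> i + 1/2)) / sqrt pi) *
      (\<integral>\<^sup>+v. \<integral>\<^sup>+c. G (v\<^sup>2 + c, sqrt (\<Sum>i\<in>I. (\<eta> i)\<^sup>2) * v) \<partial>riesz ((\<Sum>i\<in>I. \<kappa> i) + (real (card I) - 1) / 2) \<partial>lborel)"
  using assms(1,2,4)
proof (induction I arbitrary: G rule: finite_ne_induct)
  case (singleton i)
  note [measurable] = singleton
  interpret U: product_prob_space "\<lambda>i. u_measure (\<kappa> i)"
    by (intro product_prob_spaceI prob_space_u_measure \<kappa>)
  interpret L: product_sigma_finite "\<lambda>_::'i. lborel :: real measure" by standard
  interpret g: sigma_finite_measure "riesz a" for a by (rule sigma_finite_riesz)
  note id [measurable] = measurable_ident_u_measure[of "\<kappa> i"]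
  have "(\<integral>\<^sup>+x. \<integral>\<^sup>+u. ennreal (\<Prod>i\<in>{i}. coord_weight (\<kappa> i) (x i)) * G (\<Sum>i\<in>{i}. (x i)\<^sup>2, \<Sum>i\<in>{i}. \<eta> i * (x i * u i))
      \<partial>(\<Pi>\<^sub>M i\<in>{i}. u_measure (\<kappa> i)) \<partial>(\<Pi>\<^sub>M i\<in>{i}. lborel))
    = (\<integral>\<^sup>+x. \<integral>\<^sup>+u. ennreal (coord_weight (\<kappa> i) (x i)) * G ((x i)\<^sup>2, \<eta> i * (x i * u i)) \<partial>(\<Pi>\<^sub>M i\<in>{i}. u_measure (\<kappa> i)) \<partial>(\<Pi>\<^sub>M i\<in>{i}. lborel))"
    by simp
  also have "\<dots> = (\<integral>\<^sup>+x. \<integral>\<^sup>+u. ennreal (coord_weight (\<kappa> i) (x i)) * G ((x i)\<^sup>2, \<eta> i * (x i * u)) \<partial>u_measure (\<kappa> i) \<partial>(\<Pi>\<^sub>M i\<in>{i}. lborel))"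
    by (intro nn_integral_cong U.product_nn_integral_singleton[of "\<lambda>u. ennreal (coord_weight (\<kappa> i) (_ i)) * G ((_ i)\<^sup>2, \<eta> i * (_ i * u))"]) measurable
  also have "\<dots> = (\<integral>\<^sup>+y. \<integral>\<^sup>+u. ennreal (coord_weight (\<kappa> i) y) * G (y\<^sup>2, \<eta> i * (y * u)) \<partial>u_measure (\<kappa> i) \<partial>lborel)"
    by (rule L.product_nn_integral_singleton) measurable
  also have "\<dots> = (\<integral>\<^sup>+y. ennreal (coord_weight (\<kappa> i) y) * (\<integral>\<^sup>+u. G (y\<^sup>2, \<eta> i * (y * u)) \<partial>u_measure (\<kappa> i)) \<partial>lborel)"
    by (intro nn_integral_cong nn_integral_cmult) measurable
  also have "\<dots> = ennreal (Gamma (\<kappa> i + 1/2) / sqrt pi) * (\<integral>\<^sup>+v. \<integral>\<^sup>+c. G (v\<^sup>2 + c, \<eta> i * v) \<partial>riesz (\<kappa> i) \<partial>lborel)"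
    using coordinate_formula[OF \<kappa>, of "\<lambda>(t, v). G (t, \<eta> i * v)" i] by simp
  \<comment> \<open>The length of \<eta> has no sign; a reflection of v accounts for it.\<close>
  also have "(\<integral>\<^sup>+v. \<integral>\<^sup>+c. G (v\<^sup>2 + c, \<eta> i * v) \<partial>riesz (\<kappa> i) \<partial>lborel) = (\<integral>\<^sup>+v. \<integral>\<^sup>+c. G (v\<^sup>2 + c, \<bar>\<eta> i\<bar> * v) \<partial>riesz (\<kappa> i) \<partial>lborel)"
  proof (cases "0 \<le> \<eta> i")
    case False then show ?thesis
      by (subst nn_integral_real_affine[where t = 0 and c = "-1"]) simp_all
  qed simp
  finally show ?case by simp
next
  case (insert i I)
  note [measurable] = insert.prems
  let ?U = "\<Pi>\<^sub>M i\<in>I. u_measure (\<kappa> i)" and ?L = "\<Pi>\<^sub>M i\<in>I. (lborel :: real measure)"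
  let ?U' = "\<Pi>\<^sub>M i\<in>insert i I. u_measure (\<kappa> i)" and ?L' = "\<Pi>\<^sub>M i\<in>insert i I. (lborel :: real measure)"
  interpret U: product_prob_space "\<lambda>i. u_measure (\<kappa> i)"
    by (intro product_prob_spaceI prob_space_u_measure \<kappa>)
  interpret L: product_sigma_finite "\<lambda>_::'i. lborel :: real measure" by standard
  interpret g: sigma_finite_measure "riesz a" for a by (rule sigma_finite_riesz)
  interpret UI: prob_space ?U by (rule prob_space_PiM) (rule prob_space_u_measure[OF \<kappa>])
  interpret UI': prob_space ?U' by (rule prob_space_PiM) (rule prob_space_u_measure[OF \<kappa>])
  interpret LI: sigma_finite_measure ?L by (rule L.sigma_finite) fact
  note id [measurable] = measurable_ident_u_measure[of "\<kappa> i"]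
  have comp [measurable]: "(\<lambda>u. u j) \<in> borel_measurable ?U" if "j \<in> I" for j
    using measurable_u_measure_component[OF that] .
  have comp' [measurable]: "(\<lambda>u. u j) \<in> borel_measurable ?U'" if "j \<in> insert i I" for j
    using measurable_u_measure_component[OF that] .
  define f where "f x u = ennreal (\<Prod>i\<in>insert i I. coord_weight (\<kappa> i) (x i)) * G (\<Sum>i\<in>insert i I. (x i)\<^sup>2, \<Sum>i\<in>insert i I. \<eta> i * (x i * u i))" for x u
  define a where "a = (\<Sum>i\<in>I. \<kappa> i) + (real (card I) - 1) / 2"
  have a: "0 \<le> a"
    unfolding a_def using insert.hyps \<kappa> by (intro add_nonneg_nonneg sum_nonneg) (simp_all add: Suc_le_eq card_gt_0_iff)
  define N where "N = sqrt (\<Sum>i\<in>I. (\<eta> i)\<^sup>2)"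
  define C where "C = (\<Prod>i\<in>I. Gamma (\<kappa> i + 1/2)) / sqrt pi"
  have Gp: "0 < Gamma (\<kappa> j + 1/2)" for j using \<kappa>[of j] by (intro Gamma_real_pos) simp
  have C: "0 \<le> C" unfolding C_def using Gp by (simp add: prod_nonneg less_imp_le)
  have fm: "(\<lambda>p. f (fst p) (snd p)) \<in> borel_measurable (?L' \<Otimes>\<^sub>M ?U')"
  proof -
    have [measurable]: "(\<lambda>p. snd p j) \<in> borel_measurable (?L' \<Otimes>\<^sub>M ?U')"
      if "j \<in> insert i I" for j
      by (rule measurable_compose[OF measurable_snd comp'[OF that]])
    show ?thesis unfolding f_def by measurable
  qed
  define h where "h y v x u = ennreal (coord_weight (\<kappa> i) y) * (ennreal (\<Prod>i\<in>I. coord_weight (\<kappa> i) (x i))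
      * G (y\<^sup>2 + (\<Sum>i\<in>I. (x i)\<^sup>2), \<eta> i * (y * v) + (\<Sum>i\<in>I. \<eta> i * (x i * u i))))" for y v :: real and x u :: "'i \<Rightarrow> real"
  have fh: "f (x(i := y)) (u(i := v)) = h y v x u" for x u y v
  proof -
    have "(\<Prod>j\<in>I. coord_weight (\<kappa> j) ((x(i := y)) j)) = (\<Prod>j\<in>I. coord_weight (\<kappa> j) (x j))"
      "(\<Sum>j\<in>I. ((x(i := y)) j)\<^sup>2) = (\<Sum>j\<in>I. (x j)\<^sup>2)"
      "(\<Sum>j\<in>I. \<eta> j * ((x(i := y)) j * (u(i := v)) j)) = (\<Sum>j\<in>I. \<eta> j * (x j * u j))"
      using insert.hyps(3) by (auto intro!: prod.cong sum.cong split: if_splits)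
    then show ?thesis using insert.hyps
      by (simp add: f_def h_def ennreal_mult' prod_nonneg mult.assoc del: fun_upd_apply) simp
  qed
  have hm: "(\<lambda>p. h (fst p) (fst (snd p)) (fst (snd (snd p))) (snd (snd (snd p)))) \<in> borel_measurable (lborel \<Otimes>\<^sub>M u_measure (\<kappa> i) \<Otimes>\<^sub>M ?L \<Otimes>\<^sub>M ?U)"
  proof -
    have [measurable]: "(\<lambda>p. snd (snd (snd p)) j) \<in> borel_measurable (lborel \<Otimes>\<^sub>M u_measure (\<kappa> i) \<Otimes>\<^sub>M ?L \<Otimes>\<^sub>M ?U)"
      if "j \<in> I" for j
      by (rule measurable_compose[where g = "\<lambda>u. u j", OF _ comp[OF that]]) simp
    have [measurable]: "(\<lambda>p. fst (snd p)) \<in> borel_measurable (lborel \<Otimes>\<^sub>M u_measure (\<kappa> i) \<Otimes>\<^sub>M ?L \<Otimes>\<^sub>M ?U)"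
      by (rule measurable_compose[where g = "\<lambda>u. u", OF _ id]) simp
    show ?thesis unfolding h_def by measurable
  qed
  \<comment> \<open>Coordinate i is split off from both x and u, as y and v; the others are then
    integrated first, for fixed y and v.\<close>
  have "(\<integral>\<^sup>+x. \<integral>\<^sup>+u. f x u \<partial>?U' \<partial>?L')
    = (\<integral>\<^sup>+y. \<integral>\<^sup>+x. \<integral>\<^sup>+u. f (x(i := y)) u \<partial>?U' \<partial>?L \<partial>lborel)"
    using UI'.borel_measurable_nn_integral_fst[OF fm]
    by (intro L.product_nn_integral_insert_rev insert.hyps) simp_all
  also have "\<dots> = (\<integral>\<^sup>+y. \<integral>\<^sup>+x. \<integral>\<^sup>+v. \<integral>\<^sup>+u. h y v x u \<partial>?U \<partial>u_measure (\<kappa> i) \<partial>?L \<partial>lborel)"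
  proof (intro nn_integral_cong)
    fix y :: real and x assume x: "x \<in> space ?L"
    have "x(i := y) \<in> space ?L'"
      using x by (auto simp: space_PiM PiE_def extensional_def)
    then have "f (x(i := y)) \<in> borel_measurable ?U'"
      using measurable_compose[OF measurable_Pair1' fm] by simp
    then have "(\<integral>\<^sup>+u. f (x(i := y)) u \<partial>?U')
        = (\<integral>\<^sup>+v. \<integral>\<^sup>+u. f (x(i := y)) (u(i := v)) \<partial>?U \<partial>u_measure (\<kappa> i))"
      by (intro U.product_nn_integral_insert_rev insert.hyps)
    then show "(\<integral>\<^sup>+u. f (x(i := y)) u \<partial>?U') = (\<integral>\<^sup>+v. \<integral>\<^sup>+u. h y v x u \<partial>?U \<partial>u_measure (\<kappa> i))"
      by (simp only: fh)
  qed
  also have "\<dots> = (\<integral>\<^sup>+y. \<integral>\<^sup>+v. \<integral>\<^sup>+x. \<integral>\<^sup>+u. h y v x u \<partial>?U \<partial>?L \<partial>u_measure (\<kappa> i) \<partial>lborel)"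
  proof (rule nn_integral_cong, rule nn_integral_swap)
    fix y :: real
    show "(\<lambda>(x, v). \<integral>\<^sup>+u. h y v x u \<partial>?U) \<in> borel_measurable (?L \<Otimes>\<^sub>M u_measure (\<kappa> i))"
    proof -
      have "(\<lambda>q. h y (snd (fst q)) (fst (fst q)) (snd q)) \<in> borel_measurable ((?L \<Otimes>\<^sub>M u_measure (\<kappa> i)) \<Otimes>\<^sub>M ?U)"
        using measurable_compose[OF _ hm, of "\<lambda>q. (y, snd (fst q), fst (fst q), snd q)" "(?L \<Otimes>\<^sub>M u_measure (\<kappa> i)) \<Otimes>\<^sub>M ?U"] by simp
      from UI.borel_measurable_nn_integral_fst[OF this] show ?thesis by (simp add: split_beta)
    qed
  qed (rule LI.sigma_finite_measure_axioms prob_space_imp_sigma_finite prob_space_u_measure \<kappa>)+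
  also have "\<dots> = (\<integral>\<^sup>+y. \<integral>\<^sup>+v. ennreal (coord_weight (\<kappa> i) y) *
      (ennreal C * (\<integral>\<^sup>+z. \<integral>\<^sup>+c. G (y\<^sup>2 + (z\<^sup>2 + c), \<eta> i * (y * v) + N * z) \<partial>riesz a \<partial>lborel)) \<partial>u_measure (\<kappa> i) \<partial>lborel)"
  proof (intro nn_integral_cong)
    fix y v :: real
    \<comment> \<open>The induction hypothesis is applied to G translated by the contribution of
      coordinate i, hence the induction with G arbitrary.\<close>
    let ?G = "\<lambda>(s, t). G (y\<^sup>2 + s, \<eta> i * (y * v) + t)"
    let ?k = "\<lambda>x u. ennreal (\<Prod>i\<in>I. coord_weight (\<kappa> i) (x i)) * ?G (\<Sum>i\<in>I. (x i)\<^sup>2, \<Sum>i\<in>I. \<eta> i * (x i * u i))"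
    have km: "(\<lambda>p. ?k (fst p) (snd p)) \<in> borel_measurable (?L \<Otimes>\<^sub>M ?U)"
    proof -
      have [measurable]: "(\<lambda>p. snd p j) \<in> borel_measurable (?L \<Otimes>\<^sub>M ?U)"
        if "j \<in> I" for j
        by (rule measurable_compose[OF measurable_snd comp[OF that]])
      show ?thesis by measurable
    qed
    have "(\<integral>\<^sup>+x. \<integral>\<^sup>+u. h y v x u \<partial>?U \<partial>?L) = (\<integral>\<^sup>+x. ennreal (coord_weight (\<kappa> i) y) * (\<integral>\<^sup>+u. ?k x u \<partial>?U) \<partial>?L)"
    proof (rule nn_integral_cong)
      fix x assume x: "x \<in> space ?L"
      have "(\<integral>\<^sup>+u. ennreal (coord_weight (\<kappa> i) y) * ?k x u \<partial>?U) = ennreal (coord_weight (\<kappa> i) y) * (\<integral>\<^sup>+u. ?k x u \<partial>?U)"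
        using measurable_compose[OF measurable_Pair1'[OF x] km] by (intro nn_integral_cmult) simp
      then show "(\<integral>\<^sup>+u. h y v x u \<partial>?U) = ennreal (coord_weight (\<kappa> i) y) * (\<integral>\<^sup>+u. ?k x u \<partial>?U)"
        by (simp add: h_def)
    qed
    also have "\<dots> = ennreal (coord_weight (\<kappa> i) y) * (\<integral>\<^sup>+x. \<integral>\<^sup>+u. ?k x u \<partial>?U \<partial>?L)"
      using UI.borel_measurable_nn_integral_fst[OF km] by (intro nn_integral_cmult) simp
    also have "(\<integral>\<^sup>+x. \<integral>\<^sup>+u. ?k x u \<partial>?U \<partial>?L) = ennreal C * (\<integral>\<^sup>+z. \<integral>\<^sup>+c. G (y\<^sup>2 + (z\<^sup>2 + c), \<eta> i * (y * v) + N * z) \<partial>riesz a \<partial>lborel)"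
      unfolding C_def N_def a_def by (subst insert.IH) simp_all
    finally show "(\<integral>\<^sup>+x. \<integral>\<^sup>+u. h y v x u \<partial>?U \<partial>?L) = ennreal (coord_weight (\<kappa> i) y) *
      (ennreal C * (\<integral>\<^sup>+z. \<integral>\<^sup>+c. G (y\<^sup>2 + (z\<^sup>2 + c), \<eta> i * (y * v) + N * z) \<partial>riesz a \<partial>lborel))" .
  qed
  also have "\<dots> = (\<integral>\<^sup>+y. ennreal (coord_weight (\<kappa> i) y) * (\<integral>\<^sup>+v. ennreal C *
      (\<integral>\<^sup>+z. \<integral>\<^sup>+c. G (y\<^sup>2 + (z\<^sup>2 + c), \<eta> i * (y * v) + N * z) \<partial>riesz a \<partial>lborel) \<partial>u_measure (\<kappa> i)) \<partial>lborel)"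
    by (intro nn_integral_cong nn_integral_cmult) measurable
  also have "\<dots> = ennreal (Gamma (\<kappa> i + 1/2) / sqrt pi) * (\<integral>\<^sup>+w. \<integral>\<^sup>+b. ennreal C *
      (\<integral>\<^sup>+z. \<integral>\<^sup>+c. G ((w\<^sup>2 + b) + (z\<^sup>2 + c), \<eta> i * w + N * z) \<partial>riesz a \<partial>lborel) \<partial>riesz (\<kappa> i) \<partial>lborel)"
    using coordinate_formula[OF \<kappa>, of "\<lambda>(s, t). ennreal C * (\<integral>\<^sup>+z. \<integral>\<^sup>+c. G (s + (z\<^sup>2 + c), \<eta> i * t + N * z) \<partial>riesz a \<partial>lborel)" i]
    by simp
  also have "\<dots> = ennreal (Gamma (\<kappa> i + 1/2) / sqrt pi) * (ennreal C * (\<integral>\<^sup>+w. \<integral>\<^sup>+b.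
      (\<integral>\<^sup>+z. \<integral>\<^sup>+c. G ((w\<^sup>2 + b) + (z\<^sup>2 + c), \<eta> i * w + N * z) \<partial>riesz a \<partial>lborel) \<partial>riesz (\<kappa> i) \<partial>lborel))"
    by (simp add: nn_integral_cmult)
  also note riesz_rotation[OF \<kappa> a insert.prems]
  also have "(\<eta> i)\<^sup>2 + N\<^sup>2 = (\<Sum>i\<in>insert i I. (\<eta> i)\<^sup>2)"
    using insert.hyps by (simp add: N_def sum_nonneg)
  also have "1/2 + (\<kappa> i + a) = (\<Sum>i\<in>insert i I. \<kappa> i) + (real (card (insert i I)) - 1) / 2"
    using insert.hyps by (simp add: a_def field_simps)
  \<comment> \<open>Coordinate i and the block I each bring 1 / sqrt pi; the rotation gives one sqrt
    pi back.\<close>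
  also have "ennreal (Gamma (\<kappa> i + 1/2) / sqrt pi) * (ennreal C * (ennreal (sqrt pi) * X))
      = ennreal ((\<Prod>i\<in>insert i I. Gamma (\<kappa> i + 1/2)) / sqrt pi) * X" for X
  proof -
    have "ennreal (Gamma (\<kappa> i + 1/2) / sqrt pi) * ennreal C * ennreal (sqrt pi) = ennreal (Gamma (\<kappa> i + 1/2) / sqrt pi * C * sqrt pi)"
      using Gp[of i] C by (subst ennreal_mult, simp, simp, subst ennreal_mult) simp_all
    also have "Gamma (\<kappa> i + 1/2) / sqrt pi * C * sqrt pi = (\<Prod>i\<in>insert i I. Gamma (\<kappa> i + 1/2)) / sqrt pi"
    proof -
      have "g / s * (p / s) * s = g * p / s" if "s \<noteq> 0" for g p s :: real using that by simp
      from this[of "sqrt pi"] show ?thesis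
        using insert.hyps by (simp only: C_def prod.insert real_sqrt_eq_zero_cancel_iff pi_neq_zero simp_thms)
    qed
    finally have e: "ennreal (Gamma (\<kappa> i + 1/2) / sqrt pi) * ennreal C * ennreal (sqrt pi) = ennreal ((\<Prod>i\<in>insert i I. Gamma (\<kappa> i + 1/2)) / sqrt pi)" .
    show ?thesis unfolding e[symmetric] by (simp only: mult.assoc)
  qed
  finally show ?case by (simp only: f_def)
qed

lemma prob_space_Phi_measure:
  fixes \<kappa> :: "real ^ 'n"
  assumes "\<And>i. 0 \<le> \<kappa> $ i"
  shows "prob_space (Phi_measure \<kappa>)"
  unfolding Phi_measure_def by (intro prob_space_PiM prob_space_u_measure assms)

lemma borel_measurable_vec_nth [measurable]: "(\<lambda>x :: real ^ 'n. x $ i) \<in> borel_measurable borel"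
  by (intro borel_measurable_continuous_onI continuous_intros)

lemma borel_measurable_fst [measurable]:
  "fst \<in> borel_measurable (borel :: ('a::second_countable_topology \<times> 'b::second_countable_topology) measure)"
  unfolding borel_prod[symmetric] by measurable

lemma borel_measurable_snd [measurable]:
  "snd \<in> borel_measurable (borel :: ('a::second_countable_topology \<times> 'b::second_countable_topology) measure)"
  unfolding borel_prod[symmetric] by measurable

lemma measurable_Phi_component:
  fixes \<kappa> :: "real ^ 'n"
  shows "(\<lambda>u. u i) \<in> borel_measurable (Phi_measure \<kappa>)"
  unfolding Phi_measure_def by (rule measurable_u_measure_component) simp

section \<open>The law of t and V on the cone, and the normalising constant\<close>

text \<open>The integral of \<open>w_weight\<close>, thus the reciprocal of \<open>b_const\<close>.
  Its two factors are the constants of \<open>product_formula\<close> and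
  \<open>nn_integral_light_cone\<close>.\<close>

definition cone_const :: "real ^ 'n \<Rightarrow> real" where
  "cone_const \<kappa> = (\<Prod>i\<in>UNIV. Gamma (\<kappa> $ i + 1/2)) / sqrt pi * (4 powr (alpha \<kappa> + 1/2) * Gamma (alpha \<kappa> + 1/2))"

lemma u_weight_cone:
  fixes x \<kappa> :: "real ^ 'n"
  shows "u_weight \<kappa> (x, t) = (\<Prod>i\<in>UNIV. coord_weight (\<kappa> $ i) (x $ i)) * inverse t"
  by (simp add: u_weight_def h_weight_def coord_weight_def prod_power_distrib)

lemma u_weight_measurable [measurable]:
  fixes \<kappa> :: "real ^ 'n"
  shows "u_weight \<kappa> \<in> borel_measurable borel"
proof -
  have "u_weight \<kappa> = (\<lambda>p. (\<Prod>i\<in>UNIV. coord_weight (\<kappa> $ i) (fst p $ i)) * inverse (snd p))"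
    by (auto simp: u_weight_cone)
  then show ?thesis by simp
qed

lemma nn_integral_lborel_vec:
  fixes F :: "real ^ 'n \<Rightarrow> ennreal"
  assumes [measurable]: "F \<in> borel_measurable borel"
  shows "(\<integral>\<^sup>+x. F x \<partial>lborel) = (\<integral>\<^sup>+f. F (\<chi> i. f i) \<partial>(\<Pi>\<^sub>M i\<in>UNIV. lborel))"
  by (subst lborel_vec[symmetric]) (simp add: nn_integral_distr measurable_vec_lambda)

lemma alpha_half_pos:
  fixes \<kappa> :: "real ^ 'n"
  assumes "CARD('n) \<ge> 2" "\<And>i. 0 \<le> \<kappa> $ i"
  shows "0 < alpha \<kappa> + 1/2" "0 \<le> alpha \<kappa>"
proof -
  have "2 \<le> real CARD('n)" using assms(1) by linarith
  moreover have "0 \<le> (\<Sum>i\<in>UNIV. \<kappa> $ i)" using assms(2) by (simp add: sum_nonneg)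
  ultimately show "0 < alpha \<kappa> + 1/2" "0 \<le> alpha \<kappa>" by (auto simp: alpha_def field_simps)
qed

text \<open>The right side does not depend on the direction of \<eta>, since the rotations in
  \<open>product_formula\<close> retain only its length. The exponent there, the sum of the \<kappa>
  i plus (d - 1)/2, is \<open>alpha \<kappa> + 1/2\<close>.\<close>

lemma cone_formula:
  fixes \<kappa> \<eta> :: "real ^ 'n" and G :: "real \<times> real \<Rightarrow> ennreal"
  assumes d: "CARD('n) \<ge> 2" and \<kappa>: "\<And>i. 0 \<le> \<kappa> $ i" and \<eta>: "norm \<eta> = 1"
    and [measurable]: "G \<in> borel_measurable (borel \<Otimes>\<^sub>M borel)"
  shows "(\<integral>\<^sup>+p. ennreal (u_weight \<kappa> p) * (\<integral>\<^sup>+u. G (snd p, \<Sum>i\<in>UNIV. fst p $ i * \<eta> $ i * u i) \<partial>Phi_measure \<kappa>) \<partial>conic_measure)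
    = ennreal (cone_const \<kappa>) * (\<integral>\<^sup>+P. \<integral>\<^sup>+Q. G (P + Q, P - Q) \<partial>riesz (alpha \<kappa> + 1/2) \<partial>riesz (alpha \<kappa> + 1/2))"
proof -
  interpret Phi: prob_space "Phi_measure \<kappa>" by (rule prob_space_Phi_measure[OF \<kappa>])
  define a where "a = alpha \<kappa> + 1/2"
  have a: "0 < a" using alpha_half_pos[OF d \<kappa>] by (simp add: a_def)
  have aeq: "(\<Sum>i\<in>UNIV. \<kappa> $ i) + (real (card (UNIV :: 'n set)) - 1) / 2 = a"
    by (simp add: a_def alpha_def field_simps)
  have Gp: "0 < Gamma (\<kappa> $ i + 1/2)" for i using \<kappa>[of i] by (intro Gamma_real_pos) simp
  define f :: "(real ^ 'n) \<times> real \<Rightarrow> ennreal" where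
    "f p = ennreal (u_weight \<kappa> p) * (\<integral>\<^sup>+u. G (snd p, \<Sum>i\<in>UNIV. fst p $ i * \<eta> $ i * u i) \<partial>Phi_measure \<kappa>)" for p
  have [measurable]: "f \<in> borel_measurable borel"
  proof -
    have [measurable]: "(\<lambda>p. snd p i) \<in> borel_measurable (borel \<Otimes>\<^sub>M Phi_measure \<kappa>)" for i
      by (rule measurable_compose[OF measurable_snd measurable_Phi_component])
    have "(\<lambda>p. \<integral>\<^sup>+u. G (snd p, \<Sum>i\<in>UNIV. fst p $ i * \<eta> $ i * u i) \<partial>Phi_measure \<kappa>) \<in> borel_measurable borel"
      by measurable
    then show ?thesis unfolding f_def by measurable
  qed
  \<comment> \<open>\<open>product_formula\<close> speaks of the squared radius s; the factor 1 /
    sqrt s is the 1/t of \<open>u_weight\<close>.\<close>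
  define G' where "G' = (\<lambda>(s, t). ennreal (inverse (sqrt s)) * G (sqrt s, t))"
  have G'm [measurable]: "G' \<in> borel_measurable (borel \<Otimes>\<^sub>M borel)" unfolding G'_def by measurable
  have "(\<integral>\<^sup>+p. f p \<partial>conic_measure) = (\<integral>\<^sup>+x. f (x, norm x) \<partial>lborel)"
    by (intro nn_integral_conic_lborel measurable_restrict_space1) measurable
  also have "\<dots> = (\<integral>\<^sup>+x. f (\<chi> i. x i, norm (\<chi> i. x i)) \<partial>(\<Pi>\<^sub>M i\<in>UNIV. lborel))"
    by (rule nn_integral_lborel_vec) measurable
  also have "\<dots> = (\<integral>\<^sup>+x. \<integral>\<^sup>+u. ennreal (\<Prod>i\<in>UNIV. coord_weight (\<kappa> $ i) (x i)) * G' (\<Sum>i\<in>UNIV. (x i)\<^sup>2, \<Sum>i\<in>UNIV. \<eta> $ i * (x i * u i))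
      \<partial>Phi_measure \<kappa> \<partial>(\<Pi>\<^sub>M i\<in>UNIV. lborel))"
  proof (rule nn_integral_cong)
    fix x :: "'n \<Rightarrow> real"
    define s where "s = (\<Sum>i\<in>UNIV. (x i)\<^sup>2)"
    have n: "norm (\<chi> i. x i) = sqrt s" by (simp add: norm_vec_def L2_set_def s_def)
    note measurable_Phi_component [measurable]
    have m: "(\<lambda>u. G (sqrt s, \<Sum>i\<in>UNIV. \<eta> $ i * (x i * u i))) \<in> borel_measurable (Phi_measure \<kappa>)" by measurable
    have "f (\<chi> i. x i, norm (\<chi> i. x i))
      = ennreal ((\<Prod>i\<in>UNIV. coord_weight (\<kappa> $ i) (x i)) * inverse (sqrt s)) * (\<integral>\<^sup>+u. G (sqrt s, \<Sum>i\<in>UNIV. \<eta> $ i * (x i * u i)) \<partial>Phi_measure \<kappa>)"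
      unfolding n by (simp add: f_def u_weight_cone mult.assoc mult.left_commute)
    also have "\<dots> = (\<integral>\<^sup>+u. ennreal ((\<Prod>i\<in>UNIV. coord_weight (\<kappa> $ i) (x i)) * inverse (sqrt s)) * G (sqrt s, \<Sum>i\<in>UNIV. \<eta> $ i * (x i * u i)) \<partial>Phi_measure \<kappa>)"
      using m by (intro nn_integral_cmult[symmetric])
    also have "ennreal ((\<Prod>i\<in>UNIV. coord_weight (\<kappa> $ i) (x i)) * inverse (sqrt s)) = ennreal (\<Prod>i\<in>UNIV. coord_weight (\<kappa> $ i) (x i)) * ennreal (inverse (sqrt s))"
      by (rule ennreal_mult) (simp_all add: prod_nonneg s_def sum_nonneg)
    finally show "f (\<chi> i. x i, norm (\<chi> i. x i)) = (\<integral>\<^sup>+u. ennreal (\<Prod>i\<in>UNIV. coord_weight (\<kappa> $ i) (x i)) * G' (\<Sum>i\<in>UNIV. (x i)\<^sup>2, \<Sum>i\<in>UNIV. \<eta> $ i * (x i * u i)) \<partial>Phi_measure \<kappa>)"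
      unfolding s_def[symmetric] G'_def by (simp add: mult.assoc)
  qed
  also have "\<dots> = ennreal ((\<Prod>i\<in>UNIV. Gamma (\<kappa> $ i + 1/2)) / sqrt pi) *
      (\<integral>\<^sup>+v. \<integral>\<^sup>+c. G' (v\<^sup>2 + c, sqrt (\<Sum>i\<in>UNIV. (\<eta> $ i)\<^sup>2) * v) \<partial>riesz a \<partial>lborel)"
    unfolding Phi_measure_def aeq[symmetric] by (rule product_formula) (simp_all add: \<kappa>)
  also have "sqrt (\<Sum>i\<in>UNIV. (\<eta> $ i)\<^sup>2) = 1"
    using \<eta> by (simp add: norm_vec_def L2_set_def)
  also have "(\<integral>\<^sup>+v. \<integral>\<^sup>+c. G' (v\<^sup>2 + c, 1 * v) \<partial>riesz a \<partial>lborel) = ennreal (4 powr a * Gamma a) * (\<integral>\<^sup>+P. \<integral>\<^sup>+Q. G (P + Q, P - Q) \<partial>riesz a \<partial>riesz a)"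
    using nn_integral_light_cone[OF a, of G] by (simp add: G'_def)
  also have "ennreal ((\<Prod>i\<in>UNIV. Gamma (\<kappa> $ i + 1/2)) / sqrt pi) * (ennreal (4 powr a * Gamma a) * X) = ennreal (cone_const \<kappa>) * X" for X
    unfolding cone_const_def a_def[symmetric] mult.assoc[symmetric]
    using Gp Gamma_real_pos[OF a] by (subst ennreal_mult[symmetric]) (simp_all add: prod_nonneg less_imp_le mult.assoc)
  finally show ?thesis by (simp add: f_def a_def)
qed

lemma cone_const_pos:
  fixes \<kappa> :: "real ^ 'n"
  assumes "CARD('n) \<ge> 2" "\<And>i. 0 \<le> \<kappa> $ i"
  shows "0 < cone_const \<kappa>"
proof -
  have "0 < Gamma (\<kappa> $ i + 1/2)" for i using assms(2)[of i] by (intro Gamma_real_pos) simp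
  then show ?thesis
    unfolding cone_const_def using alpha_half_pos[OF assms]
    by (intro mult_pos_pos divide_pos_pos prod_pos) auto
qed

lemma sets_conic_measure [measurable_cong]:
  "sets (conic_measure :: ((real ^ 'n) \<times> real) measure) = sets (restrict_space borel conic_surface)"
  by (simp add: conic_measure_def)

lemma borel_measurable_conic_measureI:
  fixes f :: "(real ^ 'n) \<times> real \<Rightarrow> 'b::topological_space"
  shows "f \<in> borel_measurable borel \<Longrightarrow> f \<in> borel_measurable conic_measure"
  by (simp add: measurable_restrict_space1 cong: measurable_cong_sets[OF sets_conic_measure])

lemma space_conic_measure: "space (conic_measure :: ((real ^ 'n) \<times> real) measure) = conic_surface"
  by (simp add: conic_measure_def space_restrict_space)

text \<open>\<open>cone_formula\<close> for exp (- t): the integrand ignores V, so any unit vector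
  serves, and P + Q follows \<open>riesz (2 * a)\<close>, which gives exp (- y) the integral
  1.\<close>

lemma b_const_eq:
  fixes \<kappa> :: "real ^ 'n"
  assumes d: "CARD('n) \<ge> 2" and \<kappa>: "\<And>i. 0 \<le> \<kappa> $ i"
  shows "b_const \<kappa> = 1 / cone_const \<kappa>"
proof -
  interpret Phi: prob_space "Phi_measure \<kappa>" by (rule prob_space_Phi_measure[OF \<kappa>])
  define a where "a = alpha \<kappa> + 1/2"
  have a: "0 < a" using alpha_half_pos[OF d \<kappa>] by (simp add: a_def)
  have w: "w_weight \<kappa> p = u_weight \<kappa> p * exp (- snd p)" for p
    by (simp add: w_weight_def u_weight_def split: prod.split)
  have "(\<lambda>p. u_weight \<kappa> p * exp (- snd p)) \<in> borel_measurable borel" by measurable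
  then have m: "w_weight \<kappa> \<in> borel_measurable conic_measure"
    unfolding w[abs_def] by (rule borel_measurable_conic_measureI)
  have nn: "0 \<le> u_weight \<kappa> p" if "p \<in> conic_surface" for p
    using that by (auto simp: conic_surface_def u_weight_def)
  have "(\<integral>\<^sup>+p. ennreal (w_weight \<kappa> p) \<partial>conic_measure)
     = (\<integral>\<^sup>+p. ennreal (u_weight \<kappa> p) * (\<integral>\<^sup>+u. ennreal (exp (- snd p)) \<partial>Phi_measure \<kappa>) \<partial>conic_measure)"
    by (intro nn_integral_cong) (simp add: w ennreal_mult space_conic_measure nn Phi.emeasure_space_1)
  also have "\<dots> = ennreal (cone_const \<kappa>) * (\<integral>\<^sup>+P. \<integral>\<^sup>+Q. ennreal (exp (- (P + Q))) \<partial>riesz a \<partial>riesz a)"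
    using cone_formula[OF d \<kappa>, of "axis undefined 1" "\<lambda>(t, v). ennreal (exp (- t))"] by (simp add: a_def)
  also have "(\<integral>\<^sup>+P. \<integral>\<^sup>+Q. ennreal (exp (- (P + Q))) \<partial>riesz a \<partial>riesz a) = 1"
    using riesz_convolution[of a a "\<lambda>y. ennreal (exp (- y))"] a by (simp add: nn_integral_riesz_exp)
  finally have "(LINT p|conic_measure. w_weight \<kappa> p) = cone_const \<kappa>"
    using cone_const_pos[OF d \<kappa>]
    by (subst integral_eq_nn_integral[OF m]) (auto intro!: AE_I2 simp: w space_conic_measure nn)
  then show ?thesis by (simp add: b_const_def)
qed

section \<open>The angular integral\<close>

lemma nn_integral_theta_cos:
  fixes f :: "real \<Rightarrow> ennreal"
  assumes [measurable]: "f \<in> borel_measurable borel"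
  shows "(\<integral>\<^sup>+\<theta>. f (cos \<theta>) * ennreal (sin \<theta>) \<partial>theta_measure) = (\<integral>\<^sup>+w\<in>{-1..1}. f w \<partial>lborel)"
proof -
  \<comment> \<open>The cosine decreases on [0, pi]; reflecting w makes the substitution an
    increasing one.\<close>
  have "(\<integral>\<^sup>+w\<in>{-1..1}. f w \<partial>lborel) = (\<integral>\<^sup>+w\<in>{-1..1}. f (- w) \<partial>lborel)"
    by (subst nn_integral_real_affine[where t = 0 and c = "-1"]) (auto intro!: nn_integral_cong simp: indicator_def)
  also have "\<dots> = (\<integral>\<^sup>+w\<in>{- cos 0..- cos pi}. f (- w) \<partial>lborel)" by simp
  also have "\<dots> = (\<integral>\<^sup>+\<theta>\<in>{0..pi}. f (- (- cos \<theta>)) * ennreal (sin \<theta>) \<partial>lborel)"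
    by (rule nn_integral_substitution_aux)
      (auto intro!: derivative_eq_intros continuous_intros sin_ge_zero)
  also have "\<dots> = (\<integral>\<^sup>+\<theta>. f (cos \<theta>) * ennreal (sin \<theta>) \<partial>theta_measure)"
    unfolding theta_measure_def by (simp add: nn_integral_restrict_space)
  finally show ?thesis by simp
qed

text \<open>For fixed P put X = sqrt P cos \<theta>: the weights in P and sin \<theta> combine to (P
  - X^2)^(b - 1) dX. For fixed X the shift y = P - X^2 = P sin^2 \<theta> then separates the
  variables. It serves with b = alpha, and with b = 1 in the exceptional case alpha = 0.\<close>

lemma theta_formula:
  fixes F :: "real \<times> real \<Rightarrow> ennreal"
  assumes b: "0 < b" and [measurable]: "F \<in> borel_measurable (borel \<Otimes>\<^sub>M borel)"
  shows "(\<integral>\<^sup>+P. ennreal (if 0 < P then P powr (b - 1/2) else 0) *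
      (\<integral>\<^sup>+\<theta>. ennreal (sin \<theta> powr (2 * b - 1)) * F (sqrt P * cos \<theta>, P * (sin \<theta>)\<^sup>2) \<partial>theta_measure) \<partial>lborel)
    = ennreal (Gamma b) * (\<integral>\<^sup>+X. \<integral>\<^sup>+y. F (X, y) \<partial>riesz b \<partial>lborel)"
proof -
  have G: "0 < Gamma b" using b by (rule Gamma_real_pos)
  interpret g: sigma_finite_measure "riesz b" by (rule sigma_finite_riesz)
  have AEt: "AE \<theta> in theta_measure. 0 < sin \<theta>"
  proof -
    have "AE \<theta> in lborel. \<theta> \<in> {0..pi} \<longrightarrow> 0 < sin \<theta>"
      by (rule eventually_mono[OF AE_conjI[OF AE_lborel_singleton[of 0] AE_lborel_singleton[of pi]]])
        (auto intro: sin_gt_zero)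
    then show ?thesis unfolding theta_measure_def by (subst AE_restrict_space_iff) auto
  qed
  define D where "D X P = ennreal (if X\<^sup>2 < P then (P - X\<^sup>2) powr (b - 1) else 0) * F (X, P - X\<^sup>2)" for X P
  have [measurable]: "(\<lambda>(X, P). D X P) \<in> borel_measurable (borel \<Otimes>\<^sub>M borel)" unfolding D_def by measurable
  have "(\<integral>\<^sup>+P. ennreal (if 0 < P then P powr (b - 1/2) else 0) *
      (\<integral>\<^sup>+\<theta>. ennreal (sin \<theta> powr (2 * b - 1)) * F (sqrt P * cos \<theta>, P * (sin \<theta>)\<^sup>2) \<partial>theta_measure) \<partial>lborel)
    = (\<integral>\<^sup>+P. \<integral>\<^sup>+X. D X P \<partial>lborel \<partial>lborel)"
  proof (rule nn_integral_cong)
    fix P :: real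
    show "ennreal (if 0 < P then P powr (b - 1/2) else 0) *
      (\<integral>\<^sup>+\<theta>. ennreal (sin \<theta> powr (2 * b - 1)) * F (sqrt P * cos \<theta>, P * (sin \<theta>)\<^sup>2) \<partial>theta_measure) = (\<integral>\<^sup>+X. D X P \<partial>lborel)"
    proof (cases "0 < P")
      case True
      define f where "f w = ennreal ((1 - w\<^sup>2) powr (b - 1)) * F (sqrt P * w, P * (1 - w\<^sup>2))" for w
      have [measurable]: "f \<in> borel_measurable borel" unfolding f_def by measurable
      have "(\<integral>\<^sup>+\<theta>. ennreal (sin \<theta> powr (2 * b - 1)) * F (sqrt P * cos \<theta>, P * (sin \<theta>)\<^sup>2) \<partial>theta_measure)
        = (\<integral>\<^sup>+\<theta>. f (cos \<theta>) * ennreal (sin \<theta>) \<partial>theta_measure)"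
      proof (rule nn_integral_cong_AE, rule eventually_mono[OF AEt])
        fix \<theta> :: real assume s: "0 < sin \<theta>"
        have c: "1 - (cos \<theta>)\<^sup>2 = (sin \<theta>)\<^sup>2" by (simp add: cos_squared_eq)
        have "((sin \<theta>)\<^sup>2) powr (b - 1) = sin \<theta> powr (2 * (b - 1))"
          using s powr_powr[of "sin \<theta>" 2 "b - 1"] by simp
        moreover have "sin \<theta> powr (2 * b - 1) = sin \<theta> powr (2 * (b - 1)) * sin \<theta>"
          using s powr_add[of "sin \<theta>" "2 * (b - 1)" 1] by (simp add: algebra_simps)
        ultimately have "ennreal (sin \<theta> powr (2 * b - 1)) = ennreal (((sin \<theta>)\<^sup>2) powr (b - 1)) * ennreal (sin \<theta>)"
          using s by (simp add: ennreal_mult)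
        then show "ennreal (sin \<theta> powr (2 * b - 1)) * F (sqrt P * cos \<theta>, P * (sin \<theta>)\<^sup>2) = f (cos \<theta>) * ennreal (sin \<theta>)"
          unfolding f_def c by (simp only: mult_ac)
      qed
      also have "\<dots> = (\<integral>\<^sup>+w. f w * indicator {-1..1} w \<partial>lborel)"
        by (rule nn_integral_theta_cos) measurable
      also have "\<dots> = ennreal (1 / sqrt P) * (\<integral>\<^sup>+X. f (X / sqrt P) * indicator {-1..1} (X / sqrt P) \<partial>lborel)"
        using True by (subst nn_integral_real_affine[where t = 0 and c = "1 / sqrt P"]) simp_all
      finally have "ennreal (P powr (b - 1/2)) * (\<integral>\<^sup>+\<theta>. ennreal (sin \<theta> powr (2 * b - 1)) * F (sqrt P * cos \<theta>, P * (sin \<theta>)\<^sup>2) \<partial>theta_measure)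
        = ennreal (P powr (b - 1/2)) * (ennreal (1 / sqrt P) * (\<integral>\<^sup>+X. f (X / sqrt P) * indicator {-1..1} (X / sqrt P) \<partial>lborel))"
        by simp
      also have "\<dots> = ennreal (P powr (b - 1)) * (\<integral>\<^sup>+X. f (X / sqrt P) * indicator {-1..1} (X / sqrt P) \<partial>lborel)"
      proof -
        have "P powr (b - 1/2) * (1 / sqrt P) = P powr (b - 1)"
          using True powr_add[of P "b - 1" "1/2"] by (simp add: powr_half_sqrt)
        then have "ennreal (P powr (b - 1/2)) * ennreal (1 / sqrt P) = ennreal (P powr (b - 1))"
          using True by (subst ennreal_mult[symmetric]) simp_all
        then show ?thesis by (simp only: mult.assoc[symmetric])
      qed
      also have "\<dots> = (\<integral>\<^sup>+X. ennreal (P powr (b - 1)) * (f (X / sqrt P) * indicator {-1..1} (X / sqrt P)) \<partial>lborel)"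
        by (rule nn_integral_cmult[symmetric]) measurable
      also have "\<dots> = (\<integral>\<^sup>+X. D X P \<partial>lborel)"
      proof (rule nn_integral_cong_AE,
          rule eventually_mono[OF AE_conjI[OF AE_lborel_singleton[of "sqrt P"] AE_lborel_singleton[of "- sqrt P"]]], elim conjE)
        fix X :: real assume X: "X \<noteq> sqrt P" "X \<noteq> - sqrt P"
        have iff: "X / sqrt P \<in> {-1..1} \<longleftrightarrow> X\<^sup>2 < P"
        proof -
          have "X / sqrt P \<in> {-1..1} \<longleftrightarrow> \<bar>X\<bar> \<le> sqrt P" using True by (auto simp: field_simps abs_le_iff)
          also have "\<dots> \<longleftrightarrow> \<bar>X\<bar> < sqrt P" using X by (auto simp: abs_if)
          also have "\<dots> \<longleftrightarrow> X\<^sup>2 < P" using True real_sqrt_less_iff[of "X\<^sup>2" P] by simp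
          finally show ?thesis .
        qed
        show "ennreal (P powr (b - 1)) * (f (X / sqrt P) * indicator {-1..1} (X / sqrt P)) = D X P"
        proof (cases "X\<^sup>2 < P")
          case lt: True
          have e: "P * (1 - (X / sqrt P)\<^sup>2) = P - X\<^sup>2" using True by (simp add: power_divide right_diff_distrib)
          have "(P - X\<^sup>2) powr (b - 1) = P powr (b - 1) * (1 - (X / sqrt P)\<^sup>2) powr (b - 1)"
            unfolding e[symmetric] using True lt by (intro powr_mult)
          then have "ennreal ((P - X\<^sup>2) powr (b - 1)) = ennreal (P powr (b - 1)) * ennreal ((1 - (X / sqrt P)\<^sup>2) powr (b - 1))"
            by (simp add: ennreal_mult)
          then show ?thesis using iff lt True unfolding D_def f_def e by (simp add: mult.assoc)
        next
          case False
          then show ?thesis using iff by (simp add: D_def)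
        qed
      qed
      finally show ?thesis using True by simp
    next
      case False
      then have "\<not> X\<^sup>2 < P" for X by (smt (verit) zero_le_power2)
      then show ?thesis using False by (simp add: D_def)
    qed
  qed
  also have "\<dots> = (\<integral>\<^sup>+X. \<integral>\<^sup>+P. D X P \<partial>lborel \<partial>lborel)"
    by (intro nn_integral_swap sigma_finite_lborel) measurable
  also have "\<dots> = (\<integral>\<^sup>+X. ennreal (Gamma b) * (\<integral>\<^sup>+y. F (X, y) \<partial>riesz b) \<partial>lborel)"
  proof (rule nn_integral_cong)
    fix X :: real
    have "(\<integral>\<^sup>+P. D X P \<partial>lborel) = (\<integral>\<^sup>+y. D X (X\<^sup>2 + y) \<partial>lborel)"
      by (subst nn_integral_real_affine[where t = "X\<^sup>2" and c = 1]) simp_all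
    also have "\<dots> = (\<integral>\<^sup>+y. ennreal (Gamma b) * (ennreal (if 0 < y then y powr (b - 1) / Gamma b else 0) * F (X, y)) \<partial>lborel)"
      using G by (intro nn_integral_cong) (simp add: D_def mult.assoc[symmetric] ennreal_mult'[symmetric])
    also have "\<dots> = ennreal (Gamma b) * (\<integral>\<^sup>+y. F (X, y) \<partial>riesz b)"
      using b by (simp add: nn_integral_cmult nn_integral_riesz_pos)
    finally show "(\<integral>\<^sup>+P. D X P \<partial>lborel) = ennreal (Gamma b) * (\<integral>\<^sup>+y. F (X, y) \<partial>riesz b)" .
  qed
  also have "\<dots> = ennreal (Gamma b) * (\<integral>\<^sup>+X. \<integral>\<^sup>+y. F (X, y) \<partial>riesz b \<partial>lborel)"
    by (rule nn_integral_cmult) measurable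
  finally show ?thesis .
qed

section \<open>Bessel functions\<close>

text \<open>\<open>bseries a w\<close> is the hypergeometric series 0F1(; a; - w). In w = z^2 / 4
  the Bessel functions are power series for every real order, and their relations can be read off
  from the coefficients.\<close>

definition bcoeff :: "real \<Rightarrow> nat \<Rightarrow> real" where
  "bcoeff a k = (- 1) ^ k / (fact k * pochhammer a k)"

definition bseries :: "real \<Rightarrow> real \<Rightarrow> real" where
  "bseries a w = (\<Sum>k. bcoeff a k * w ^ k)"

lemma summable_bcoeff:
  assumes a: "0 < a"
  shows "summable (\<lambda>k. bcoeff a k * w ^ k)"
proof -
  obtain N :: nat where N: "2 * \<bar>w\<bar> \<le> real N" using real_arch_simple by blast
  show ?thesis
  proof (rule summable_ratio_test[of "1/2" "Suc N"])
    fix k assume k: "k \<ge> Suc N"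
    have e: "bcoeff a (Suc k) * w ^ Suc k = - (w / ((real k + 1) * (a + real k))) * (bcoeff a k * w ^ k)"
      by (simp add: bcoeff_def pochhammer_Suc add.commute mult_ac)
    have "\<bar>w\<bar> * 2 \<le> (real k + 1) * 1" using N k by simp
    also have "\<dots> \<le> (real k + 1) * (a + real k)" using k a by (intro mult_left_mono) auto
    finally have "\<bar>w\<bar> / ((real k + 1) * (a + real k)) \<le> 1/2"
      using a by (simp add: divide_simps mult_ac add_pos_nonneg)
    moreover have "0 < (real k + 1) * (a + real k)" using a by (intro mult_pos_pos) auto
    ultimately have "\<bar>w / ((real k + 1) * (a + real k))\<bar> \<le> 1/2" by (simp only: abs_divide abs_of_pos)
    then show "norm (bcoeff a (Suc k) * w ^ Suc k) \<le> 1/2 * norm (bcoeff a k * w ^ k)"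
      unfolding e real_norm_def abs_mult abs_minus_cancel by (intro mult_right_mono) auto
  qed simp
qed

lemma bseries_0 [simp]: "bseries a 0 = 1"
  unfolding bseries_def by (subst powser_zero) (simp add: bcoeff_def)

lemma bseries_deriv:
  assumes a: "0 < a"
  shows "(bseries a has_field_derivative - bseries (a + 1) w / a) (at w)"
proof -
  have "((\<lambda>w. \<Sum>k. bcoeff a k * w ^ k) has_field_derivative (\<Sum>k. diffs (bcoeff a) k * w ^ k)) (at w)"
    by (rule termdiffs_strong[OF summable_bcoeff[OF a], where K = "\<bar>w\<bar> + 1"]) simp
  also have "diffs (bcoeff a) = (\<lambda>k. - (1 / a) * bcoeff (a + 1) k)"
    by (auto simp: diffs_def bcoeff_def pochhammer_rec fun_eq_iff simp del: of_nat_Suc)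
  also have "(\<Sum>k. - (1 / a) * bcoeff (a + 1) k * w ^ k) = - bseries (a + 1) w / a"
    unfolding bseries_def using suminf_mult[OF summable_bcoeff[of "a + 1" w], of "- (1/a)"] a
    by (simp add: mult.assoc)
  finally show ?thesis unfolding bseries_def[abs_def] .
qed

text \<open>The three-term recurrence of Bessel functions, compared coefficient by coefficient.
  Together with \<open>bseries_deriv\<close> it replaces Bessel's differential equation in
  \<open>benergy_deriv\<close>.\<close>

lemma bseries_contiguous:
  assumes a: "0 < a"
  shows "bseries a w = bseries (a + 1) w - w / (a * (a + 1)) * bseries (a + 2) w"
proof -
  have "(\<lambda>k. bcoeff (a + 2) k * w ^ k) sums bseries (a + 2) w"
    unfolding bseries_def using a by (intro summable_sums summable_bcoeff) simp
  from sums_mult[OF this, of "- w / (a * (a + 1))"]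
  have "(\<lambda>k. - w / (a * (a + 1)) * (bcoeff (a + 2) k * w ^ k)) sums (- w / (a * (a + 1)) * bseries (a + 2) w)" .
  moreover have "- w / (a * (a + 1)) * (bcoeff (a + 2) k * w ^ k) = (bcoeff a (Suc k) - bcoeff (a + 1) (Suc k)) * w ^ Suc k" for k
  proof -
    have p: "0 < pochhammer (a + 2) k" using a by (intro pochhammer_pos) simp
    have 1: "pochhammer a (Suc k) = a * ((a + 1) * pochhammer (a + 2) k) / (a + 1 + real k)"
    proof -
      have "pochhammer a (Suc (Suc k)) = a * ((a + 1) * pochhammer (a + 2) k)"
        by (simp add: pochhammer_rec add.assoc)
      moreover have "pochhammer a (Suc (Suc k)) = pochhammer a (Suc k) * (a + 1 + real k)"
        by (subst pochhammer_Suc) simp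
      ultimately show ?thesis using a by (simp add: field_simps)
    qed
    have 2: "pochhammer (a + 1) (Suc k) = (a + 1) * pochhammer (a + 2) k"
      by (simp add: pochhammer_rec add.assoc)
    have "bcoeff a (Suc k) - bcoeff (a + 1) (Suc k)
       = - ((- 1) ^ k / fact k) * ((a + 1 + real k) / (a * ((a + 1) * pochhammer (a + 2) k)) - 1 / ((a + 1) * pochhammer (a + 2) k)) / (real k + 1)"
      unfolding bcoeff_def 1 2 by (simp add: divide_simps) (simp add: algebra_simps)
    also have "(a + 1 + real k) / (a * ((a + 1) * pochhammer (a + 2) k)) - 1 / ((a + 1) * pochhammer (a + 2) k)
       = (real k + 1) / (a * ((a + 1) * pochhammer (a + 2) k))"
      using a p by (simp add: divide_simps)
    also have "- ((- 1) ^ k / fact k) * ((real k + 1) / (a * ((a + 1) * pochhammer (a + 2) k))) / (real k + 1) = - (1 / (a * (a + 1))) * bcoeff (a + 2) k"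
      using a p by (simp add: bcoeff_def divide_simps)
    finally show ?thesis by simp
  qed
  ultimately have "(\<lambda>k. (bcoeff a (Suc k) - bcoeff (a + 1) (Suc k)) * w ^ Suc k) sums (- w / (a * (a + 1)) * bseries (a + 2) w)"
    by simp
  \<comment> \<open>The series may start at k = 0, where both coefficients are 1.\<close>
  then have "(\<lambda>k. (bcoeff a k - bcoeff (a + 1) k) * w ^ k) sums (- w / (a * (a + 1)) * bseries (a + 2) w)"
    by (subst (asm) sums_Suc_iff) (simp add: bcoeff_def)
  moreover have "(\<lambda>k. (bcoeff a k - bcoeff (a + 1) k) * w ^ k) sums (bseries a w - bseries (a + 1) w)"
    unfolding bseries_def left_diff_distrib using a
    by (intro sums_diff summable_sums summable_bcoeff) simp_all
  ultimately show ?thesis by (auto dest: sums_unique2)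
qed

text \<open>\<open>nbessel a\<close> is \<open>j\<^bsub>a - 1\<^esub>\<close> normalised to the value \<open>1\<close> at \<open>0\<close>.\<close>
definition nbessel :: "real \<Rightarrow> real \<Rightarrow> real" where
  "nbessel a z = bseries a (z\<^sup>2 / 4)"

lemma nbessel_0 [simp]: "nbessel a 0 = 1"
  by (simp add: nbessel_def)

lemma nbessel_deriv:
  assumes "0 < a"
  shows "(nbessel a has_field_derivative - z / (2 * a) * nbessel (a + 1) z) (at z)"
proof -
  have "((\<lambda>z. bseries a (z\<^sup>2 / 4)) has_field_derivative (- bseries (a + 1) (z\<^sup>2 / 4) / a) * (z / 2)) (at z)"
    by (rule DERIV_chain2[OF bseries_deriv[OF assms]]) (auto intro!: derivative_eq_intros)
  then show ?thesis unfolding nbessel_def[abs_def] by (simp add: mult.commute)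
qed

lemma nbessel_contiguous:
  assumes "0 < a"
  shows "nbessel a z = nbessel (a + 1) z - z\<^sup>2 / (4 * a * (a + 1)) * nbessel (a + 2) z"
  unfolding nbessel_def using bseries_contiguous[OF assms, of "z\<^sup>2 / 4"] by simp

lemma nbessel_measurable [measurable]:
  assumes "0 < a"
  shows "nbessel a \<in> borel_measurable borel"
  using nbessel_deriv[OF assms]
  by (intro borel_measurable_continuous_onI continuous_at_imp_continuous_on ballI DERIV_isCont)

section \<open>Energy estimates and the growth of the Bessel function\<close>

text \<open>
  The sum of the squares of \<open>nbessel a\<close> and its derivative. By Bessel's equation it decreases for \<open>a \<ge> 1/2\<close>, while for
  \<open>a \<le> 1/2\<close> its quotient by \<open>(2 a + (1 - 2 a) z)\<^sup>2\<close> decreases on \<open>z \<ge> 1\<close>.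
\<close>
definition benergy :: "real \<Rightarrow> real \<Rightarrow> real" where
  "benergy a z = (nbessel a z)\<^sup>2 + (z / (2 * a) * nbessel (a + 1) z)\<^sup>2"

lemma benergy_0 [simp]: "benergy a 0 = 1"
  by (simp add: benergy_def)

text \<open>The terms with \<open>nbessel (a + 2)\<close> cancel by the contiguous relation. What
  remains is a square times z and a constant with the sign of 1 - 2a.\<close>

lemma benergy_deriv:
  assumes a: "0 < a"
  shows "(benergy a has_field_derivative (1 - 2 * a) * z * (nbessel (a + 1) z)\<^sup>2 / (2 * a\<^sup>2)) (at z)"
proof -
  let ?f = "nbessel a z" and ?g = "nbessel (a + 1) z" and ?h = "nbessel (a + 2) z"
  have g: "(nbessel (a + 1) has_field_derivative - z / (2 * (a + 1)) * ?h) (at z)"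
    using nbessel_deriv[of "a + 1" z] a by (simp add: add.assoc)
  \<comment> \<open>With the reciprocals as letters the cancellation is an identity of
    polynomials.\<close>
  define p q where "p = 1 / a" and "q = 1 / (a + 1)"
  have ap: "a * p = 1" using a by (simp add: p_def)
  have c: "?f = ?g - z\<^sup>2 * p * q / 4 * ?h"
    using nbessel_contiguous[OF a, of z] by (simp add: p_def q_def)
  have lin: "((\<lambda>z. z / (2 * a)) has_field_derivative 1 / (2 * a)) (at z)"
    by (rule DERIV_cdivide[OF DERIV_ident])
  note d = DERIV_add[OF DERIV_power[OF nbessel_deriv[OF a], of 2] DERIV_power[OF DERIV_mult[OF lin g], of 2]]
  have "(benergy a has_field_derivative
      2 * ?f * (- z * p / 2 * ?g) + 2 * (z * p / 2 * ?g) * (p / 2 * ?g + z * p / 2 * (- z * q / 2 * ?h))) (at z)"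
    unfolding benergy_def[abs_def] by (rule DERIV_cong[OF d]) (simp add: p_def q_def mult_ac)
  also have "2 * ?f * (- z * p / 2 * ?g) + 2 * (z * p / 2 * ?g) * (p / 2 * ?g + z * p / 2 * (- z * q / 2 * ?h))
      = z * ?g\<^sup>2 * (p\<^sup>2 / 2 - p)"
    unfolding c by (simp add: algebra_simps power2_eq_square)
  also have "p\<^sup>2 / 2 - p = (1 - 2 * a) / (2 * a\<^sup>2)"
    using a by (simp add: p_def divide_simps power2_eq_square)
  finally show ?thesis by (simp add: mult_ac)
qed

lemma benergy_le_1:
  assumes a: "1/2 \<le> a" and z: "0 \<le> z"
  shows "benergy a z \<le> 1"
proof -
  have "benergy a z \<le> benergy a 0"
  proof (rule DERIV_nonpos_imp_nonincreasing[OF z])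
    fix x :: real assume "0 \<le> x"
    then have "(1 - 2 * a) * x * (nbessel (a + 1) x)\<^sup>2 / (2 * a\<^sup>2) \<le> 0"
      using a by (intro divide_nonpos_nonneg mult_nonpos_nonneg) auto
    then show "\<exists>y. (benergy a has_field_derivative y) (at x) \<and> y \<le> 0"
      using benergy_deriv[of a x] a by auto
  qed
  then show ?thesis by simp
qed

lemma abs_nbessel_le_1: "1/2 \<le> a \<Longrightarrow> 0 \<le> z \<Longrightarrow> \<bar>nbessel a z\<bar> \<le> 1"
proof -
  assume "1/2 \<le> a" "0 \<le> z"
  then have "benergy a z \<le> 1" by (rule benergy_le_1)
  moreover have "(nbessel a z)\<^sup>2 \<le> benergy a z" by (simp add: benergy_def)
  ultimately have "(nbessel a z)\<^sup>2 \<le> 1" by linarith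
  then show ?thesis by (simp add: abs_square_le_1)
qed

text \<open>The derivative is - x / (2a) times \<open>nbessel (a + 1) x\<close>, and the latter is
  at most 1 because a + 1 \<ge> 1/2; integration gives the first two terms of the series as a lower
  bound.\<close>

lemma nbessel_lower:
  assumes a: "0 < a" "1/2 \<le> a + 1" and z: "0 \<le> z"
  shows "1 - z\<^sup>2 / (4 * a) \<le> nbessel a z"
proof -
  define h where "h z = nbessel a z + z\<^sup>2 / (4 * a)" for z
  have "h 0 \<le> h z"
  proof (rule DERIV_nonneg_imp_nondecreasing[OF z])
    fix x :: real assume x: "0 \<le> x"
    have "nbessel (a + 1) x \<le> 1" using abs_nbessel_le_1[OF a(2) x] by simp
    then have "0 \<le> x / (2 * a) * (1 - nbessel (a + 1) x)" using x a by (intro mult_nonneg_nonneg) auto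
    also have "\<dots> = - x / (2 * a) * nbessel (a + 1) x + x / (2 * a)" by (simp add: right_diff_distrib)
    finally have "0 \<le> - x / (2 * a) * nbessel (a + 1) x + x / (2 * a)" .
    moreover have "(h has_field_derivative - x / (2 * a) * nbessel (a + 1) x + x / (2 * a)) (at x)"
    proof -
      have "((\<lambda>z. z\<^sup>2 / (4 * a)) has_field_derivative x / (2 * a)) (at x)"
        by (rule DERIV_cong[OF DERIV_cdivide[OF DERIV_power[OF DERIV_ident, where n = 2]]]) simp
      from DERIV_add[OF nbessel_deriv[OF a(1)] this] show ?thesis unfolding h_def[abs_def] .
    qed
    ultimately show "\<exists>y. (h has_field_derivative y) (at x) \<and> 0 \<le> y" by blast
  qed
  then show ?thesis by (simp add: h_def)
qed

text \<open>For a < 1/2 the energy increases and gives no bound by 1. On [0, 1], however,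
  \<open>nbessel (a + 1)\<close> is nonnegative by \<open>nbessel_lower\<close>, so
  \<open>nbessel a\<close> decreases.\<close>

lemma nbessel_le_1:
  assumes a: "0 < a" and z: "0 \<le> z" "z \<le> 1"
  shows "nbessel a z \<le> 1"
proof -
  have "nbessel a z \<le> nbessel a 0"
  proof (rule DERIV_nonpos_imp_nonincreasing[OF z(1)])
    fix x :: real assume x: "0 \<le> x" "x \<le> z"
    have "x\<^sup>2 \<le> 1" using x z by (simp add: power_le_one)
    then have "x\<^sup>2 / (4 * (a + 1)) \<le> 1" using a by (simp add: divide_simps)
    moreover have "1 - x\<^sup>2 / (4 * (a + 1)) \<le> nbessel (a + 1) x" by (rule nbessel_lower) (use a x in auto)
    ultimately have "0 \<le> nbessel (a + 1) x" by linarith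
    then have "- x / (2 * a) * nbessel (a + 1) x \<le> 0"
      using a x by (intro mult_nonpos_nonneg) (auto simp: divide_simps)
    then show "\<exists>y. (nbessel a has_field_derivative y) (at x) \<and> y \<le> 0"
      using nbessel_deriv[OF a, of x] by blast
  qed
  then show ?thesis by simp
qed

text \<open>Log-convexity of Gamma: a + 1/2 and 1 lie between 1/2 and a + 1 and have the same sum,
  so the inner product Gamma (a + 1/2) Gamma 1 is at most the outer one.\<close>

lemma Gamma_half_ratio:
  assumes "0 < a"
  shows "Gamma (a + 1/2) \<le> sqrt pi * Gamma (a + 1)"
proof -
  \<comment> \<open>The weight that places a + 1/2 between the end points; 1 - t then places
    1.\<close>
  define t where "t = a / (a + 1/2)"
  have t: "0 \<le> t" "t \<le> 1" using assms by (auto simp: t_def divide_simps)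
  have G: "0 < Gamma (1/2::real)" "0 < Gamma (a + 1)" "0 < Gamma (a + 1/2)" using assms by (auto intro!: Gamma_real_pos)
  have cv: "convex_on {0<..} (ln \<circ> (Gamma :: real \<Rightarrow> real))" by (rule log_convex_Gamma_real)
  have e1: "(1 - t) * (1/2) + t * (a + 1) = a + 1/2" and e2: "t * (1/2) + (1 - t) * (a + 1) = 1"
  proof -
    have b: "a + 1/2 \<noteq> 0" using assms by simp
    have t': "t * (a + 1/2) = a" using b by (simp add: t_def)
    have t2: "t * a = a - t / 2" using t' by (simp add: algebra_simps)
    have "(1 - t) * (1/2) + t * (a + 1) = 1/2 + t/2 + t * a" "t * (1/2) + (1 - t) * (a + 1) = 1 + a - t/2 - t * a"
      by (simp_all add: field_simps)
    then show "(1 - t) * (1/2) + t * (a + 1) = a + 1/2" "t * (1/2) + (1 - t) * (a + 1) = 1"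
      unfolding t2 by simp_all
  qed
  have "ln (Gamma (a + 1/2)) \<le> (1 - t) * ln (Gamma (1/2)) + t * ln (Gamma (a + 1))"
    using convex_onD[OF cv, of t "1/2" "a + 1"] t assms e1 by simp
  moreover have "ln (Gamma (1::real)) \<le> t * ln (Gamma (1/2)) + (1 - t) * ln (Gamma (a + 1))"
    using convex_onD[OF cv, of "1 - t" "1/2" "a + 1"] t assms e2 by simp
  ultimately have "ln (Gamma (a + 1/2)) \<le> ln (Gamma (1/2)) + ln (Gamma (a + 1))" by (simp add: algebra_simps)
  then have "ln (Gamma (a + 1/2)) \<le> ln (Gamma (1/2) * Gamma (a + 1))" using G by (simp add: ln_mult_pos)
  then have "Gamma (a + 1/2) \<le> Gamma (1/2) * Gamma (a + 1)" using G by simp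
  then show ?thesis by (simp add: Gamma_one_half_real)
qed

text \<open>L is affine with slope 1 - 2a and L 1 = 1, so L x \<le> x for x \<ge> 1. With E the
  energy, L E' \<le> x E' \<le> 2 L' E, which is the monotonicity of E / L^2.\<close>

lemma nbessel_growth:
  assumes a: "0 < a" "a \<le> 1/2" and z: "1 \<le> z"
  shows "\<bar>nbessel a z\<bar> \<le> sqrt (benergy a 1) * (2 * a + (1 - 2 * a) * z)"
proof -
  define L where "L z = 2 * a + (1 - 2 * a) * z" for z
  have Lp: "0 < L x" "L x \<le> x" if "1 \<le> x" for x
  proof -
    show "0 < L x" unfolding L_def using a that by (intro add_pos_nonneg mult_nonneg_nonneg) auto
    have "0 \<le> 2 * a * (x - 1)" using a that by simp
    then show "L x \<le> x" unfolding L_def by (simp add: algebra_simps)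
  qed
  define q where "q z = benergy a z / (L z)\<^sup>2" for z
  have "q z \<le> q 1"
  proof (rule DERIV_nonpos_imp_nonincreasing[OF z])
    fix x :: real assume x: "1 \<le> x"
    let ?E' = "(1 - 2 * a) * x * (nbessel (a + 1) x)\<^sup>2 / (2 * a\<^sup>2)"
    have d: "(q has_field_derivative (?E' * (L x)\<^sup>2 - benergy a x * (2 * L x * (1 - 2 * a))) / ((L x)\<^sup>2 * (L x)\<^sup>2)) (at x)"
    proof -
      have "(L has_field_derivative 1 - 2 * a) (at x)"
        unfolding L_def[abs_def] by (auto intro!: derivative_eq_intros)
      from DERIV_divide[OF benergy_deriv[OF a(1)] DERIV_power[OF this, of 2]] Lp[OF x]
      show ?thesis unfolding q_def[abs_def] by (simp add: mult_ac)
    qed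
    \<comment> \<open>x E' is 2 (1 - 2a) times the second of the two squares that make up the
      energy.\<close>
    have "x * ?E' \<le> 2 * (1 - 2 * a) * benergy a x"
    proof -
      have "x * ?E' = 2 * (1 - 2 * a) * (x / (2 * a) * nbessel (a + 1) x)\<^sup>2"
        using a by (simp add: field_simps power2_eq_square)
      also have "\<dots> \<le> 2 * (1 - 2 * a) * benergy a x"
        unfolding benergy_def using a by (intro mult_left_mono) auto
      finally show ?thesis .
    qed
    moreover have "0 \<le> ?E'" using a x by (intro divide_nonneg_nonneg mult_nonneg_nonneg) auto
    ultimately have "L x * ?E' \<le> 2 * (1 - 2 * a) * benergy a x"
      using mult_right_mono[OF Lp(2)[OF x], of ?E'] by linarith
    then have "L x * (L x * ?E') \<le> L x * (2 * (1 - 2 * a) * benergy a x)"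
      using Lp[OF x] by (intro mult_left_mono) auto
    then have "?E' * (L x)\<^sup>2 - benergy a x * (2 * L x * (1 - 2 * a)) \<le> 0"
      by (simp add: power2_eq_square mult_ac)
    then show "\<exists>y. (q has_field_derivative y) (at x) \<and> y \<le> 0"
    proof (intro exI conjI)
      show "(?E' * (L x)\<^sup>2 - benergy a x * (2 * L x * (1 - 2 * a))) / ((L x)\<^sup>2 * (L x)\<^sup>2) \<le> 0"
        by (rule divide_nonpos_nonneg) (fact, simp)
    qed (rule d)
  qed
  then have "benergy a z \<le> benergy a 1 * (L z)\<^sup>2"
    using Lp[OF z] by (simp add: q_def L_def[of 1] divide_simps)
  moreover have "(nbessel a z)\<^sup>2 \<le> benergy a z" by (simp add: benergy_def)
  ultimately have "(nbessel a z)\<^sup>2 \<le> benergy a 1 * (L z)\<^sup>2" by linarith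
  then have "sqrt ((nbessel a z)\<^sup>2) \<le> sqrt (benergy a 1 * (L z)\<^sup>2)" by (rule real_sqrt_le_mono)
  then show ?thesis using Lp(1)[OF z] by (simp add: real_sqrt_mult L_def)
qed

text \<open>The slope is the reciprocal of the factor in \<open>riesz_sqrt_shift\<close>. Up to z =
  1 the quadratic lower bound suffices. Beyond it \<open>nbessel_growth\<close> is affine in z - 1,
  and it remains to compare value and slope at z = 1, with S the square root of the energy
  there.\<close>

lemma nbessel_bound:
  assumes a: "0 < a" "a \<le> 1/2" and z: "0 \<le> z"
  shows "\<bar>nbessel a z\<bar> \<le> 1 + Gamma a / Gamma (a + 1/2) * z"
proof -
  define c where "c = Gamma a / Gamma (a + 1/2)"
  have G: "0 < Gamma (a + 1/2)" "0 < Gamma a" using a by (auto intro: Gamma_real_pos)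
  have c0: "0 < c" using G by (simp add: c_def)
  have cpi: "1 / (a * sqrt pi) \<le> c"
  proof -
    have "Gamma (a + 1/2) \<le> sqrt pi * (a * Gamma a)"
    proof -
      have "a \<notin> \<int>\<^sub>\<le>\<^sub>0" using a by (auto dest: nonpos_Ints_nonpos)
      then show ?thesis using Gamma_half_ratio[OF a(1)] Gamma_plus1[of a] by simp
    qed
    then show ?thesis using G a by (simp add: c_def divide_simps mult_ac)
  qed
  have pi1: "sqrt pi < 2" using pi_less_4 by (simp add: real_less_lsqrt)
  have c1: "1 / (2 * a) \<le> c"
  proof -
    have "1 / (2 * a) \<le> 1 / (a * sqrt pi)" using a pi1 by (simp add: divide_simps)
    then show ?thesis using cpi by simp
  qed
  show ?thesis
  proof (cases "z \<le> 1")
    case True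
    have lo: "1 - z\<^sup>2 / (4 * a) \<le> nbessel a z" by (rule nbessel_lower) (use a z in auto)
    have hi: "nbessel a z \<le> 1" by (rule nbessel_le_1) (use a z True in auto)
    have "z\<^sup>2 \<le> z" using True z by (simp add: power2_eq_square mult_left_le)
    then have "z\<^sup>2 / (4 * a) \<le> z / (2 * a)" using a z by (simp add: divide_simps)
    also have "\<dots> \<le> c * z" using mult_right_mono[OF c1 z] by simp
    finally show ?thesis using lo hi c0 z mult_nonneg_nonneg[of c z] unfolding c_def[symmetric] by linarith
  next
    case False
    then have z1: "1 \<le> z" by simp
    have f1: "nbessel a 1 \<le> 1" by (rule nbessel_le_1) (use a in auto)
    have f2: "1 - 1 / (4 * a) \<le> nbessel a 1"
      using nbessel_lower[of a 1] a by simp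
    have g1: "\<bar>nbessel (a + 1) 1\<bar> \<le> 1" by (rule abs_nbessel_le_1) (use a in auto)
    define S where "S = sqrt (benergy a 1)"
    define r where "r = 1 / (2 * a)"
    have r: "0 < r" "r \<le> c" using a c1 by (auto simp: r_def)
    have E: "benergy a 1 \<le> (nbessel a 1)\<^sup>2 + r\<^sup>2"
    proof -
      have "(nbessel (a + 1) 1)\<^sup>2 \<le> 1" using g1 by (simp add: abs_square_le_1)
      then have "r\<^sup>2 * (nbessel (a + 1) 1)\<^sup>2 \<le> r\<^sup>2 * 1" by (intro mult_left_mono) auto
      then show ?thesis by (simp add: benergy_def r_def power_divide)
    qed
    have "S \<le> 1 + c \<and> S * (1 - 2 * a) \<le> c"
    proof (cases "-1 \<le> nbessel a 1")
      case True
      then have "(nbessel a 1)\<^sup>2 \<le> 1" using f1 by (simp add: abs_square_le_1 abs_le_iff)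
      then have E1: "benergy a 1 \<le> 1 + r\<^sup>2" using E by linarith
      also have "\<dots> \<le> (1 + r)\<^sup>2" using r by (simp add: power2_eq_square algebra_simps)
      finally have "S \<le> 1 + r" unfolding S_def using r by (intro real_le_lsqrt) auto
      moreover have "S * (1 - 2 * a) \<le> r"
      proof -
        have "benergy a 1 * (1 - 2 * a)\<^sup>2 \<le> (1 + r\<^sup>2) * (1 - 2 * a)\<^sup>2"
          using E1 by (intro mult_right_mono) auto
        \<comment> \<open>As r = 1 / (2a), 1 + r^2 equals (4 a^2 + 1) r^2; a \<le> 1/2 gives 4 a^2
          \<le> 2a, and the product with (1 - 2a)^2 is at most 1.\<close>
        also have "\<dots> \<le> r\<^sup>2"
        proof -
          have "(4 * a\<^sup>2 + 1) * (1 - 2 * a)\<^sup>2 \<le> (2 * a + 1) * (1 - 2 * a)\<^sup>2"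
            using a by (intro mult_right_mono) (auto simp: power2_eq_square)
          also have "\<dots> = (1 - 4 * a\<^sup>2) * (1 - 2 * a)" by (simp add: power2_eq_square algebra_simps)
          also have "\<dots> \<le> 1 * 1" using a by (intro mult_mono) auto
          finally have "((4 * a\<^sup>2 + 1) * (1 - 2 * a)\<^sup>2) * r\<^sup>2 \<le> 1 * r\<^sup>2" by (intro mult_right_mono) auto
          moreover have "1 + r\<^sup>2 = (4 * a\<^sup>2 + 1) * r\<^sup>2"
            using a by (simp add: r_def power_divide divide_simps)
          ultimately show ?thesis by (simp add: mult_ac)
        qed
        finally have "sqrt (benergy a 1 * (1 - 2 * a)\<^sup>2) \<le> r" using r by (intro real_le_lsqrt) auto
        then show ?thesis using a by (simp add: S_def real_sqrt_mult)
      qed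
      ultimately show ?thesis using r by linarith
    next
      case False
      \<comment> \<open>Here r \<le> c is too weak, since S is only bounded by sqrt (5/4) r. The
        sharper lower bound 1 / (a sqrt pi) for c is used, and the comparison amounts to 5 pi \<le>
        16.\<close>
      have "\<bar>nbessel a 1\<bar> \<le> r / 2" using f2 False a by (simp add: r_def)
      then have "(nbessel a 1)\<^sup>2 \<le> (r / 2)\<^sup>2" using abs_le_square_iff[of "nbessel a 1" "r / 2"] r by simp
      then have "benergy a 1 \<le> 5 / 4 * r\<^sup>2" using E by (simp add: power_divide)
      also have "\<dots> \<le> (1 / (a * sqrt pi))\<^sup>2"
        using a pi_approx by (simp add: r_def power_divide power_mult_distrib divide_simps)
      also have "\<dots> \<le> c\<^sup>2" using cpi a by (intro power_mono) auto
      finally have "S \<le> c" unfolding S_def using c0 by (intro real_le_lsqrt) auto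
      moreover have "S * (1 - 2 * a) \<le> S * 1"
        using a by (intro mult_left_mono) (auto simp: S_def benergy_def)
      ultimately show ?thesis by linarith
    qed
    then have s1: "S \<le> 1 + c" and s2: "S * (1 - 2 * a) \<le> c" by auto
    have "\<bar>nbessel a z\<bar> \<le> S * (2 * a + (1 - 2 * a) * z)" unfolding S_def by (rule nbessel_growth[OF a z1])
    also have "\<dots> = S + S * (1 - 2 * a) * (z - 1)" by (simp add: algebra_simps)
    also have "\<dots> \<le> (1 + c) + c * (z - 1)" using s1 s2 z1 by (intro add_mono mult_right_mono) auto
    finally show ?thesis unfolding c_def[symmetric] by (simp add: algebra_simps)
  qed
qed

lemma bessel_j_nbessel:
  assumes a: "0 < a + 1" and z: "0 \<le> z"
  shows "bessel_j a z = nbessel (a + 1) z / (2 powr a * Gamma (a + 1))"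
proof (cases "z = 0")
  case True
  then show ?thesis by (simp add: bessel_j_def)
next
  case False
  with z have z: "0 < z" by simp
  have G: "0 < Gamma (a + 1)" using a by (rule Gamma_real_pos)
  have t: "(- 1) ^ k / (fact k * Gamma (real k + a + 1)) * (z / 2) powr (2 * real k + a)
      = (z / 2) powr a / Gamma (a + 1) * (bcoeff (a + 1) k * (z\<^sup>2 / 4) ^ k)" for k
  proof -
    have "a + 1 \<notin> \<int>\<^sub>\<le>\<^sub>0" using a by (auto dest: nonpos_Ints_nonpos)
    then have "Gamma (real k + a + 1) = pochhammer (a + 1) k * Gamma (a + 1)"
      using pochhammer_Gamma[of "a + 1" k] G by (simp add: add_ac)
    moreover have "(z / 2) powr (2 * real k + a) = (z\<^sup>2 / 4) ^ k * (z / 2) powr a"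
    proof -
      have "(z / 2) powr (2 * real k) = (z / 2) ^ (2 * k)"
        using z powr_realpow[of "z / 2" "2 * k"] by simp
      also have "\<dots> = (z\<^sup>2 / 4) ^ k" by (simp add: power_mult power_divide)
      finally show ?thesis by (simp add: powr_add)
    qed
    ultimately show ?thesis by (simp add: bcoeff_def mult_ac)
  qed
  have "Bessel_J a z = (z / 2) powr a / Gamma (a + 1) * nbessel (a + 1) z"
    unfolding Bessel_J_def t nbessel_def bseries_def
    by (rule suminf_mult[OF summable_bcoeff[OF a]])
  moreover have "z powr (- a) * (z / 2) powr a = 1 / 2 powr a"
    using z by (simp add: powr_divide powr_minus divide_simps)
  ultimately have e: "z powr (- a) * (z / 2) powr a = 1 / 2 powr a"
    and J: "Bessel_J a z = (z / 2) powr a / Gamma (a + 1) * nbessel (a + 1) z" by simp_all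
  have "bessel_j a z = (z powr (- a) * (z / 2) powr a) * (nbessel (a + 1) z / Gamma (a + 1))"
    using z by (simp add: bessel_j_def J)
  also have "\<dots> = nbessel (a + 1) z / (2 powr a * Gamma (a + 1))"
    unfolding e by simp
  finally show ?thesis .
qed

text \<open>Up to sign the left side is the derivative of \<open>nbessel 1\<close>, that is of J_0,
  and its square is part of an energy that is at most 1.\<close>

lemma nbessel_2_bound:
  assumes "0 \<le> z"
  shows "z / 2 * \<bar>nbessel 2 z\<bar> \<le> 1"
proof -
  have "(z / 2 * nbessel 2 z)\<^sup>2 \<le> benergy 1 z" by (simp add: benergy_def)
  also have "\<dots> \<le> 1" using assms by (intro benergy_le_1) auto
  finally have "\<bar>z / 2 * nbessel 2 z\<bar> \<le> 1" by (simp add: abs_square_le_1)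
  then show ?thesis using assms by (simp add: abs_mult)
qed

section \<open>The kernel of the averaged translation\<close>

lemma bessel_j_measurable [measurable]: "bessel_j a \<in> borel_measurable borel"
  unfolding bessel_j_def[abs_def] Bessel_J_def[abs_def] by measurable

text \<open>\<open>shifted c g X t\<close> is \<open>exp (c\<^sup>2/2) * damped g ((X + c)\<^sup>2 + t)\<close>.\<close>
definition damped :: "(real \<Rightarrow> real) \<Rightarrow> real \<Rightarrow> ennreal" where
  "damped g t = ennreal (\<bar>g t\<bar> * exp (- t / 2))"

definition shifted :: "real \<Rightarrow> (real \<Rightarrow> real) \<Rightarrow> real \<Rightarrow> real \<Rightarrow> ennreal" where
  "shifted c g X t = ennreal (\<bar>g (X\<^sup>2 + t + c\<^sup>2 + 2 * c * X)\<bar> * exp (- (X\<^sup>2 + t) / 2 - c * X))"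

lemma shifted_measurable:
  assumes [measurable]: "g \<in> borel_measurable borel"
  shows "(\<lambda>(X, t). shifted c g X t) \<in> borel_measurable (borel \<Otimes>\<^sub>M borel)"
  unfolding shifted_def by measurable

lemma damped_half_line:
  assumes b: "0 \<le> b" and [measurable]: "g \<in> borel_measurable borel"
  shows "(\<integral>\<^sup>+t. damped g t \<partial>riesz (b + 1)) = norm1_half_line b g"
proof -
  have G: "0 < Gamma (b + 1)" using b by (intro Gamma_real_pos) simp
  have "(\<integral>\<^sup>+t. damped g t \<partial>riesz (b + 1))
      = (\<integral>\<^sup>+t. ennreal (if 0 < t then t powr (b + 1 - 1) / Gamma (b + 1) else 0) * damped g t \<partial>lborel)"
    using b by (intro nn_integral_riesz_pos) (simp_all add: damped_def)
  also have "\<dots> = (\<integral>\<^sup>+t. ennreal (1 / Gamma (b + 1)) * (ennreal (\<bar>g t\<bar> * exp (- t / 2) * t powr b) * indicator {0..} t) \<partial>lborel)"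
    by (rule nn_integral_cong_AE, rule eventually_mono[OF AE_lborel_singleton[of 0]])
      (use G in \<open>auto simp: damped_def indicator_def ennreal_mult'[symmetric] mult_ac\<close>)
  also have "\<dots> = ennreal (1 / Gamma (b + 1)) * (\<integral>\<^sup>+t. ennreal (\<bar>g t\<bar> * exp (- t / 2) * t powr b) * indicator {0..} t \<partial>lborel)"
    by (rule nn_integral_cmult) measurable
  also have "\<dots> = norm1_half_line b g"
    unfolding norm1_half_line_def by (subst nn_integral_restrict_space) simp_all
  finally show ?thesis .
qed

lemma shifted_integral:
  assumes b: "0 \<le> b" and [measurable]: "g \<in> borel_measurable borel"
  shows "(\<integral>\<^sup>+X. \<integral>\<^sup>+t. shifted c g X t \<partial>riesz b \<partial>lborel)
    = ennreal (sqrt pi * exp (c\<^sup>2 / 2)) * (\<integral>\<^sup>+t. damped g t \<partial>riesz (b + 1/2))"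
proof -
  interpret g: sigma_finite_measure "riesz b" by (rule sigma_finite_riesz)
  have [measurable]: "damped g \<in> borel_measurable borel" unfolding damped_def by measurable
  \<comment> \<open>Completing the square: - X^2 / 2 - c X = c^2 / 2 - (X + c)^2 / 2, so the same
    square X + c enters g and the exponential.\<close>
  have s: "shifted c g X t = ennreal (exp (c\<^sup>2 / 2)) * damped g ((X + c)\<^sup>2 + t)" for X t
  proof -
    have "X\<^sup>2 + t + c\<^sup>2 + 2 * c * X = (X + c)\<^sup>2 + t" by (simp add: power2_eq_square algebra_simps)
    moreover have "exp (- (X\<^sup>2 + t) / 2 - c * X) = exp (c\<^sup>2 / 2) * exp (- ((X + c)\<^sup>2 + t) / 2)"
      by (simp add: exp_add[symmetric] power2_eq_square field_simps)
    ultimately show ?thesis unfolding shifted_def damped_def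
      by (simp only:) (simp add: ennreal_mult'[symmetric] mult_ac)
  qed
  have "(\<integral>\<^sup>+X. \<integral>\<^sup>+t. shifted c g X t \<partial>riesz b \<partial>lborel)
      = ennreal (exp (c\<^sup>2 / 2)) * (\<integral>\<^sup>+X. \<integral>\<^sup>+t. damped g ((X + c)\<^sup>2 + t) \<partial>riesz b \<partial>lborel)"
    unfolding s by (simp add: nn_integral_cmult)
  also have "(\<integral>\<^sup>+X. \<integral>\<^sup>+t. damped g ((X + c)\<^sup>2 + t) \<partial>riesz b \<partial>lborel) = (\<integral>\<^sup>+X. \<integral>\<^sup>+t. damped g (X\<^sup>2 + t) \<partial>riesz b \<partial>lborel)"
    by (subst nn_integral_real_affine[where t = "- c" and c = 1]) simp_all
  also have "\<dots> = ennreal (sqrt pi) * (\<integral>\<^sup>+y. \<integral>\<^sup>+t. damped g (y + t) \<partial>riesz b \<partial>riesz (1/2))"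
    by (rule nn_integral_square_riesz) measurable
  also have "(\<integral>\<^sup>+y. \<integral>\<^sup>+t. damped g (y + t) \<partial>riesz b \<partial>riesz (1/2)) = (\<integral>\<^sup>+t. damped g t \<partial>riesz (b + 1/2))"
    using riesz_convolution[of "1/2" b "damped g"] b by (simp add: add.commute)
  finally show ?thesis by (simp add: ennreal_mult mult_ac)
qed

text \<open>The factor sqrt y raises the exponent of the density by 1/2; the quotient of Gamma
  values is the change of normalisation.\<close>

lemma riesz_sqrt_shift:
  assumes b: "0 < b" and [measurable]: "H \<in> borel_measurable borel"
  shows "(\<integral>\<^sup>+y. ennreal (sqrt y) * H y \<partial>riesz b) = ennreal (Gamma (b + 1/2) / Gamma b) * (\<integral>\<^sup>+y. H y \<partial>riesz (b + 1/2))"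
proof -
  have G: "0 < Gamma b" "0 < Gamma (b + 1/2)" using b by (auto intro: Gamma_real_pos)
  have "(\<integral>\<^sup>+y. ennreal (sqrt y) * H y \<partial>riesz b)
      = (\<integral>\<^sup>+y. ennreal (if 0 < y then y powr (b - 1) / Gamma b else 0) * (ennreal (sqrt y) * H y) \<partial>lborel)"
    using b by (intro nn_integral_riesz_pos) simp_all
  also have "\<dots> = (\<integral>\<^sup>+y. ennreal (Gamma (b + 1/2) / Gamma b) *
      (ennreal (if 0 < y then y powr (b + 1/2 - 1) / Gamma (b + 1/2) else 0) * H y) \<partial>lborel)"
  proof (rule nn_integral_cong)
    fix y :: real
    show "ennreal (if 0 < y then y powr (b - 1) / Gamma b else 0) * (ennreal (sqrt y) * H y)
      = ennreal (Gamma (b + 1/2) / Gamma b) * (ennreal (if 0 < y then y powr (b + 1/2 - 1) / Gamma (b + 1/2) else 0) * H y)"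
    proof (cases "0 < y")
      case True
      have "y powr (b + 1/2 - 1) = y powr (b - 1) * sqrt y"
        using True powr_add[of y "b - 1" "1/2"] by (simp add: powr_half_sqrt algebra_simps)
      then have "y powr (b - 1) / Gamma b * sqrt y = Gamma (b + 1/2) / Gamma b * (y powr (b + 1/2 - 1) / Gamma (b + 1/2))"
        using G by simp
      then have "ennreal (y powr (b - 1) / Gamma b) * ennreal (sqrt y)
          = ennreal (Gamma (b + 1/2) / Gamma b) * ennreal (y powr (b + 1/2 - 1) / Gamma (b + 1/2))"
        using G True by (simp only: ennreal_mult[symmetric] divide_nonneg_nonneg powr_ge_zero less_imp_le real_sqrt_ge_zero)
      then show ?thesis using True by (simp only: if_True mult.assoc[symmetric])
    qed simp
  qed
  also have "\<dots> = ennreal (Gamma (b + 1/2) / Gamma b) * (\<integral>\<^sup>+y. H y \<partial>riesz (b + 1/2))"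
    using b by (simp add: nn_integral_cmult nn_integral_riesz_pos cong: if_cong)
  finally show ?thesis .
qed

lemma bessel_j_bound:
  assumes a: "0 < a" "a \<le> 1/2" and z: "0 \<le> z"
  shows "\<bar>bessel_j (a - 1) z\<bar> \<le> (1 + Gamma a / Gamma (a + 1/2) * z) / (2 powr (a - 1) * Gamma a)"
proof -
  have "\<bar>bessel_j (a - 1) z\<bar> = \<bar>nbessel a z\<bar> / (2 powr (a - 1) * Gamma a)"
    using bessel_j_nbessel[of "a - 1" z] a z Gamma_real_pos[OF a(1)] by (simp add: abs_mult)
  also have "\<dots> \<le> (1 + Gamma a / Gamma (a + 1/2) * z) / (2 powr (a - 1) * Gamma a)"
    using nbessel_bound[OF a z] Gamma_real_pos[OF a(1)] by (intro divide_right_mono) auto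
  finally show ?thesis .
qed

lemma bessel_j_1_bound:
  assumes "0 \<le> z"
  shows "z * \<bar>bessel_j 1 z\<bar> \<le> 1"
proof -
  have e: "bessel_j 1 z = nbessel 2 z / 2"
    using bessel_j_nbessel[of 1 z] assms Gamma_fact[of 1, where ?'a = real] by simp
  have "z * \<bar>bessel_j 1 z\<bar> = z / 2 * \<bar>nbessel 2 z\<bar>" unfolding e by simp
  also have "\<dots> \<le> 1" by (rule nbessel_2_bound[OF assms])
  finally show ?thesis .
qed

lemma AE_riesz_pos: "0 < a \<Longrightarrow> AE y in riesz a. 0 < y"
  unfolding riesz_def by (simp add: AE_density)

lemma shifted_convolution:
  assumes b: "0 \<le> a" "0 \<le> b" and [measurable]: "g \<in> borel_measurable borel"
  shows "(\<integral>\<^sup>+X. \<integral>\<^sup>+y. \<integral>\<^sup>+Q. shifted c g X (y + Q) \<partial>riesz b \<partial>riesz a \<partial>lborel)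
    = ennreal (sqrt pi * exp (c\<^sup>2 / 2)) * (\<integral>\<^sup>+t. damped g t \<partial>riesz (a + b + 1/2))"
proof -
  note shifted_measurable[OF assms(3), measurable]
  have "(\<integral>\<^sup>+y. \<integral>\<^sup>+Q. shifted c g X (y + Q) \<partial>riesz b \<partial>riesz a) = (\<integral>\<^sup>+t. shifted c g X t \<partial>riesz (a + b))" for X
    using b by (intro riesz_convolution) measurable
  then show ?thesis using b shifted_integral[of "a + b" g c] by simp
qed

text \<open>The Bessel bound splits the integrand. Its constant part keeps \<open>riesz a\<close>;
  in its linear part sqrt y raises \<open>riesz a\<close> to \<open>riesz (a + 1/2)\<close> and
  brings 1 / k, which cancels the slope k. The factor c stays outside and becomes the sqrt t of the
  starred norm.\<close>

lemma kernel_bound_pos: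
  assumes a: "0 < a" "a \<le> 1/2" and c: "0 \<le> c" and [measurable]: "g \<in> borel_measurable borel"
  shows "ennreal (Gamma a / Gamma (a + 1/2) * (2 powr (a - 1) * Gamma (a + 1/2) / sqrt pi)) *
      (\<integral>\<^sup>+X. \<integral>\<^sup>+y. (\<integral>\<^sup>+Q. shifted c g X (y + Q) \<partial>riesz (a + 1/2)) * ennreal \<bar>bessel_j (a - 1) (c * sqrt y)\<bar> \<partial>riesz a \<partial>lborel)
    \<le> ennreal (exp (c\<^sup>2 / 2)) * (norm1_half_line (2 * a) g + ennreal c * norm1_half_line (2 * a + 1/2) g)"
proof -
  note shifted_measurable[OF assms(4), measurable]
  interpret g: sigma_finite_measure "riesz b" for b by (rule sigma_finite_riesz)
  \<comment> \<open>1 / A is the value of \<open>bessel_j (a - 1)\<close> at 0, and k below is the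
    slope of its normalised bound.\<close>
  define A where "A = 2 powr (a - 1) * Gamma a"
  define k where "k = Gamma a / Gamma (a + 1/2)"
  have G: "0 < Gamma a" "0 < Gamma (a + 1/2)" using a by (auto intro: Gamma_real_pos)
  have A: "0 < A" and k: "0 < k" using G by (simp_all add: A_def k_def)
  define S where "S X y = (\<integral>\<^sup>+Q. shifted c g X (y + Q) \<partial>riesz (a + 1/2))" for X y
  have Sm [measurable]: "(\<lambda>(X, y). S X y) \<in> borel_measurable (borel \<Otimes>\<^sub>M borel)"
    unfolding S_def by measurable
  have AEy: "AE y in riesz a. 0 < y"
    by (rule AE_riesz_pos) fact
  have "(\<integral>\<^sup>+X. \<integral>\<^sup>+y. S X y * ennreal \<bar>bessel_j (a - 1) (c * sqrt y)\<bar> \<partial>riesz a \<partial>lborel)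
     \<le> (\<integral>\<^sup>+X. \<integral>\<^sup>+y. ennreal (1 / A) * S X y + ennreal (k * c / A) * (ennreal (sqrt y) * S X y) \<partial>riesz a \<partial>lborel)"
  proof (intro nn_integral_mono nn_integral_mono_AE, rule eventually_mono[OF AEy])
    fix X y :: real assume y: "0 < y"
    have "\<bar>bessel_j (a - 1) (c * sqrt y)\<bar> \<le> (1 + k * (c * sqrt y)) / A"
      using bessel_j_bound[OF a, of "c * sqrt y"] c y by (simp add: k_def A_def)
    then have "ennreal \<bar>bessel_j (a - 1) (c * sqrt y)\<bar> \<le> ennreal (1 / A + k * c / A * sqrt y)"
      by (intro ennreal_leI) (simp add: add_divide_distrib mult_ac)
    also have "\<dots> = ennreal (1 / A) + ennreal (k * c / A) * ennreal (sqrt y)"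
      using A k c y by (subst ennreal_plus) (auto simp: ennreal_mult[symmetric])
    finally have "S X y * ennreal \<bar>bessel_j (a - 1) (c * sqrt y)\<bar> \<le> S X y * (ennreal (1 / A) + ennreal (k * c / A) * ennreal (sqrt y))"
      by (rule mult_left_mono) simp
    then show "S X y * ennreal \<bar>bessel_j (a - 1) (c * sqrt y)\<bar> \<le> ennreal (1 / A) * S X y + ennreal (k * c / A) * (ennreal (sqrt y) * S X y)"
      by (simp only: distrib_left mult_ac)
  qed
  also have "\<dots> = ennreal (1 / A) * (\<integral>\<^sup>+X. \<integral>\<^sup>+y. S X y \<partial>riesz a \<partial>lborel)
      + ennreal (k * c / A) * (\<integral>\<^sup>+X. \<integral>\<^sup>+y. ennreal (sqrt y) * S X y \<partial>riesz a \<partial>lborel)"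
    by (simp add: nn_integral_add nn_integral_cmult)
  also have "(\<integral>\<^sup>+X. \<integral>\<^sup>+y. S X y \<partial>riesz a \<partial>lborel) = ennreal (sqrt pi * exp (c\<^sup>2 / 2)) * norm1_half_line (2 * a) g"
  proof -
    \<comment> \<open>The exponents of Y, Q and X^2. As \<open>riesz b\<close> has density t^(b - 1)
      up to a constant, the weight is t^(2a).\<close>
    have e: "a + (a + 1/2) + 1/2 = 2 * a + 1" by simp
    show ?thesis
      unfolding S_def using a shifted_convolution[of a "a + 1/2" g c, unfolded e] damped_half_line[of "2 * a" g] by simp
  qed
  also have "(\<integral>\<^sup>+X. \<integral>\<^sup>+y. ennreal (sqrt y) * S X y \<partial>riesz a \<partial>lborel) = ennreal (1 / k) * (ennreal (sqrt pi * exp (c\<^sup>2 / 2)) * norm1_half_line (2 * a + 1/2) g)"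
  proof -
    have e: "(a + 1/2) + (a + 1/2) + 1/2 = 2 * a + 1/2 + 1" by simp
    have "(\<integral>\<^sup>+X. \<integral>\<^sup>+y. ennreal (sqrt y) * S X y \<partial>riesz a \<partial>lborel) = (\<integral>\<^sup>+X. ennreal (1 / k) * (\<integral>\<^sup>+y. S X y \<partial>riesz (a + 1/2)) \<partial>lborel)"
      using a by (simp add: riesz_sqrt_shift k_def)
    also have "\<dots> = ennreal (1 / k) * (\<integral>\<^sup>+X. (\<integral>\<^sup>+y. S X y \<partial>riesz (a + 1/2)) \<partial>lborel)"
      by (rule nn_integral_cmult) measurable
    also have "(\<integral>\<^sup>+X. (\<integral>\<^sup>+y. S X y \<partial>riesz (a + 1/2)) \<partial>lborel) = ennreal (sqrt pi * exp (c\<^sup>2 / 2)) * norm1_half_line (2 * a + 1/2) g"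
      unfolding S_def using a shifted_convolution[of "a + 1/2" "a + 1/2" g c, unfolded e] damped_half_line[of "2 * a + 1/2" g] by simp
    finally show ?thesis .
  qed
  finally have *: "(\<integral>\<^sup>+X. \<integral>\<^sup>+y. S X y * ennreal \<bar>bessel_j (a - 1) (c * sqrt y)\<bar> \<partial>riesz a \<partial>lborel)
    \<le> ennreal (1 / A) * (ennreal (sqrt pi * exp (c\<^sup>2 / 2)) * norm1_half_line (2 * a) g)
      + ennreal (k * c / A) * (ennreal (1 / k) * (ennreal (sqrt pi * exp (c\<^sup>2 / 2)) * norm1_half_line (2 * a + 1/2) g))" .
  \<comment> \<open>The prefactor of the translation cancels the value of the Bessel function at 0
    up to sqrt pi, and the integral over X supplies that sqrt pi.\<close>
  have K: "Gamma a / Gamma (a + 1/2) * (2 powr (a - 1) * Gamma (a + 1/2) / sqrt pi) = A / sqrt pi"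
    using G by (simp add: A_def)
  have "ennreal (A / sqrt pi) * (ennreal (1 / A) * (ennreal (sqrt pi * exp (c\<^sup>2 / 2)) * N)) = ennreal (exp (c\<^sup>2 / 2)) * N" for N
  proof -
    have "ennreal (A / sqrt pi) * ennreal (1 / A) * ennreal (sqrt pi * exp (c\<^sup>2 / 2)) = ennreal (A / sqrt pi * (1 / A) * (sqrt pi * exp (c\<^sup>2 / 2)))"
      using A by (subst ennreal_mult[symmetric], simp, simp, subst ennreal_mult[symmetric]) simp_all
    also have "A / sqrt pi * (1 / A) * (sqrt pi * exp (c\<^sup>2 / 2)) = exp (c\<^sup>2 / 2)" using A by simp
    finally have e: "ennreal (A / sqrt pi) * ennreal (1 / A) * ennreal (sqrt pi * exp (c\<^sup>2 / 2)) = ennreal (exp (c\<^sup>2 / 2))" .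
    show ?thesis unfolding e[symmetric] by (simp only: mult.assoc)
  qed
  moreover have "ennreal (k * c / A) * (ennreal (1 / k) * M) = ennreal (1 / A) * (ennreal c * M)" for M
    using A k c by (simp add: mult.assoc[symmetric] ennreal_mult[symmetric])
  ultimately have e: "ennreal (A / sqrt pi) * (ennreal (1 / A) * (ennreal (sqrt pi * exp (c\<^sup>2 / 2)) * norm1_half_line (2 * a) g)
      + ennreal (k * c / A) * (ennreal (1 / k) * (ennreal (sqrt pi * exp (c\<^sup>2 / 2)) * norm1_half_line (2 * a + 1/2) g)))
    = ennreal (exp (c\<^sup>2 / 2)) * (norm1_half_line (2 * a) g + ennreal c * norm1_half_line (2 * a + 1/2) g)"
    by (simp only: distrib_left mult.left_commute[of "ennreal c"])
  show ?thesis unfolding K e[symmetric] S_def[symmetric]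
    by (intro mult_left_mono *) simp
qed

text \<open>The boundary terms reproduce the first norm exactly. In the integral term z |j_1(z)|
  \<le> 1 trades c^2 for c / sqrt y, which lowers \<open>riesz 1\<close> to
  \<open>riesz (1/2)\<close> and so produces the exponent of the second norm.\<close>

lemma kernel_bound_zero:
  assumes c: "0 \<le> c" and [measurable]: "g \<in> borel_measurable borel"
  shows "ennreal (1 / sqrt pi) * (\<integral>\<^sup>+X. \<integral>\<^sup>+Q. shifted c g X Q \<partial>riesz (1/2) \<partial>lborel)
    + ennreal (c\<^sup>2 / (2 * sqrt pi)) * (\<integral>\<^sup>+X. \<integral>\<^sup>+y. (\<integral>\<^sup>+Q. shifted c g X (y + Q) \<partial>riesz (1/2)) * ennreal \<bar>bessel_j 1 (c * sqrt y)\<bar> \<partial>riesz 1 \<partial>lborel)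
    \<le> ennreal (exp (c\<^sup>2 / 2)) * (norm1_half_line 0 g + ennreal c * norm1_half_line (1/2) g)"
proof -
  note shifted_measurable[OF assms(2), measurable]
  interpret g: sigma_finite_measure "riesz b" for b by (rule sigma_finite_riesz)
  define S where "S X y = (\<integral>\<^sup>+Q. shifted c g X (y + Q) \<partial>riesz (1/2))" for X y
  have Sm [measurable]: "(\<lambda>(X, y). S X y) \<in> borel_measurable (borel \<Otimes>\<^sub>M borel)"
    unfolding S_def by measurable
  define E where "E = exp (c\<^sup>2 / 2)"
  have E: "0 \<le> E" by (simp add: E_def)
  have 1: "ennreal (1 / sqrt pi) * (\<integral>\<^sup>+X. \<integral>\<^sup>+Q. shifted c g X Q \<partial>riesz (1/2) \<partial>lborel) = ennreal E * norm1_half_line 0 g"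
    using shifted_integral[of "1/2" g c] damped_half_line[of 0 g]
    by (simp add: E_def[symmetric] mult.assoc[symmetric] ennreal_mult[symmetric] E)
  \<comment> \<open>\<open>riesz_sqrt_shift\<close> read backwards, from exponent 1 to 1/2; the
    factor is Gamma (1/2) = sqrt pi.\<close>
  have sh: "ennreal c * (\<integral>\<^sup>+y. ennreal (inverse (sqrt y)) * S X y \<partial>riesz 1) = ennreal (c * sqrt pi) * (\<integral>\<^sup>+y. S X y \<partial>riesz (1/2))" for X
  proof -
    have "(\<integral>\<^sup>+y. S X y \<partial>riesz (1/2)) = (\<integral>\<^sup>+y. ennreal (sqrt y) * (ennreal (inverse (sqrt y)) * S X y) \<partial>riesz (1/2))"
      by (rule nn_integral_cong_AE, rule eventually_mono[OF AE_riesz_pos])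
        (simp_all add: mult.assoc[symmetric] ennreal_mult[symmetric])
    also have "\<dots> = ennreal (1 / sqrt pi) * (\<integral>\<^sup>+y. ennreal (inverse (sqrt y)) * S X y \<partial>riesz 1)"
      using riesz_sqrt_shift[of "1/2" "\<lambda>y. ennreal (inverse (sqrt y)) * S X y"] by (simp add: Gamma_one_half_real)
    finally show ?thesis
      using c by (simp only: mult.assoc[symmetric] ennreal_mult[symmetric] mult_nonneg_nonneg zero_le_divide_1_iff real_sqrt_ge_zero pi_ge_zero) simp
  qed
  have "ennreal (c\<^sup>2) * (\<integral>\<^sup>+X. \<integral>\<^sup>+y. S X y * ennreal \<bar>bessel_j 1 (c * sqrt y)\<bar> \<partial>riesz 1 \<partial>lborel)
      = (\<integral>\<^sup>+X. \<integral>\<^sup>+y. ennreal (c\<^sup>2) * (S X y * ennreal \<bar>bessel_j 1 (c * sqrt y)\<bar>) \<partial>riesz 1 \<partial>lborel)"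
    by (simp add: nn_integral_cmult)
  also have "\<dots> \<le> (\<integral>\<^sup>+X. \<integral>\<^sup>+y. ennreal c * (ennreal (inverse (sqrt y)) * S X y) \<partial>riesz 1 \<partial>lborel)"
  proof (intro nn_integral_mono nn_integral_mono_AE, rule eventually_mono[OF AE_riesz_pos])
    fix X y :: real assume y: "0 < y"
    have "c * sqrt y * \<bar>bessel_j 1 (c * sqrt y)\<bar> \<le> 1"
      using c y by (intro bessel_j_1_bound) simp
    then have "c * (c * sqrt y * \<bar>bessel_j 1 (c * sqrt y)\<bar>) * inverse (sqrt y) \<le> c * 1 * inverse (sqrt y)"
      using c y by (intro mult_right_mono mult_left_mono) auto
    then have "c\<^sup>2 * \<bar>bessel_j 1 (c * sqrt y)\<bar> \<le> c * inverse (sqrt y)"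
      using y by (simp add: power2_eq_square field_simps)
    then have "ennreal (c\<^sup>2 * \<bar>bessel_j 1 (c * sqrt y)\<bar>) \<le> ennreal (c * inverse (sqrt y))" by (rule ennreal_leI)
    then have "ennreal (c\<^sup>2) * ennreal \<bar>bessel_j 1 (c * sqrt y)\<bar> \<le> ennreal c * ennreal (inverse (sqrt y))"
      using c y by (simp add: ennreal_mult)
    then have "ennreal (c\<^sup>2) * ennreal \<bar>bessel_j 1 (c * sqrt y)\<bar> * S X y \<le> ennreal c * ennreal (inverse (sqrt y)) * S X y"
      by (rule mult_right_mono) simp
    then show "ennreal (c\<^sup>2) * (S X y * ennreal \<bar>bessel_j 1 (c * sqrt y)\<bar>) \<le> ennreal c * (ennreal (inverse (sqrt y)) * S X y)"
      by (simp only: mult_ac)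
  qed simp
  also have "\<dots> = (\<integral>\<^sup>+X. ennreal (c * sqrt pi) * (\<integral>\<^sup>+y. S X y \<partial>riesz (1/2)) \<partial>lborel)"
    by (simp add: nn_integral_cmult sh)
  also have "\<dots> = ennreal (c * sqrt pi) * (\<integral>\<^sup>+X. \<integral>\<^sup>+y. S X y \<partial>riesz (1/2) \<partial>lborel)"
    by (rule nn_integral_cmult) measurable
  also have "(\<integral>\<^sup>+X. \<integral>\<^sup>+y. S X y \<partial>riesz (1/2) \<partial>lborel) = ennreal (sqrt pi * E) * norm1_half_line (1/2) g"
    unfolding S_def E_def using shifted_convolution[of "1/2" "1/2" g c] damped_half_line[of "1/2" g] by simp
  finally have *: "ennreal (c\<^sup>2) * (\<integral>\<^sup>+X. \<integral>\<^sup>+y. S X y * ennreal \<bar>bessel_j 1 (c * sqrt y)\<bar> \<partial>riesz 1 \<partial>lborel)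
    \<le> ennreal (c * sqrt pi) * (ennreal (sqrt pi * E) * norm1_half_line (1/2) g)" .
  have "ennreal (c\<^sup>2 / (2 * sqrt pi)) * X = ennreal (1 / (2 * sqrt pi)) * (ennreal (c\<^sup>2) * X)" for X
    by (simp add: mult.assoc[symmetric] ennreal_mult[symmetric])
  then have "ennreal (c\<^sup>2 / (2 * sqrt pi)) * (\<integral>\<^sup>+X. \<integral>\<^sup>+y. S X y * ennreal \<bar>bessel_j 1 (c * sqrt y)\<bar> \<partial>riesz 1 \<partial>lborel)
    \<le> ennreal (1 / (2 * sqrt pi)) * (ennreal (c * sqrt pi) * (ennreal (sqrt pi * E) * norm1_half_line (1/2) g))"
    using mult_left_mono[OF *, of "ennreal (1 / (2 * sqrt pi))"] by simp
  also have "\<dots> = ennreal (c * (sqrt pi / 2) * E) * norm1_half_line (1/2) g"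
  proof -
    have "ennreal (1 / (2 * sqrt pi)) * ennreal (c * sqrt pi) * ennreal (sqrt pi * E) = ennreal (1 / (2 * sqrt pi) * (c * sqrt pi) * (sqrt pi * E))"
      using c E by (subst ennreal_mult[symmetric], simp, simp, subst ennreal_mult[symmetric]) simp_all
    also have "1 / (2 * sqrt pi) * (c * sqrt pi) * (sqrt pi * E) = c * (sqrt pi / 2) * E" by simp
    finally show ?thesis by (simp only: mult.assoc[symmetric])
  qed
  \<comment> \<open>The constant sqrt pi / 2 collected so far is below 1 because pi < 4.\<close>
  also have "\<dots> \<le> ennreal (E * c) * norm1_half_line (1/2) g"
  proof (intro mult_right_mono ennreal_leI)
    have "sqrt pi / 2 \<le> 1" using pi_less_4 by (simp add: real_le_lsqrt)
    then have "c * (sqrt pi / 2) * E \<le> c * 1 * E" using c E by (intro mult_right_mono mult_left_mono) auto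
    then show "c * (sqrt pi / 2) * E \<le> E * c" by (simp add: mult_ac)
  qed simp
  finally have 2: "ennreal (c\<^sup>2 / (2 * sqrt pi)) * (\<integral>\<^sup>+X. \<integral>\<^sup>+y. S X y * ennreal \<bar>bessel_j 1 (c * sqrt y)\<bar> \<partial>riesz 1 \<partial>lborel)
    \<le> ennreal (E * c) * norm1_half_line (1/2) g" .
  show ?thesis unfolding 1 S_def[symmetric] E_def[symmetric] distrib_left
    using 2 c E by (intro add_left_mono) (simp add: ennreal_mult mult.assoc)
qed

section \<open>The angular integral in light-cone variables\<close>

lemma sigma_finite_theta_measure: "sigma_finite_measure theta_measure"
  unfolding theta_measure_def by (rule sigma_finite_measure_restrict_space) (simp_all add: sigma_finite_lborel)

lemma measurable_ident_theta: "(\<lambda>\<theta>. \<theta>) \<in> borel_measurable theta_measure"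
  unfolding theta_measure_def by (intro measurable_restrict_space1) simp

lemma sin_nonneg_theta: "\<theta> \<in> space theta_measure \<Longrightarrow> 0 \<le> sin \<theta>"
  by (simp add: theta_measure_def space_restrict_space sin_ge_zero)

text \<open>One form for both cases of the translation, with c r in the role of \<rho> and the
  damping exp (- t / 2) included: e = 2a - 1 with j of order a - 1 if a = alpha is positive, and e =
  1 with j of order 1 if alpha = 0.\<close>

definition theta_kernel :: "real \<Rightarrow> real \<Rightarrow> (real \<Rightarrow> real) \<Rightarrow> (real \<Rightarrow> real) \<Rightarrow> real \<Rightarrow> real \<Rightarrow> ennreal" where
  "theta_kernel e c g \<beta> t r = (\<integral>\<^sup>+\<theta>. ennreal (sin \<theta> powr e) *
      (ennreal (exp (- t / 2) * \<bar>g (t + c\<^sup>2 + 2 * (c * r) * cos \<theta>)\<bar> * exp (- (c * r) * cos \<theta>))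
        * ennreal \<bar>\<beta> (c * r * sin \<theta>)\<bar>) \<partial>theta_measure)"

lemma theta_kernel_measurable:
  assumes [measurable]: "g \<in> borel_measurable borel" "\<beta> \<in> borel_measurable borel"
  shows "(\<lambda>(t, r). theta_kernel e c g \<beta> t r) \<in> borel_measurable (borel \<Otimes>\<^sub>M borel)"
proof -
  interpret th: sigma_finite_measure theta_measure by (rule sigma_finite_theta_measure)
  have [measurable]: "(\<lambda>p. snd p) \<in> borel_measurable ((borel \<Otimes>\<^sub>M borel) \<Otimes>\<^sub>M theta_measure)"
    by (rule measurable_compose[OF measurable_snd measurable_ident_theta])
  show ?thesis unfolding theta_kernel_def split_beta by measurable
qed

text \<open>With X = sqrt P cos \<theta> and y = P sin^2 \<theta> one has X^2 + y = P, so t = P + Q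
  becomes X^2 + (y + Q), the form in which \<open>shifted\<close> is written. The Bessel factor does
  not involve Q and leaves the inner integral.\<close>

lemma nn_integral_theta_shifted:
  fixes g \<beta> :: "real \<Rightarrow> real"
  assumes [measurable]: "g \<in> borel_measurable borel" "\<beta> \<in> borel_measurable borel" and P: "0 \<le> P"
  shows "(\<integral>\<^sup>+Q. theta_kernel e c g \<beta> (P + Q) (sqrt P) \<partial>riesz d)
    = (\<integral>\<^sup>+\<theta>. ennreal (sin \<theta> powr e) * ((\<lambda>(X, y). (\<integral>\<^sup>+Q. shifted c g X (y + Q) \<partial>riesz d) * ennreal \<bar>\<beta> (c * sqrt y)\<bar>)
        (sqrt P * cos \<theta>, P * (sin \<theta>)\<^sup>2)) \<partial>theta_measure)" (is "_ = (\<integral>\<^sup>+\<theta>. ?F \<theta> \<partial>_)")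
proof -
  interpret th: sigma_finite_measure theta_measure by (rule sigma_finite_theta_measure)
  note shifted_measurable[OF assms(1), measurable]
  have [measurable]: "(\<lambda>p. snd p) \<in> borel_measurable (riesz d \<Otimes>\<^sub>M theta_measure)"
    by (rule measurable_compose[OF measurable_snd measurable_ident_theta])
  define k where "k \<theta> Q = ennreal (sin \<theta> powr e) *
      (ennreal (exp (- (P + Q) / 2) * \<bar>g (P + Q + c\<^sup>2 + 2 * (c * sqrt P) * cos \<theta>)\<bar> * exp (- (c * sqrt P) * cos \<theta>))
        * ennreal \<bar>\<beta> (c * sqrt P * sin \<theta>)\<bar>)" for \<theta> Q
  have "(\<integral>\<^sup>+Q. theta_kernel e c g \<beta> (P + Q) (sqrt P) \<partial>riesz d) = (\<integral>\<^sup>+\<theta>. \<integral>\<^sup>+Q. k \<theta> Q \<partial>riesz d \<partial>theta_measure)"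
    unfolding theta_kernel_def k_def
    by (intro nn_integral_swap sigma_finite_riesz sigma_finite_theta_measure) measurable
  also have "\<dots> = (\<integral>\<^sup>+\<theta>. ?F \<theta> \<partial>theta_measure)"
  proof (rule nn_integral_cong)
    fix \<theta> assume "\<theta> \<in> space theta_measure"
    then have s: "0 \<le> sin \<theta>" by (rule sin_nonneg_theta)
    have r: "sqrt (P * (sin \<theta>)\<^sup>2) = sqrt P * sin \<theta>" using s P by (simp add: real_sqrt_mult)
    have x: "(sqrt P * cos \<theta>)\<^sup>2 + (P * (sin \<theta>)\<^sup>2 + Q) = P + Q" for Q
    proof -
      have "(sqrt P * cos \<theta>)\<^sup>2 + P * (sin \<theta>)\<^sup>2 = P * ((cos \<theta>)\<^sup>2 + (sin \<theta>)\<^sup>2)"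
        using P by (simp only: power_mult_distrib real_sqrt_pow2 distrib_left)
      then show ?thesis by simp
    qed
    have sh: "ennreal (exp (- (P + Q) / 2) * \<bar>g (P + Q + c\<^sup>2 + 2 * (c * sqrt P) * cos \<theta>)\<bar> * exp (- (c * sqrt P) * cos \<theta>))
        = shifted c g (sqrt P * cos \<theta>) (P * (sin \<theta>)\<^sup>2 + Q)" for Q
    proof -
      have "exp (- (P + Q) / 2 - c * (sqrt P * cos \<theta>)) = exp (- (P + Q) / 2) * exp (- (c * sqrt P) * cos \<theta>)"
        by (simp add: exp_add[symmetric] mult.assoc)
      then show ?thesis unfolding shifted_def x by (simp only: mult_ac)
    qed
    have "(\<integral>\<^sup>+Q. ennreal (sin \<theta> powr e) * (shifted c g (sqrt P * cos \<theta>) (P * (sin \<theta>)\<^sup>2 + Q) * ennreal \<bar>\<beta> (c * sqrt P * sin \<theta>)\<bar>) \<partial>riesz d)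
       = ennreal (sin \<theta> powr e) * ((\<integral>\<^sup>+Q. shifted c g (sqrt P * cos \<theta>) (P * (sin \<theta>)\<^sup>2 + Q) \<partial>riesz d) * ennreal \<bar>\<beta> (c * sqrt P * sin \<theta>)\<bar>)"
      by (simp add: nn_integral_cmult nn_integral_multc)
    then show "(\<integral>\<^sup>+Q. k \<theta> Q \<partial>riesz d) = ?F \<theta>"
      unfolding k_def sh by (simp add: r mult.assoc)
  qed
  finally show ?thesis .
qed

text \<open>The boundary terms at alpha = 0 are the values at X = sqrt P and X = - sqrt P, that is
  \<theta> = 0 and \<theta> = pi. Averaged over the sign, \<open>riesz (1/2)\<close> in P is
  Lebesgue measure in X up to sqrt pi, so translation invariance is available again.\<close>

lemma nn_integral_riesz_half_sqrt:
  assumes [measurable]: "K \<in> borel_measurable borel"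
  shows "(\<integral>\<^sup>+P. (K (sqrt P) + K (- sqrt P)) / 2 \<partial>riesz (1/2)) = ennreal (1 / sqrt pi) * (\<integral>\<^sup>+X. K X \<partial>lborel)"
proof -
  have "ennreal (sqrt pi) * (\<integral>\<^sup>+P. K (sqrt P) + K (- sqrt P) \<partial>riesz (1/2)) = (\<integral>\<^sup>+X. K (sqrt (X\<^sup>2)) + K (- sqrt (X\<^sup>2)) \<partial>lborel)"
    by (rule nn_integral_square_riesz[symmetric]) measurable
  also have "\<dots> = (\<integral>\<^sup>+X. K X + K (- X) \<partial>lborel)"
    by (intro nn_integral_cong) (auto simp: abs_if add.commute)
  also have "\<dots> = (\<integral>\<^sup>+X. K X \<partial>lborel) + (\<integral>\<^sup>+X. K (- X) \<partial>lborel)"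
    by (rule nn_integral_add) measurable
  also have "(\<integral>\<^sup>+X. K (- X) \<partial>lborel) = (\<integral>\<^sup>+X. K X \<partial>lborel)"
    by (subst (2) nn_integral_real_affine[where t = 0 and c = "-1"]) simp_all
  finally have *: "ennreal (sqrt pi) * (\<integral>\<^sup>+P. K (sqrt P) + K (- sqrt P) \<partial>riesz (1/2)) = 2 * (\<integral>\<^sup>+X. K X \<partial>lborel)"
    by (simp only: mult_2)
  have "(\<integral>\<^sup>+P. (K (sqrt P) + K (- sqrt P)) / 2 \<partial>riesz (1/2)) = (\<integral>\<^sup>+P. K (sqrt P) + K (- sqrt P) \<partial>riesz (1/2)) / 2"
    by (rule nn_integral_divide) measurable
  also have "(\<integral>\<^sup>+P. K (sqrt P) + K (- sqrt P) \<partial>riesz (1/2)) = ennreal (1 / sqrt pi) * (2 * (\<integral>\<^sup>+X. K X \<partial>lborel))"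
    unfolding *[symmetric] by (simp add: mult.assoc[symmetric] ennreal_mult[symmetric])
  also have "ennreal (1 / sqrt pi) * (2 * (\<integral>\<^sup>+X. K X \<partial>lborel)) = (ennreal (1 / sqrt pi) * (\<integral>\<^sup>+X. K X \<partial>lborel)) * 2"
    by (simp only: mult_ac)
  also have "\<dots> / 2 = ennreal (1 / sqrt pi) * (\<integral>\<^sup>+X. K X \<partial>lborel)"
    by (rule ennreal_mult_divide_eq) simp_all
  finally show ?thesis .
qed

text \<open>Once Q is integrated, the density P^(a - 1/2) of \<open>riesz (a + 1/2)\<close> is
  exactly the weight that \<open>theta_formula\<close> expects.\<close>

lemma cone_kernel_pos:
  assumes a: "0 < a" "a \<le> 1/2" and c: "0 \<le> c" and [measurable]: "g \<in> borel_measurable borel"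
  defines "C \<equiv> 2 powr (a - 1) * Gamma (a + 1/2) / sqrt pi"
  shows "(\<integral>\<^sup>+P. \<integral>\<^sup>+Q. ennreal C * theta_kernel (2 * a - 1) c g (bessel_j (a - 1)) (P + Q) (sqrt P) \<partial>riesz (a + 1/2) \<partial>riesz (a + 1/2))
    \<le> ennreal (exp (c\<^sup>2 / 2)) * (norm1_half_line (2 * a) g + ennreal c * norm1_half_line (2 * a + 1/2) g)"
proof -
  have G: "0 < Gamma a" "0 < Gamma (a + 1/2)" using a by (auto intro: Gamma_real_pos)
  have C: "0 \<le> C" using G by (simp add: C_def)
  interpret th: sigma_finite_measure theta_measure by (rule sigma_finite_theta_measure)
  interpret gm: sigma_finite_measure "riesz b" for b by (rule sigma_finite_riesz)
  note shifted_measurable[OF assms(4), measurable]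
  define F where "F = (\<lambda>(X, y). (\<integral>\<^sup>+Q. shifted c g X (y + Q) \<partial>riesz (a + 1/2)) * ennreal \<bar>bessel_j (a - 1) (c * sqrt y)\<bar>)"
  have Fm [measurable]: "F \<in> borel_measurable (borel \<Otimes>\<^sub>M borel)" unfolding F_def by measurable
  define L where "L P = (\<integral>\<^sup>+\<theta>. ennreal (sin \<theta> powr (2 * a - 1)) * F (sqrt P * cos \<theta>, P * (sin \<theta>)\<^sup>2) \<partial>theta_measure)" for P
  have Lm [measurable]: "L \<in> borel_measurable borel"
  proof -
    have [measurable]: "(\<lambda>p. snd p) \<in> borel_measurable (borel \<Otimes>\<^sub>M theta_measure)"
      by (rule measurable_compose[OF measurable_snd measurable_ident_theta])
    show ?thesis unfolding L_def by measurable
  qed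
  have "(\<integral>\<^sup>+P. \<integral>\<^sup>+Q. ennreal C * theta_kernel (2 * a - 1) c g (bessel_j (a - 1)) (P + Q) (sqrt P) \<partial>riesz (a + 1/2) \<partial>riesz (a + 1/2))
    = (\<integral>\<^sup>+P. ennreal C * L P \<partial>riesz (a + 1/2))"
  proof (rule nn_integral_cong_AE, rule eventually_mono[OF AE_riesz_pos])
    fix P :: real assume P: "0 < P"
    note theta_kernel_measurable[OF assms(4) bessel_j_measurable, measurable]
    have "(\<integral>\<^sup>+Q. ennreal C * theta_kernel (2 * a - 1) c g (bessel_j (a - 1)) (P + Q) (sqrt P) \<partial>riesz (a + 1/2))
      = ennreal C * (\<integral>\<^sup>+Q. theta_kernel (2 * a - 1) c g (bessel_j (a - 1)) (P + Q) (sqrt P) \<partial>riesz (a + 1/2))"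
      by (rule nn_integral_cmult) measurable
    also have "\<dots> = ennreal C * L P"
      unfolding L_def F_def by (subst nn_integral_theta_shifted) (use P in simp_all)
    finally show "(\<integral>\<^sup>+Q. ennreal C * theta_kernel (2 * a - 1) c g (bessel_j (a - 1)) (P + Q) (sqrt P) \<partial>riesz (a + 1/2)) = ennreal C * L P" .
  qed (use a in simp)
  also have "\<dots> = (\<integral>\<^sup>+P. ennreal (if 0 < P then P powr (a + 1/2 - 1) / Gamma (a + 1/2) else 0) * (ennreal C * L P) \<partial>lborel)"
    using a by (intro nn_integral_riesz_pos) simp_all
  also have "\<dots> = (\<integral>\<^sup>+P. ennreal (C / Gamma (a + 1/2)) * (ennreal (if 0 < P then P powr (a - 1/2) else 0) * L P) \<partial>lborel)"
  proof (rule nn_integral_cong)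
    fix P :: real
    have "ennreal (P powr (a + 1/2 - 1) / Gamma (a + 1/2)) * ennreal C = ennreal (C / Gamma (a + 1/2)) * ennreal (P powr (a - 1/2))"
      using G C by (subst (1 2) ennreal_mult[symmetric]) simp_all
    then show "ennreal (if 0 < P then P powr (a + 1/2 - 1) / Gamma (a + 1/2) else 0) * (ennreal C * L P)
      = ennreal (C / Gamma (a + 1/2)) * (ennreal (if 0 < P then P powr (a - 1/2) else 0) * L P)"
      by (cases "0 < P") (simp_all only: if_True mult.assoc[symmetric], simp)
  qed
  also have "\<dots> = ennreal (C / Gamma (a + 1/2)) * (\<integral>\<^sup>+P. ennreal (if 0 < P then P powr (a - 1/2) else 0) * L P \<partial>lborel)"
    by (rule nn_integral_cmult) measurable
  also have "(\<integral>\<^sup>+P. ennreal (if 0 < P then P powr (a - 1/2) else 0) * L P \<partial>lborel) = ennreal (Gamma a) * (\<integral>\<^sup>+X. \<integral>\<^sup>+y. F (X, y) \<partial>riesz a \<partial>lborel)"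
    unfolding L_def by (rule theta_formula[OF a(1) Fm])
  also have "ennreal (C / Gamma (a + 1/2)) * (ennreal (Gamma a) * Z) = ennreal (Gamma a / Gamma (a + 1/2) * C) * Z" for Z
  proof -
    have "ennreal (C / Gamma (a + 1/2)) * ennreal (Gamma a) = ennreal (Gamma a / Gamma (a + 1/2) * C)"
      using G C by (subst ennreal_mult[symmetric]) (simp_all add: mult.commute)
    then show ?thesis by (simp only: mult.assoc[symmetric])
  qed
  also have "ennreal (Gamma a / Gamma (a + 1/2) * C) * (\<integral>\<^sup>+X. \<integral>\<^sup>+y. F (X, y) \<partial>riesz a \<partial>lborel)
    \<le> ennreal (exp (c\<^sup>2 / 2)) * (norm1_half_line (2 * a) g + ennreal c * norm1_half_line (2 * a + 1/2) g)"
    unfolding F_def C_def using kernel_bound_pos[OF a c assms(4)] by simp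
  finally show ?thesis .
qed

text \<open>Here \<rho>^2 = c^2 P. The factor P lifts the density P^(-1/2) of
  \<open>riesz (1/2)\<close> to P^(1/2), so the integral term falls under
  \<open>theta_formula\<close> with b = 1.\<close>

lemma cone_kernel_zero:
  assumes c: "0 \<le> c" and [measurable]: "g \<in> borel_measurable borel"
  shows "(\<integral>\<^sup>+P. \<integral>\<^sup>+Q. (shifted c g (sqrt P) Q + shifted c g (- sqrt P) Q) / 2
      + ennreal (c\<^sup>2 * P / 2) * theta_kernel 1 c g (bessel_j 1) (P + Q) (sqrt P) \<partial>riesz (1/2) \<partial>riesz (1/2))
    \<le> ennreal (exp (c\<^sup>2 / 2)) * (norm1_half_line 0 g + ennreal c * norm1_half_line (1/2) g)"
proof -
  interpret th: sigma_finite_measure theta_measure by (rule sigma_finite_theta_measure)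
  interpret gm: sigma_finite_measure "riesz b" for b by (rule sigma_finite_riesz)
  note shifted_measurable[OF assms(2), measurable]
  define K where "K X = (\<integral>\<^sup>+Q. shifted c g X Q \<partial>riesz (1/2))" for X
  have Km [measurable]: "K \<in> borel_measurable borel" unfolding K_def by measurable
  define F where "F = (\<lambda>(X, y). (\<integral>\<^sup>+Q. shifted c g X (y + Q) \<partial>riesz (1/2)) * ennreal \<bar>bessel_j 1 (c * sqrt y)\<bar>)"
  have Fm [measurable]: "F \<in> borel_measurable (borel \<Otimes>\<^sub>M borel)" unfolding F_def by measurable
  define L where "L P = (\<integral>\<^sup>+\<theta>. ennreal (sin \<theta> powr 1) * F (sqrt P * cos \<theta>, P * (sin \<theta>)\<^sup>2) \<partial>theta_measure)" for P
  have Lm [measurable]: "L \<in> borel_measurable borel"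
  proof -
    have [measurable]: "(\<lambda>p. snd p) \<in> borel_measurable (borel \<Otimes>\<^sub>M theta_measure)"
      by (rule measurable_compose[OF measurable_snd measurable_ident_theta])
    show ?thesis unfolding L_def by measurable
  qed
  have "(\<integral>\<^sup>+P. \<integral>\<^sup>+Q. (shifted c g (sqrt P) Q + shifted c g (- sqrt P) Q) / 2
      + ennreal (c\<^sup>2 * P / 2) * theta_kernel 1 c g (bessel_j 1) (P + Q) (sqrt P) \<partial>riesz (1/2) \<partial>riesz (1/2))
    = (\<integral>\<^sup>+P. (K (sqrt P) + K (- sqrt P)) / 2 + ennreal (c\<^sup>2 * P / 2) * L P \<partial>riesz (1/2))"
  proof (rule nn_integral_cong_AE, rule eventually_mono[OF AE_riesz_pos])
    fix P :: real assume P: "0 < P"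
    let ?B = "\<lambda>Q. theta_kernel 1 c g (bessel_j 1) (P + Q) (sqrt P)"
    note theta_kernel_measurable[OF assms(2) bessel_j_measurable, measurable]
    have Bm [measurable]: "?B \<in> borel_measurable borel" by measurable
    have "(\<integral>\<^sup>+Q. (shifted c g (sqrt P) Q + shifted c g (- sqrt P) Q) / 2 + ennreal (c\<^sup>2 * P / 2) * ?B Q \<partial>riesz (1/2))
      = (K (sqrt P) + K (- sqrt P)) / 2 + ennreal (c\<^sup>2 * P / 2) * (\<integral>\<^sup>+Q. ?B Q \<partial>riesz (1/2))"
      using Bm by (simp add: nn_integral_add nn_integral_cmult nn_integral_divide K_def)
    also have "(\<integral>\<^sup>+Q. ?B Q \<partial>riesz (1/2)) = L P"
      unfolding L_def F_def by (subst nn_integral_theta_shifted) (use P in simp_all)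
    finally show "(\<integral>\<^sup>+Q. (shifted c g (sqrt P) Q + shifted c g (- sqrt P) Q) / 2 + ennreal (c\<^sup>2 * P / 2) * ?B Q \<partial>riesz (1/2))
      = (K (sqrt P) + K (- sqrt P)) / 2 + ennreal (c\<^sup>2 * P / 2) * L P" .
  qed simp
  also have "\<dots> = (\<integral>\<^sup>+P. (K (sqrt P) + K (- sqrt P)) / 2 \<partial>riesz (1/2)) + (\<integral>\<^sup>+P. ennreal (c\<^sup>2 * P / 2) * L P \<partial>riesz (1/2))"
    by (rule nn_integral_add) measurable
  also have "(\<integral>\<^sup>+P. (K (sqrt P) + K (- sqrt P)) / 2 \<partial>riesz (1/2)) = ennreal (1 / sqrt pi) * (\<integral>\<^sup>+X. K X \<partial>lborel)"
    by (rule nn_integral_riesz_half_sqrt) measurable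
  also have "(\<integral>\<^sup>+P. ennreal (c\<^sup>2 * P / 2) * L P \<partial>riesz (1/2))
      = (\<integral>\<^sup>+P. ennreal (if 0 < P then P powr (1/2 - 1) / Gamma (1/2) else 0) * (ennreal (c\<^sup>2 * P / 2) * L P) \<partial>lborel)"
    by (intro nn_integral_riesz_pos) simp_all
  also have "\<dots> = (\<integral>\<^sup>+P. ennreal (c\<^sup>2 / (2 * sqrt pi)) * (ennreal (if 0 < P then P powr (1 - 1/2) else 0) * L P) \<partial>lborel)"
  proof (rule nn_integral_cong)
    fix P :: real
    show "ennreal (if 0 < P then P powr (1/2 - 1) / Gamma (1/2) else 0) * (ennreal (c\<^sup>2 * P / 2) * L P)
      = ennreal (c\<^sup>2 / (2 * sqrt pi)) * (ennreal (if 0 < P then P powr (1 - 1/2) else 0) * L P)"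
    proof (cases "0 < P")
      case True
      have "P powr (1 - 1/2) = P powr (1/2 - 1) * P" using True powr_add[of P "1/2 - 1" 1] by simp
      then have "P powr (1/2 - 1) / Gamma (1/2) * (c\<^sup>2 * P / 2) = c\<^sup>2 / (2 * sqrt pi) * P powr (1 - 1/2)"
        by (simp only: Gamma_one_half_real) (simp add: mult_ac)
      then have "ennreal (P powr (1/2 - 1) / Gamma (1/2)) * ennreal (c\<^sup>2 * P / 2) = ennreal (c\<^sup>2 / (2 * sqrt pi)) * ennreal (P powr (1 - 1/2))"
        using True by (subst (1 2) ennreal_mult[symmetric]) (simp_all add: Gamma_one_half_real)
      then show ?thesis using True by (simp only: if_True mult.assoc[symmetric])
    qed simp
  qed
  also have "\<dots> = ennreal (c\<^sup>2 / (2 * sqrt pi)) * (\<integral>\<^sup>+P. ennreal (if 0 < P then P powr (1 - 1/2) else 0) * L P \<partial>lborel)"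
    by (rule nn_integral_cmult) measurable
  also have "(\<integral>\<^sup>+P. ennreal (if 0 < P then P powr (1 - 1/2) else 0) * L P \<partial>lborel) = (\<integral>\<^sup>+X. \<integral>\<^sup>+y. F (X, y) \<partial>riesz 1 \<partial>lborel)"
    unfolding L_def using theta_formula[of 1 F] by simp
  also have "ennreal (1 / sqrt pi) * (\<integral>\<^sup>+X. K X \<partial>lborel) + ennreal (c\<^sup>2 / (2 * sqrt pi)) * (\<integral>\<^sup>+X. \<integral>\<^sup>+y. F (X, y) \<partial>riesz 1 \<partial>lborel)
    \<le> ennreal (exp (c\<^sup>2 / 2)) * (norm1_half_line 0 g + ennreal c * norm1_half_line (1/2) g)"
    unfolding F_def K_def using kernel_bound_zero[OF c assms(2)] by simp
  finally show ?thesis .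
qed

section \<open>Translation and pseudo convolution\<close>

text \<open>A non-integrable function has Bochner integral 0, so the inequality covers this case too
  and can be used before convergence is known.\<close>

lemma norm_integral_le_nn_integral:
  fixes f :: "'a \<Rightarrow> real"
  shows "ennreal \<bar>integral\<^sup>L M f\<bar> \<le> (\<integral>\<^sup>+x. ennreal \<bar>f x\<bar> \<partial>M)"
proof (cases "integrable M f")
  case True
  then show ?thesis using integral_norm_bound_ennreal[OF True] by simp
qed (simp add: not_integrable_integral_eq)

text \<open>The translation with all absolute values inside the integrals, valued in
  \<open>ennreal\<close>. It dominates the translation, and its finiteness yields
  \<open>translation_defined\<close>, so one bound gives both the estimate and the
  convergence.\<close>

definition abs_translation :: "real ^ 'n \<Rightarrow> (real \<Rightarrow> real) \<Rightarrow> (real ^ 'n) \<times> real \<Rightarrow> (real ^ 'n) \<times> real \<Rightarrow> ennreal" where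
  "abs_translation \<kappa> g p q =
    (if alpha \<kappa> = 0 then
       ennreal ((exp (- rho_zero p q) * \<bar>g (snd p + snd q + 2 * rho_zero p q)\<bar> + exp (rho_zero p q) * \<bar>g (snd p + snd q - 2 * rho_zero p q)\<bar>) / 2)
       + ennreal ((rho_zero p q)\<^sup>2 / 2) * (\<integral>\<^sup>+\<theta>. ennreal \<bar>trans_integrand_zero g p q \<theta>\<bar> \<partial>theta_measure)
     else ennreal (2 powr (alpha \<kappa> - 1) * Gamma (alpha \<kappa> + 1 / 2) / sqrt pi) *
       (\<integral>\<^sup>+u. \<integral>\<^sup>+\<theta>. ennreal \<bar>trans_integrand \<kappa> g p q u \<theta>\<bar> \<partial>theta_measure \<partial>Phi_measure \<kappa>))"

lemma translation_le_abs_translation: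
  fixes \<kappa> :: "real ^ 'n"
  assumes "CARD('n) \<ge> 2" "\<And>i. 0 \<le> \<kappa> $ i"
  shows "ennreal \<bar>translation \<kappa> g p q\<bar> \<le> abs_translation \<kappa> g p q"
proof (cases "alpha \<kappa> = 0")
  case True
  let ?r = "rho_zero p q"
  let ?A = "exp (- ?r) * g (snd p + snd q + 2 * ?r) + exp ?r * g (snd p + snd q - 2 * ?r)"
  let ?B = "LINT \<theta>|theta_measure. trans_integrand_zero g p q \<theta>"
  have "\<bar>translation \<kappa> g p q\<bar> \<le> (exp (- ?r) * \<bar>g (snd p + snd q + 2 * ?r)\<bar> + exp ?r * \<bar>g (snd p + snd q - 2 * ?r)\<bar>) / 2 + ?r\<^sup>2 / 2 * \<bar>?B\<bar>"
  proof -
    have "translation \<kappa> g p q = ?A / 2 - ?r\<^sup>2 / 2 * ?B"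
      using True by (simp add: translation_def Let_def)
    then have "\<bar>translation \<kappa> g p q\<bar> \<le> \<bar>?A / 2\<bar> + \<bar>?r\<^sup>2 / 2 * ?B\<bar>" by (simp only: abs_triangle_ineq4)
    also have "\<bar>?r\<^sup>2 / 2 * ?B\<bar> = ?r\<^sup>2 / 2 * \<bar>?B\<bar>" by (simp add: abs_mult)
    also have "\<bar>?A / 2\<bar> \<le> (exp (- ?r) * \<bar>g (snd p + snd q + 2 * ?r)\<bar> + exp ?r * \<bar>g (snd p + snd q - 2 * ?r)\<bar>) / 2"
      using abs_triangle_ineq[of "exp (- ?r) * g (snd p + snd q + 2 * ?r)" "exp ?r * g (snd p + snd q - 2 * ?r)"]
      by (simp add: abs_mult)
    finally show ?thesis by simp
  qed
  then have "ennreal \<bar>translation \<kappa> g p q\<bar> \<le> ennreal ((exp (- ?r) * \<bar>g (snd p + snd q + 2 * ?r)\<bar> + exp ?r * \<bar>g (snd p + snd q - 2 * ?r)\<bar>) / 2) + ennreal (?r\<^sup>2 / 2) * ennreal \<bar>?B\<bar>"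
  proof -
    assume le: "\<bar>translation \<kappa> g p q\<bar> \<le> (exp (- ?r) * \<bar>g (snd p + snd q + 2 * ?r)\<bar> + exp ?r * \<bar>g (snd p + snd q - 2 * ?r)\<bar>) / 2 + ?r\<^sup>2 / 2 * \<bar>?B\<bar>"
    have "0 \<le> (exp (- ?r) * \<bar>g (snd p + snd q + 2 * ?r)\<bar> + exp ?r * \<bar>g (snd p + snd q - 2 * ?r)\<bar>) / 2" "0 \<le> ?r\<^sup>2 / 2" by simp_all
    then show ?thesis using ennreal_leI[OF le] by (simp only: ennreal_plus ennreal_mult mult_nonneg_nonneg abs_ge_zero)
  qed
  also have "\<dots> \<le> abs_translation \<kappa> g p q"
    unfolding abs_translation_def using True
    by (simp add: add_left_mono mult_left_mono norm_integral_le_nn_integral)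
  finally show ?thesis .
next
  case False
  let ?C = "2 powr (alpha \<kappa> - 1) * Gamma (alpha \<kappa> + 1 / 2) / sqrt pi"
  let ?I = "LINT u|Phi_measure \<kappa>. (LINT \<theta>|theta_measure. trans_integrand \<kappa> g p q u \<theta>)"
  have C: "0 \<le> ?C" using alpha_half_pos[OF assms] by (simp add: Gamma_real_pos less_imp_le)
  have "translation \<kappa> g p q = ?C * ?I" using False by (simp add: translation_def)
  then have "ennreal \<bar>translation \<kappa> g p q\<bar> = ennreal ?C * ennreal \<bar>?I\<bar>"
    using C by (simp only: abs_mult abs_of_nonneg ennreal_mult abs_ge_zero)
  also have "ennreal \<bar>?I\<bar> \<le> (\<integral>\<^sup>+u. ennreal \<bar>LINT \<theta>|theta_measure. trans_integrand \<kappa> g p q u \<theta>\<bar> \<partial>Phi_measure \<kappa>)"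
    by (rule norm_integral_le_nn_integral)
  also have "\<dots> \<le> (\<integral>\<^sup>+u. \<integral>\<^sup>+\<theta>. ennreal \<bar>trans_integrand \<kappa> g p q u \<theta>\<bar> \<partial>theta_measure \<partial>Phi_measure \<kappa>)"
    by (intro nn_integral_mono norm_integral_le_nn_integral)
  finally show ?thesis using False by (simp add: abs_translation_def mult_left_mono)
qed

section \<open>Measurability and convergence of the translation\<close>

lemma rho_eq: "rho p q u = sqrt ((snd p * snd q + (\<Sum>i\<in>UNIV. fst p $ i * fst q $ i * u i)) / 2)"
  by (cases p; cases q) (simp add: rho_def)

lemma rho_zero_eq: "rho_zero p q = sqrt ((snd p * snd q + (\<Sum>i\<in>UNIV. fst p $ i * fst q $ i)) / 2)"
  by (cases p; cases q) (simp add: rho_zero_def inner_vec_def)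

lemma trans_integrand_measurable:
  fixes \<kappa> :: "real ^ 'n"
  assumes [measurable]: "g \<in> borel_measurable borel"
  shows "(\<lambda>z. trans_integrand \<kappa> g (fst (fst (fst z))) (snd (fst (fst z))) (snd (fst z)) (snd z))
    \<in> borel_measurable (((borel \<Otimes>\<^sub>M borel) \<Otimes>\<^sub>M Phi_measure \<kappa>) \<Otimes>\<^sub>M theta_measure)"
proof -
  let ?M = "(((borel :: ((real ^ 'n) \<times> real) measure) \<Otimes>\<^sub>M (borel :: ((real ^ 'n) \<times> real) measure)) \<Otimes>\<^sub>M Phi_measure \<kappa>) \<Otimes>\<^sub>M theta_measure"
  have [measurable]: "(\<lambda>z. snd z) \<in> borel_measurable ?M"
    by (rule measurable_compose[OF measurable_snd measurable_ident_theta])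
  have [measurable]: "(\<lambda>z. snd (fst z) i) \<in> borel_measurable ?M" for i
    by (rule measurable_compose[where g = "\<lambda>u. u i", OF _ measurable_Phi_component[where \<kappa> = \<kappa>]]) simp
  show ?thesis unfolding trans_integrand_def Let_def rho_eq by measurable
qed

lemma trans_integrand_zero_measurable:
  assumes [measurable]: "g \<in> borel_measurable borel"
  shows "(\<lambda>z. trans_integrand_zero g (fst (fst z) :: (real ^ 'n) \<times> real) (snd (fst z)) (snd z))
    \<in> borel_measurable ((borel \<Otimes>\<^sub>M borel) \<Otimes>\<^sub>M theta_measure)"
proof -
  let ?M = "((borel :: ((real ^ 'n) \<times> real) measure) \<Otimes>\<^sub>M (borel :: ((real ^ 'n) \<times> real) measure)) \<Otimes>\<^sub>M theta_measure"
  have [measurable]: "(\<lambda>z. snd z) \<in> borel_measurable ?M"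
    by (rule measurable_compose[OF measurable_snd measurable_ident_theta])
  show ?thesis unfolding trans_integrand_zero_def Let_def rho_zero_eq by measurable
qed

lemma translation_measurable:
  fixes \<kappa> :: "real ^ 'n"
  assumes \<kappa>: "\<And>i. 0 \<le> \<kappa> $ i" and g [measurable]: "g \<in> borel_measurable borel"
  shows "(\<lambda>w. translation \<kappa> g (fst w) (snd w)) \<in> borel_measurable (borel \<Otimes>\<^sub>M borel)"
    and "(\<lambda>w. abs_translation \<kappa> g (fst w) (snd w)) \<in> borel_measurable (borel \<Otimes>\<^sub>M borel)"
proof -
  interpret Phi: prob_space "Phi_measure \<kappa>" by (rule prob_space_Phi_measure[OF \<kappa>])
  interpret th: sigma_finite_measure theta_measure by (rule sigma_finite_theta_measure)
  note m1 = trans_integrand_measurable[OF g, of \<kappa>]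
  note m0 = trans_integrand_zero_measurable[OF g, where 'n = 'n]
  have r0 [measurable]: "(\<lambda>w. rho_zero (fst w) (snd w)) \<in> borel_measurable ((borel :: ((real ^ 'n) \<times> real) measure) \<Otimes>\<^sub>M borel)"
    unfolding rho_zero_eq by measurable
  have 1: "(\<lambda>w. \<integral>\<^sup>+\<theta>. ennreal \<bar>trans_integrand_zero g (fst w) (snd w) \<theta>\<bar> \<partial>theta_measure) \<in> borel_measurable ((borel :: ((real ^ 'n) \<times> real) measure) \<Otimes>\<^sub>M borel)"
    using m0 by (intro th.borel_measurable_nn_integral) (simp add: split_beta)
  have 2: "(\<lambda>w. LINT \<theta>|theta_measure. trans_integrand_zero g (fst w) (snd w) \<theta>) \<in> borel_measurable ((borel :: ((real ^ 'n) \<times> real) measure) \<Otimes>\<^sub>M borel)"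
    using m0 by (intro th.borel_measurable_lebesgue_integral) (simp add: split_beta)
  have "(\<lambda>z. \<integral>\<^sup>+\<theta>. ennreal \<bar>trans_integrand \<kappa> g (fst (fst z)) (snd (fst z)) (snd z) \<theta>\<bar> \<partial>theta_measure) \<in> borel_measurable ((borel \<Otimes>\<^sub>M borel) \<Otimes>\<^sub>M Phi_measure \<kappa>)"
    using m1 by (intro th.borel_measurable_nn_integral) (simp add: split_beta)
  then have 3: "(\<lambda>w. \<integral>\<^sup>+u. \<integral>\<^sup>+\<theta>. ennreal \<bar>trans_integrand \<kappa> g (fst w) (snd w) u \<theta>\<bar> \<partial>theta_measure \<partial>Phi_measure \<kappa>) \<in> borel_measurable (borel \<Otimes>\<^sub>M borel)"
    by (intro Phi.borel_measurable_nn_integral) (simp add: split_beta)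
  have "(\<lambda>z. LINT \<theta>|theta_measure. trans_integrand \<kappa> g (fst (fst z)) (snd (fst z)) (snd z) \<theta>) \<in> borel_measurable ((borel \<Otimes>\<^sub>M borel) \<Otimes>\<^sub>M Phi_measure \<kappa>)"
    using m1 by (intro th.borel_measurable_lebesgue_integral) (simp add: split_beta)
  then have 4: "(\<lambda>w. LINT u|Phi_measure \<kappa>. LINT \<theta>|theta_measure. trans_integrand \<kappa> g (fst w) (snd w) u \<theta>) \<in> borel_measurable (borel \<Otimes>\<^sub>M borel)"
    by (intro Phi.borel_measurable_lebesgue_integral) (simp add: split_beta)
  note [measurable] = 1 2 3 4
  show "(\<lambda>w. translation \<kappa> g (fst w) (snd w)) \<in> borel_measurable (borel \<Otimes>\<^sub>M borel)"
    unfolding translation_def Let_def by (cases "alpha \<kappa> = 0") simp_all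
  show "(\<lambda>w. abs_translation \<kappa> g (fst w) (snd w)) \<in> borel_measurable (borel \<Otimes>\<^sub>M borel)"
    unfolding abs_translation_def by (cases "alpha \<kappa> = 0") simp_all
qed

lemma translation_definedI:
  fixes \<kappa> :: "real ^ 'n"
  assumes d: "CARD('n) \<ge> 2" and \<kappa>: "\<And>i. 0 \<le> \<kappa> $ i" and g: "g \<in> borel_measurable borel"
    and fin: "abs_translation \<kappa> g p q < \<infinity>"
  shows "translation_defined \<kappa> g p q"
proof (cases "alpha \<kappa> = 0")
  case True
  have m: "trans_integrand_zero g p q \<in> borel_measurable theta_measure"
    using measurable_compose[OF measurable_Pair1'[of "(p, q)" "borel \<Otimes>\<^sub>M borel" theta_measure] trans_integrand_zero_measurable[OF g]]
    by (simp add: space_pair_measure)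
  have "integrable theta_measure (trans_integrand_zero g p q)"
  proof (cases "rho_zero p q = 0")
    \<comment> \<open>If \<rho> = 0 the factor \<rho>^2 hides the integral from
      \<open>abs_translation\<close>, and its finiteness says nothing. The integrand is then a
      constant times sin \<theta>.\<close>
    case r: True
    interpret th: finite_measure theta_measure
      by (rule finite_measureI) (simp add: theta_measure_def emeasure_restrict_space space_restrict_space)
    show ?thesis
      by (rule th.integrable_const_bound[of _ "\<bar>g (snd p + snd q) * bessel_j 1 0\<bar>"])
        (use m in \<open>auto intro!: AE_I2 mult_left_le simp: trans_integrand_zero_def r abs_mult\<close>)
  next
    case False
    have "ennreal ((rho_zero p q)\<^sup>2 / 2) * (\<integral>\<^sup>+\<theta>. ennreal \<bar>trans_integrand_zero g p q \<theta>\<bar> \<partial>theta_measure) < \<infinity>"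
      using fin True by (simp add: abs_translation_def)
    then have "(\<integral>\<^sup>+\<theta>. ennreal \<bar>trans_integrand_zero g p q \<theta>\<bar> \<partial>theta_measure) < \<infinity>"
      using False by (auto simp: ennreal_mult_less_top)
    then show ?thesis using m by (simp add: integrable_iff_bounded)
  qed
  then show ?thesis using True by (simp add: translation_defined_def)
next
  case False
  interpret th: sigma_finite_measure theta_measure by (rule sigma_finite_theta_measure)
  define C where "C = 2 powr (alpha \<kappa> - 1) * Gamma (alpha \<kappa> + 1 / 2) / sqrt pi"
  have C: "0 < C" using alpha_half_pos[OF d \<kappa>] by (simp add: C_def Gamma_real_pos)
  have m: "(\<lambda>w. trans_integrand \<kappa> g p q (fst w) (snd w)) \<in> borel_measurable (Phi_measure \<kappa> \<Otimes>\<^sub>M theta_measure)"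
    using measurable_compose[OF _ trans_integrand_measurable[OF g], of "\<lambda>w. (((p, q), fst w), snd w)" "Phi_measure \<kappa> \<Otimes>\<^sub>M theta_measure"]
    by simp
  have "ennreal C * (\<integral>\<^sup>+u. \<integral>\<^sup>+\<theta>. ennreal \<bar>trans_integrand \<kappa> g p q u \<theta>\<bar> \<partial>theta_measure \<partial>Phi_measure \<kappa>) < \<infinity>"
    using fin False by (simp add: abs_translation_def C_def)
  then have "(\<integral>\<^sup>+u. \<integral>\<^sup>+\<theta>. ennreal \<bar>trans_integrand \<kappa> g p q u \<theta>\<bar> \<partial>theta_measure \<partial>Phi_measure \<kappa>) < \<infinity>"
    using C by (auto simp: ennreal_mult_less_top)
  also have "(\<integral>\<^sup>+u. \<integral>\<^sup>+\<theta>. ennreal \<bar>trans_integrand \<kappa> g p q u \<theta>\<bar> \<partial>theta_measure \<partial>Phi_measure \<kappa>)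
      = (\<integral>\<^sup>+w. ennreal \<bar>trans_integrand \<kappa> g p q (fst w) (snd w)\<bar> \<partial>(Phi_measure \<kappa> \<Otimes>\<^sub>M theta_measure))"
    using m by (subst th.nn_integral_fst[symmetric]) simp_all
  finally have "integrable (Phi_measure \<kappa> \<Otimes>\<^sub>M theta_measure) (\<lambda>w. trans_integrand \<kappa> g p q (fst w) (snd w))"
    using m by (simp add: integrable_iff_bounded)
  then show ?thesis using False by (simp add: translation_defined_def case_prod_unfold)
qed

section \<open>Averaging the translation over the cone\<close>

text \<open>At \<kappa> = 0 all coordinate measures are point masses at 1. This lets
  \<open>cone_formula\<close>, which integrates over u, handle the exceptional translation, which
  has no u.\<close>

lemma nn_integral_Phi_zero:
  fixes H :: "('n::finite \<Rightarrow> real) \<Rightarrow> ennreal"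
  assumes "H \<in> borel_measurable (Phi_measure (0 :: real ^ 'n))"
  shows "(\<integral>\<^sup>+u. H u \<partial>Phi_measure 0) = H (\<lambda>_. 1)"
proof -
  interpret Phi: prob_space "Phi_measure (0 :: real ^ 'n)" by (rule prob_space_Phi_measure) simp
  have "AE u in Phi_measure (0 :: real ^ 'n). u i = 1" for i
  proof -
    have "u_measure 0 = return (restrict_space borel {- 1..1}) (1 :: real)" by (simp add: u_measure_def)
    moreover have "Measurable.pred (restrict_space borel {- 1..1}) (\<lambda>u :: real. u = 1)"
      by (intro measurable_restrict_space1) measurable
    ultimately have "AE u in u_measure 0. u = 1"
      by (simp only:) (subst AE_return, simp_all add: space_restrict_space)
    then have "AE u in u_measure ((0 :: real ^ 'n) $ i). u = 1" by (simp only: zero_index)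
    then show ?thesis unfolding Phi_measure_def
      by (intro AE_PiM_component prob_space_u_measure) simp_all
  qed
  then have "AE u in Phi_measure (0 :: real ^ 'n). \<forall>i. u i = 1" by (simp add: AE_all_countable)
  then have "(\<integral>\<^sup>+u. H u \<partial>Phi_measure 0) = (\<integral>\<^sup>+u. H (\<lambda>_. 1) \<partial>Phi_measure (0 :: real ^ 'n))"
    by (intro nn_integral_cong_AE) (auto elim!: eventually_mono intro!: arg_cong[where f = H])
  then show ?thesis by (simp add: Phi.emeasure_space_1)
qed

text \<open>With q fixed, the integrand depends on p and u only through t and V, so
  \<open>cone_formula\<close> turns the average into a kernel integral in P and Q whose only trace
  of q is c = sqrt s.\<close>

lemma abs_translation_bound:
  fixes \<kappa> :: "real ^ 'n"
  assumes d: "CARD('n) \<ge> 2" and \<kappa>: "\<And>i. 0 \<le> \<kappa> $ i" and le: "alpha \<kappa> \<le> 1/2"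
    and g [measurable]: "g \<in> borel_measurable borel" and q: "q \<in> conic_surface" "0 < snd q"
  shows "(\<integral>\<^sup>+p. ennreal (exp (- snd p / 2) * u_weight \<kappa> p) * abs_translation \<kappa> g p q \<partial>conic_measure)
    \<le> ennreal (cone_const \<kappa>) * (ennreal (exp (snd q / 2)) *
        (norm1_half_line (2 * alpha \<kappa>) g + ennreal (sqrt (snd q)) * norm1_half_line (2 * alpha \<kappa> + 1/2) g))"
proof -
  define s c \<eta> where "s = snd q" and "c = sqrt s" and "\<eta> = (1 / s) *\<^sub>R fst q"
  have s: "0 < s" "norm (fst q) = s" using q by (auto simp: s_def conic_surface_def)
  have c: "0 \<le> c" "c\<^sup>2 = s" using s by (simp_all add: c_def)
  have \<eta>: "norm \<eta> = 1" using s by (simp add: \<eta>_def)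
  have fq: "fst q $ i = s * \<eta> $ i" for i using s by (simp add: \<eta>_def)
  interpret Phi: prob_space "Phi_measure \<kappa>" by (rule prob_space_Phi_measure[OF \<kappa>])
  interpret th: sigma_finite_measure theta_measure by (rule sigma_finite_theta_measure)
  note shifted_measurable[OF g, measurable]
  \<comment> \<open>Since y = s \<eta>, a factor s comes out of the radicand.\<close>
  have rho: "rho p q u = c * sqrt ((snd p + (\<Sum>i\<in>UNIV. fst p $ i * \<eta> $ i * u i)) / 2)" for p u
  proof -
    have "(snd p * snd q + (\<Sum>i\<in>UNIV. fst p $ i * fst q $ i * u i)) / 2 = s * ((snd p + (\<Sum>i\<in>UNIV. fst p $ i * \<eta> $ i * u i)) / 2)"
      by (simp add: fq s_def[symmetric] sum_distrib_left algebra_simps)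
    then show ?thesis unfolding rho_eq c_def by (simp only: real_sqrt_mult)
  qed
  define D where "D t V e \<beta> = theta_kernel e c g \<beta> t (sqrt ((t + V) / 2))" for t V e :: real and \<beta> :: "real \<Rightarrow> real"
  have Dm: "(\<lambda>(t, V). D t V e \<beta>) \<in> borel_measurable (borel \<Otimes>\<^sub>M borel)" if \<beta>: "\<beta> \<in> borel_measurable borel" for e \<beta>
  proof -
    note theta_kernel_measurable[OF g \<beta>, measurable]
    show ?thesis unfolding D_def split_beta by measurable
  qed
  \<comment> \<open>In light-cone variables (t + V) / 2 is P, hence \<rho> = c sqrt P.\<close>
  have PQ: "(P + Q + (P - Q)) / 2 = P" for P Q :: real by simp
  have un: "0 \<le> u_weight \<kappa> p" if "p \<in> space conic_measure" for p
    using that by (auto simp: space_conic_measure conic_surface_def u_weight_def)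
  have ew: "ennreal (exp (- snd p / 2) * u_weight \<kappa> p) * X = ennreal (u_weight \<kappa> p) * (ennreal (exp (- snd p / 2)) * X)"
    if "p \<in> space conic_measure" for p X
    using un[OF that] by (simp add: ennreal_mult mult_ac)
  show ?thesis
  proof (cases "alpha \<kappa> = 0")
    case False
    define a where "a = alpha \<kappa>"
    have a: "0 < a" "a \<le> 1/2" using False alpha_half_pos(2)[OF d \<kappa>] le by (auto simp: a_def)
    define C where "C = 2 powr (a - 1) * Gamma (a + 1/2) / sqrt pi"
    define G where "G = (\<lambda>(t, V). ennreal C * D t V (2 * a - 1) (bessel_j (a - 1)))"
    have Gm: "G \<in> borel_measurable (borel \<Otimes>\<^sub>M borel)"
      using Dm[of "bessel_j (a - 1)"] unfolding G_def split_beta by measurable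
    have "(\<integral>\<^sup>+p. ennreal (exp (- snd p / 2) * u_weight \<kappa> p) * abs_translation \<kappa> g p q \<partial>conic_measure)
      = (\<integral>\<^sup>+p. ennreal (u_weight \<kappa> p) * (\<integral>\<^sup>+u. G (snd p, \<Sum>i\<in>UNIV. fst p $ i * \<eta> $ i * u i) \<partial>Phi_measure \<kappa>) \<partial>conic_measure)"
    proof (rule nn_integral_cong)
      fix p :: "(real ^ 'n) \<times> real" assume p: "p \<in> space conic_measure"
      have m: "(\<lambda>w. trans_integrand \<kappa> g p q (fst w) (snd w)) \<in> borel_measurable (Phi_measure \<kappa> \<Otimes>\<^sub>M theta_measure)"
        using measurable_compose[OF _ trans_integrand_measurable[OF g], of "\<lambda>w. (((p, q), fst w), snd w)" "Phi_measure \<kappa> \<Otimes>\<^sub>M theta_measure"]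
        by simp
      have "G (snd p, \<Sum>i\<in>UNIV. fst p $ i * \<eta> $ i * u i)
          = ennreal C * (ennreal (exp (- snd p / 2)) * (\<integral>\<^sup>+\<theta>. ennreal \<bar>trans_integrand \<kappa> g p q u \<theta>\<bar> \<partial>theta_measure))"
        if u: "u \<in> space (Phi_measure \<kappa>)" for u
      proof -
        have "(\<lambda>\<theta>. trans_integrand \<kappa> g p q u \<theta>) \<in> borel_measurable theta_measure"
          using measurable_compose[OF measurable_Pair1'[OF u] m] by simp
        then have "ennreal (exp (- snd p / 2)) * (\<integral>\<^sup>+\<theta>. ennreal \<bar>trans_integrand \<kappa> g p q u \<theta>\<bar> \<partial>theta_measure)
            = (\<integral>\<^sup>+\<theta>. ennreal (exp (- snd p / 2)) * ennreal \<bar>trans_integrand \<kappa> g p q u \<theta>\<bar> \<partial>theta_measure)"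
          by (intro nn_integral_cmult[symmetric]) simp
        also have "\<dots> = D (snd p) (\<Sum>i\<in>UNIV. fst p $ i * \<eta> $ i * u i) (2 * a - 1) (bessel_j (a - 1))"
          unfolding D_def theta_kernel_def trans_integrand_def Let_def rho a_def[symmetric] c(2) s_def[symmetric]
          by (intro nn_integral_cong) (simp add: abs_mult ennreal_mult mult_ac)
        finally show ?thesis by (simp add: G_def)
      qed
      then have "(\<integral>\<^sup>+u. G (snd p, \<Sum>i\<in>UNIV. fst p $ i * \<eta> $ i * u i) \<partial>Phi_measure \<kappa>)
          = (\<integral>\<^sup>+u. ennreal C * (ennreal (exp (- snd p / 2)) * (\<integral>\<^sup>+\<theta>. ennreal \<bar>trans_integrand \<kappa> g p q u \<theta>\<bar> \<partial>theta_measure)) \<partial>Phi_measure \<kappa>)"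
        by (intro nn_integral_cong)
      also have "\<dots> = ennreal C * (ennreal (exp (- snd p / 2)) * (\<integral>\<^sup>+u. \<integral>\<^sup>+\<theta>. ennreal \<bar>trans_integrand \<kappa> g p q u \<theta>\<bar> \<partial>theta_measure \<partial>Phi_measure \<kappa>))"
      proof -
        have "(\<lambda>u. \<integral>\<^sup>+\<theta>. ennreal \<bar>trans_integrand \<kappa> g p q u \<theta>\<bar> \<partial>theta_measure) \<in> borel_measurable (Phi_measure \<kappa>)"
          using m by (intro th.borel_measurable_nn_integral) (simp add: split_beta)
        then show ?thesis by (simp add: nn_integral_cmult)
      qed
      finally have "(\<integral>\<^sup>+u. G (snd p, \<Sum>i\<in>UNIV. fst p $ i * \<eta> $ i * u i) \<partial>Phi_measure \<kappa>) = ennreal (exp (- snd p / 2)) * abs_translation \<kappa> g p q"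
        using False by (simp add: abs_translation_def C_def a_def mult_ac)
      then show "ennreal (exp (- snd p / 2) * u_weight \<kappa> p) * abs_translation \<kappa> g p q
        = ennreal (u_weight \<kappa> p) * (\<integral>\<^sup>+u. G (snd p, \<Sum>i\<in>UNIV. fst p $ i * \<eta> $ i * u i) \<partial>Phi_measure \<kappa>)"
        by (simp only: ew[OF p])
    qed
    also have "\<dots> = ennreal (cone_const \<kappa>) * (\<integral>\<^sup>+P. \<integral>\<^sup>+Q. G (P + Q, P - Q) \<partial>riesz (a + 1/2) \<partial>riesz (a + 1/2))"
      unfolding a_def by (rule cone_formula[OF d \<kappa> \<eta> Gm])
    also have "\<dots> \<le> ennreal (cone_const \<kappa>) * (ennreal (exp (c\<^sup>2 / 2)) * (norm1_half_line (2 * a) g + ennreal c * norm1_half_line (2 * a + 1/2) g))"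
      unfolding G_def D_def C_def prod.case PQ by (intro mult_left_mono cone_kernel_pos a c g) simp
    finally show ?thesis unfolding c(2) a_def s_def[symmetric] c_def[symmetric] .
  next
    case True
    \<comment> \<open>alpha is a sum of two nonnegative parts, the \<kappa> i and (d - 2)/2; if it
      vanishes, so do both.\<close>
    have k0: "\<kappa> = 0"
    proof -
      have "2 \<le> real CARD('n)" using d by linarith
      then have "(\<Sum>i\<in>UNIV. \<kappa> $ i) \<le> 0" using True by (simp add: alpha_def field_simps)
      moreover have "0 \<le> (\<Sum>i\<in>UNIV. \<kappa> $ i)" using \<kappa> by (simp add: sum_nonneg)
      ultimately have "(\<Sum>i\<in>UNIV. \<kappa> $ i) = 0" by linarith
      then show ?thesis using \<kappa> by (simp add: sum_nonneg_eq_0_iff vec_eq_iff)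
    qed
    have rz: "rho_zero p q = c * sqrt ((snd p + (\<Sum>i\<in>UNIV. fst p $ i * \<eta> $ i)) / 2)" for p
      using rho[of p "\<lambda>_. 1"] by (simp add: rho_eq rho_zero_eq)
    define B where "B t r = ennreal (exp (- t / 2) * ((exp (- (c * r)) * \<bar>g (t + c\<^sup>2 + 2 * (c * r))\<bar> + exp (c * r) * \<bar>g (t + c\<^sup>2 - 2 * (c * r))\<bar>) / 2))" for t r :: real
    define G where "G = (\<lambda>(t, V). B t (sqrt ((t + V) / 2)) + ennreal (c\<^sup>2 * (sqrt ((t + V) / 2))\<^sup>2 / 2) * D t V 1 (bessel_j 1))"
    have Gm: "G \<in> borel_measurable (borel \<Otimes>\<^sub>M borel)"
      using Dm[of "bessel_j 1"] unfolding G_def B_def split_beta by measurable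
    have "(\<integral>\<^sup>+p. ennreal (exp (- snd p / 2) * u_weight \<kappa> p) * abs_translation \<kappa> g p q \<partial>conic_measure)
      = (\<integral>\<^sup>+p. ennreal (u_weight \<kappa> p) * (\<integral>\<^sup>+u. G (snd p, \<Sum>i\<in>UNIV. fst p $ i * \<eta> $ i * u i) \<partial>Phi_measure \<kappa>) \<partial>conic_measure)"
    proof (rule nn_integral_cong)
      fix p :: "(real ^ 'n) \<times> real" assume p: "p \<in> space conic_measure"
      have m: "trans_integrand_zero g p q \<in> borel_measurable theta_measure"
        using measurable_compose[OF measurable_Pair1'[of "(p, q)" "borel \<Otimes>\<^sub>M borel" theta_measure] trans_integrand_zero_measurable[OF g]]
        by (simp add: space_pair_measure)
      have mu: "(\<lambda>u. G (snd p, \<Sum>i\<in>UNIV. fst p $ i * \<eta> $ i * u i)) \<in> borel_measurable (Phi_measure \<kappa>)"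
      proof -
        note measurable_Phi_component [measurable]
        note Gm [measurable]
        show ?thesis by measurable
      qed
      have "ennreal (exp (- snd p / 2)) * (\<integral>\<^sup>+\<theta>. ennreal \<bar>trans_integrand_zero g p q \<theta>\<bar> \<partial>theta_measure)
          = (\<integral>\<^sup>+\<theta>. ennreal (exp (- snd p / 2)) * ennreal \<bar>trans_integrand_zero g p q \<theta>\<bar> \<partial>theta_measure)"
        using m by (intro nn_integral_cmult[symmetric]) simp
      also have "\<dots> = D (snd p) (\<Sum>i\<in>UNIV. fst p $ i * \<eta> $ i) 1 (bessel_j 1)"
        unfolding D_def theta_kernel_def trans_integrand_zero_def Let_def rz c(2) s_def[symmetric]
        by (intro nn_integral_cong) (simp add: abs_mult ennreal_mult mult_ac sin_nonneg_theta)
      finally have e1: "ennreal (exp (- snd p / 2)) * (\<integral>\<^sup>+\<theta>. ennreal \<bar>trans_integrand_zero g p q \<theta>\<bar> \<partial>theta_measure)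
        = D (snd p) (\<Sum>i\<in>UNIV. fst p $ i * \<eta> $ i) 1 (bessel_j 1)" .
      have e2: "ennreal (exp (- snd p / 2)) * ennreal ((exp (- rho_zero p q) * \<bar>g (snd p + snd q + 2 * rho_zero p q)\<bar> + exp (rho_zero p q) * \<bar>g (snd p + snd q - 2 * rho_zero p q)\<bar>) / 2)
        = B (snd p) (sqrt ((snd p + (\<Sum>i\<in>UNIV. fst p $ i * \<eta> $ i)) / 2))"
        unfolding B_def rz c(2) s_def[symmetric] by (rule ennreal_mult[symmetric]) (simp_all add: add_nonneg_nonneg)
      have "(\<integral>\<^sup>+u. G (snd p, \<Sum>i\<in>UNIV. fst p $ i * \<eta> $ i * u i) \<partial>Phi_measure \<kappa>) = G (snd p, \<Sum>i\<in>UNIV. fst p $ i * \<eta> $ i)"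
        using mu unfolding k0 by (subst nn_integral_Phi_zero) simp_all
      also have "\<dots> = ennreal (exp (- snd p / 2)) * abs_translation \<kappa> g p q"
      proof -
        let ?X = "ennreal ((exp (- rho_zero p q) * \<bar>g (snd p + snd q + 2 * rho_zero p q)\<bar> + exp (rho_zero p q) * \<bar>g (snd p + snd q - 2 * rho_zero p q)\<bar>) / 2)"
        let ?Z = "\<integral>\<^sup>+\<theta>. ennreal \<bar>trans_integrand_zero g p q \<theta>\<bar> \<partial>theta_measure"
        have "ennreal (exp (- snd p / 2)) * abs_translation \<kappa> g p q
            = ennreal (exp (- snd p / 2)) * (?X + ennreal ((rho_zero p q)\<^sup>2 / 2) * ?Z)"
          using True by (simp add: abs_translation_def)
        also have "\<dots> = ennreal (exp (- snd p / 2)) * ?X + ennreal ((rho_zero p q)\<^sup>2 / 2) * (ennreal (exp (- snd p / 2)) * ?Z)"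
          by (simp only: distrib_left mult.left_commute)
        also have "\<dots> = G (snd p, \<Sum>i\<in>UNIV. fst p $ i * \<eta> $ i)"
          unfolding e1 e2 by (simp only: G_def prod.case rz power_mult_distrib)
        finally show ?thesis by simp
      qed
      finally show "ennreal (exp (- snd p / 2) * u_weight \<kappa> p) * abs_translation \<kappa> g p q
        = ennreal (u_weight \<kappa> p) * (\<integral>\<^sup>+u. G (snd p, \<Sum>i\<in>UNIV. fst p $ i * \<eta> $ i * u i) \<partial>Phi_measure \<kappa>)"
        by (simp only: ew[OF p])
    qed
    also have "\<dots> = ennreal (cone_const \<kappa>) * (\<integral>\<^sup>+P. \<integral>\<^sup>+Q. G (P + Q, P - Q) \<partial>riesz (alpha \<kappa> + 1/2) \<partial>riesz (alpha \<kappa> + 1/2))"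
      by (rule cone_formula[OF d \<kappa> \<eta> Gm])
    also have "(\<integral>\<^sup>+P. \<integral>\<^sup>+Q. G (P + Q, P - Q) \<partial>riesz (alpha \<kappa> + 1/2) \<partial>riesz (alpha \<kappa> + 1/2))
      = (\<integral>\<^sup>+P. \<integral>\<^sup>+Q. (shifted c g (sqrt P) Q + shifted c g (- sqrt P) Q) / 2
      + ennreal (c\<^sup>2 * P / 2) * theta_kernel 1 c g (bessel_j 1) (P + Q) (sqrt P) \<partial>riesz (1/2) \<partial>riesz (1/2))"
    proof -
      have "B (P + Q) (sqrt P) = (shifted c g (sqrt P) Q + shifted c g (- sqrt P) Q) / 2" if P: "0 < P" for P Q
      proof -
        have sh: "shifted c g X Q = ennreal (exp (- (P + Q) / 2) * (exp (- (c * X)) * \<bar>g (P + Q + c\<^sup>2 + 2 * (c * X))\<bar>))" if "X\<^sup>2 = P" for X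
        proof -
          have "exp (- (P + Q) / 2 - c * X) = exp (- (P + Q) / 2) * exp (- (c * X))" by (simp add: exp_add[symmetric])
          then show ?thesis unfolding shifted_def that by (simp only: mult_ac)
        qed
        have "(shifted c g (sqrt P) Q + shifted c g (- sqrt P) Q) / 2
          = ennreal ((exp (- (P + Q) / 2) * (exp (- (c * sqrt P)) * \<bar>g (P + Q + c\<^sup>2 + 2 * (c * sqrt P))\<bar>)
            + exp (- (P + Q) / 2) * (exp (c * sqrt P) * \<bar>g (P + Q + c\<^sup>2 - 2 * (c * sqrt P))\<bar>)) / 2)"
        proof -
          let ?a = "exp (- (P + Q) / 2) * (exp (- (c * sqrt P)) * \<bar>g (P + Q + c\<^sup>2 + 2 * (c * sqrt P))\<bar>)"
          let ?b = "exp (- (P + Q) / 2) * (exp (c * sqrt P) * \<bar>g (P + Q + c\<^sup>2 - 2 * (c * sqrt P))\<bar>)"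
          have nn: "0 \<le> ?a" "0 \<le> ?b" by simp_all
          have "shifted c g (sqrt P) Q = ennreal ?a" using P by (intro sh) simp
          moreover have "shifted c g (- sqrt P) Q = ennreal ?b" using P sh[of "- sqrt P"] by simp
          moreover have "ennreal ?a + ennreal ?b = ennreal (?a + ?b)" using nn by (rule ennreal_plus[symmetric])
          moreover have "ennreal (?a + ?b) / 2 = ennreal ((?a + ?b) / 2)"
            using nn by (intro ennreal_divide_numeral add_nonneg_nonneg)
          ultimately show ?thesis by (simp only:)
        qed
        then show ?thesis unfolding B_def by (simp only: distrib_left times_divide_eq_right)
      qed
      then have GPQ: "G (P + Q, P - Q) = (shifted c g (sqrt P) Q + shifted c g (- sqrt P) Q) / 2
          + ennreal (c\<^sup>2 * P / 2) * theta_kernel 1 c g (bessel_j 1) (P + Q) (sqrt P)" if "0 < P" for P Q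
        using that real_sqrt_pow2[of P] unfolding G_def D_def prod.case PQ by (simp only: less_imp_le)
      show ?thesis
        unfolding True add_0_left
      proof (rule nn_integral_cong_AE, rule eventually_mono[OF AE_riesz_pos])
        fix P :: real assume "0 < P"
        then show "(\<integral>\<^sup>+Q. G (P + Q, P - Q) \<partial>riesz (1/2)) = (\<integral>\<^sup>+Q. (shifted c g (sqrt P) Q + shifted c g (- sqrt P) Q) / 2
          + ennreal (c\<^sup>2 * P / 2) * theta_kernel 1 c g (bessel_j 1) (P + Q) (sqrt P) \<partial>riesz (1/2))"
          by (intro nn_integral_cong GPQ)
      qed simp
    qed
    finally have "(\<integral>\<^sup>+p. ennreal (exp (- snd p / 2) * u_weight \<kappa> p) * abs_translation \<kappa> g p q \<partial>conic_measure)
      \<le> ennreal (cone_const \<kappa>) * (ennreal (exp (c\<^sup>2 / 2)) * (norm1_half_line 0 g + ennreal c * norm1_half_line (1/2) g))"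
      by (simp only:) (intro mult_left_mono cone_kernel_zero[OF c(1) g], simp)
    then show ?thesis unfolding c(2) True s_def[symmetric] c_def[symmetric] by simp
  qed
qed

section \<open>Null sets and sigma-finiteness on the cone\<close>

lemma measurable_ident_conic: "(\<lambda>p. p) \<in> borel_measurable (conic_measure :: ((real ^ 'n) \<times> real) measure)"
  by (rule borel_measurable_conic_measureI) simp

lemma AE_conicI:
  fixes P :: "(real ^ 'n) \<times> real \<Rightarrow> bool"
  assumes [measurable]: "Measurable.pred borel P" and AE: "AE x in lborel. P (x, norm x)"
  shows "AE p in conic_measure. P p"
proof -
  have m: "Measurable.pred conic_measure P"
    using measurable_compose[OF measurable_ident_conic assms(1)] .
  have "(\<integral>\<^sup>+p. indicator {p. \<not> P p} p \<partial>conic_measure) = (\<integral>\<^sup>+x. indicator {p. \<not> P p} (x, norm x) \<partial>lborel)"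
    by (intro nn_integral_conic_lborel measurable_restrict_space1) measurable
  also have "\<dots> = (\<integral>\<^sup>+x. 0 \<partial>(lborel :: (real ^ 'n) measure))"
    using AE by (intro nn_integral_cong_AE) (auto elim!: eventually_mono)
  finally show ?thesis using m by (subst AE_iff_nn_integral) (simp_all add: pred_def)
qed

lemma sigma_finite_conic_measure: "sigma_finite_measure (conic_measure :: ((real ^ 'n) \<times> real) measure)"
proof
  define A where "A n = {p \<in> space (conic_measure :: ((real ^ 'n) \<times> real) measure). norm (fst p) \<le> real n}" for n :: nat
  have m: "(\<lambda>p. norm (fst p)) \<in> borel_measurable (conic_measure :: ((real ^ 'n) \<times> real) measure)"
    by (rule borel_measurable_conic_measureI) measurable
  have sets: "A n \<in> sets conic_measure" for n
    unfolding A_def using m by measurable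
  have "emeasure conic_measure (A n) \<noteq> \<infinity>" for n
  proof -
    have "emeasure conic_measure (A n) = (\<integral>\<^sup>+p. indicator (A n) p \<partial>conic_measure)"
      using sets by simp
    also have "\<dots> = (\<integral>\<^sup>+p. indicator {p :: (real ^ 'n) \<times> real. norm (fst p) \<le> real n} p \<partial>conic_measure)"
      by (intro nn_integral_cong) (auto simp: A_def indicator_def)
    also have "\<dots> = (\<integral>\<^sup>+x. indicator {p :: (real ^ 'n) \<times> real. norm (fst p) \<le> real n} (x, norm x) \<partial>lborel)"
      by (intro nn_integral_conic_lborel measurable_restrict_space1) measurable
    also have "\<dots> = (\<integral>\<^sup>+x. indicator (cball (0 :: real ^ 'n) (real n)) x \<partial>lborel)"
      by (intro nn_integral_cong) (auto simp: indicator_def)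
    also have "\<dots> = emeasure lborel (cball (0 :: real ^ 'n) (real n))" by simp
    finally show ?thesis using emeasure_bounded_finite[of "cball (0 :: real ^ 'n) (real n)"] by simp
  qed
  moreover have "\<Union> (range A) = space conic_measure"
    by (auto simp: A_def) (rule real_arch_simple)
  ultimately show "\<exists>\<A>. countable \<A> \<and> \<A> \<subseteq> sets (conic_measure :: ((real ^ 'n) \<times> real) measure) \<and> \<Union> \<A> = space conic_measure \<and> (\<forall>a\<in>\<A>. emeasure conic_measure a \<noteq> \<infinity>)"
    using sets by (intro exI[of _ "range A"]) auto
qed

text \<open>The weight can vanish only over coordinate hyperplanes, which are null. Positivity
  almost everywhere is what turns finiteness of a weighted integral into finiteness of the integrand
  without its weight.\<close>

lemma AE_u_weight_pos:
  fixes \<kappa> :: "real ^ 'n"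
  shows "AE p in conic_measure. 0 < u_weight \<kappa> p \<and> 0 < snd p"
proof (rule AE_conicI)
  have "AE x in (lborel :: (real ^ 'n) measure). x $ i \<noteq> 0" for i :: 'n
  proof -
    have "closed {x :: real ^ 'n. x $ i = 0}" by (intro closed_Collect_eq continuous_intros)
    then have "{x :: real ^ 'n. x $ i = 0} \<in> sets lborel" by simp
    moreover have "{x :: real ^ 'n. x $ i = 0} \<in> null_sets lebesgue"
      using negligible_standard_hyperplane_cart[of i] by (simp add: negligible_iff_null_sets)
    ultimately have "{x :: real ^ 'n. x $ i = 0} \<in> null_sets lborel" by (simp add: null_sets_completion_iff)
    from AE_not_in[OF this] show ?thesis by simp
  qed
  then have "AE x in (lborel :: (real ^ 'n) measure). \<forall>i. x $ i \<noteq> 0" by (simp add: AE_all_countable)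
  then show "AE x in lborel. 0 < u_weight \<kappa> (x, norm x) \<and> 0 < snd (x, norm x)"
  proof (rule eventually_mono)
    fix x :: "real ^ 'n" assume x: "\<forall>i. x $ i \<noteq> 0"
    then have "x \<noteq> 0" by auto
    moreover have "0 < coord_weight (\<kappa> $ i) (x $ i)" for i using x by (simp add: coord_weight_def)
    ultimately show "0 < u_weight \<kappa> (x, norm x) \<and> 0 < snd (x, norm x)"
      by (simp add: u_weight_cone prod_pos)
  qed
qed measurable

section \<open>The range of the argument of g\<close>

text \<open>Cauchy-Schwarz bounds \<rho> by sqrt (t s), and the arithmetic mean bounds that. Hence t
  + s + 2 \<rho> cos \<theta> never becomes negative.\<close>

lemma rho_bound:
  fixes p q :: "(real ^ 'n) \<times> real"
  assumes p: "p \<in> conic_surface" and q: "q \<in> conic_surface" and u: "\<And>i. \<bar>u i\<bar> \<le> 1"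
  shows "\<bar>rho p q u\<bar> \<le> (snd p + snd q) / 2"
proof -
  define V where "V = (\<Sum>i\<in>UNIV. fst p $ i * fst q $ i * u i)"
  have n: "norm (fst p) = snd p" "norm (fst q) = snd q" and nn: "0 \<le> snd p" "0 \<le> snd q"
    using p q by (auto simp: conic_surface_def)
  have "\<bar>V\<bar> \<le> (\<Sum>i\<in>UNIV. \<bar>fst p $ i * fst q $ i * u i\<bar>)" unfolding V_def by (rule sum_abs)
  also have "\<dots> \<le> (\<Sum>i\<in>UNIV. \<bar>fst p $ i\<bar> * \<bar>fst q $ i\<bar>)"
    using u by (intro sum_mono) (simp add: abs_mult mult_left_le)
  also have "\<dots> \<le> snd p * snd q"
    using L2_set_mult_ineq[of "\<lambda>i. fst p $ i" "\<lambda>i. fst q $ i" UNIV] n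
    by (simp add: norm_vec_def L2_set_def)
  finally have V: "\<bar>V\<bar> \<le> snd p * snd q" .
  have "rho p q u = sqrt ((snd p * snd q + V) / 2)" by (simp add: rho_eq V_def)
  also have "\<dots> \<le> sqrt (snd p * snd q)" using V by simp
  also have "\<dots> \<le> (snd p + snd q) / 2" using nn by (rule arith_geo_mean_sqrt)
  finally have "rho p q u \<le> (snd p + snd q) / 2" .
  moreover have "0 \<le> rho p q u" using V by (simp add: rho_eq V_def[symmetric])
  ultimately show ?thesis by simp
qed

lemma translation_argument_nonneg:
  fixes r t c :: real
  assumes "\<bar>r\<bar> \<le> t / 2"
  shows "0 \<le> t + 2 * r * cos c"
proof -
  have "\<bar>2 * r * cos c\<bar> \<le> 2 * \<bar>r\<bar> * 1" unfolding abs_mult by (intro mult_mono) auto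
  then show ?thesis using assms by linarith
qed

text \<open>Membership in \<open>L1_half_line\<close> controls g on the half-line only; this permits
  replacing g by its extension by 0, which is Borel on the whole line.\<close>

lemma translation_cong:
  fixes \<kappa> :: "real ^ 'n" and p q :: "(real ^ 'n) \<times> real"
  assumes p: "p \<in> conic_surface" and q: "q \<in> conic_surface" and eq: "\<And>x. 0 \<le> x \<Longrightarrow> g x = h x"
  shows "translation \<kappa> g p q = translation \<kappa> h p q" "translation_defined \<kappa> g p q \<longleftrightarrow> translation_defined \<kappa> h p q"
proof -
  have "rho_zero p q = rho p q (\<lambda>_. 1)" by (simp add: rho_eq rho_zero_eq)
  then have rz: "\<bar>rho_zero p q\<bar> \<le> (snd p + snd q) / 2" using rho_bound[OF p q, of "\<lambda>_. 1"] by simp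
  have tz: "trans_integrand_zero g p q = trans_integrand_zero h p q"
    unfolding trans_integrand_zero_def Let_def using translation_argument_nonneg[OF rz]
    by (intro ext) (simp add: eq mult.assoc)
  have gz: "g (snd p + snd q + 2 * rho_zero p q) = h (snd p + snd q + 2 * rho_zero p q)"
    "g (snd p + snd q - 2 * rho_zero p q) = h (snd p + snd q - 2 * rho_zero p q)"
    using rz by (auto intro!: eq)
  have t: "trans_integrand \<kappa> g p q u = trans_integrand \<kappa> h p q u" if "u \<in> space (Phi_measure \<kappa>)" for u
  proof -
    have "u i \<in> space (u_measure (\<kappa> $ i))" for i
      using that by (auto simp: Phi_measure_def space_PiM)
    moreover have "space (u_measure k) = {- 1..1}" for k
      by (simp add: u_measure_def space_restrict_space)
    ultimately have "\<bar>u i\<bar> \<le> 1" for i by (auto simp: abs_le_iff minus_le_iff)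
    from translation_argument_nonneg[OF rho_bound[OF p q this]] show ?thesis
      unfolding trans_integrand_def Let_def by (intro ext) (simp add: eq mult.assoc)
  qed
  show "translation \<kappa> g p q = translation \<kappa> h p q"
    unfolding translation_def Let_def tz gz using t
    by (simp cong: Bochner_Integration.integral_cong)
  have "integrable (Phi_measure \<kappa> \<Otimes>\<^sub>M theta_measure) (\<lambda>(u, \<theta>). trans_integrand \<kappa> g p q u \<theta>)
    \<longleftrightarrow> integrable (Phi_measure \<kappa> \<Otimes>\<^sub>M theta_measure) (\<lambda>(u, \<theta>). trans_integrand \<kappa> h p q u \<theta>)"
    by (intro Bochner_Integration.integrable_cong) (auto simp: space_pair_measure t)
  then show "translation_defined \<kappa> g p q \<longleftrightarrow> translation_defined \<kappa> h p q"
    unfolding translation_defined_def tz by simp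
qed

section \<open>The estimate for the pseudo convolution\<close>

lemma norm1_eq: "norm1 \<kappa> f = ennreal (b_const \<kappa>) * (\<integral>\<^sup>+p. ennreal (\<bar>f p\<bar> * exp (- snd p / 2) * u_weight \<kappa> p) \<partial>conic_measure)"
  unfolding norm1_def by (simp add: case_prod_unfold)

lemma norm1_star_eq: "norm1_star \<kappa> f = ennreal (b_const \<kappa>) * (\<integral>\<^sup>+p. ennreal (\<bar>f p\<bar> * exp (- snd p / 2) * sqrt (snd p) * u_weight \<kappa> p) \<partial>conic_measure)"
  unfolding norm1_star_def by (simp add: case_prod_unfold)

text \<open>Tonelli brings the integral over p inside, where \<open>abs_translation_bound\<close>
  applies to each q. The same finite double integral shows that the convolution converges absolutely
  at almost every p.\<close>

lemma pseudo_conv_bound: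
  fixes \<kappa> :: "real ^ 'n"
  assumes d: "CARD('n) \<ge> 2" and \<kappa>: "\<And>i. 0 \<le> \<kappa> $ i" and le: "alpha \<kappa> \<le> 1/2"
    and f [measurable]: "f \<in> borel_measurable conic_measure" and f1: "norm1 \<kappa> f < \<infinity>" and f2: "norm1_star \<kappa> f < \<infinity>"
    and g [measurable]: "g \<in> borel_measurable borel"
    and g1: "norm1_half_line (2 * alpha \<kappa>) g < \<infinity>" and g2: "norm1_half_line (2 * alpha \<kappa> + 1/2) g < \<infinity>"
  shows "AE p in conic_measure. pseudo_conv_defined \<kappa> f g p"
    and "norm1 \<kappa> (pseudo_conv \<kappa> f g) \<le> norm1 \<kappa> f * norm1_half_line (2 * alpha \<kappa>) g
        + norm1_star \<kappa> f * norm1_half_line (2 * alpha \<kappa> + 1/2) g"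
proof -
  let ?M = "conic_measure :: ((real ^ 'n) \<times> real) measure"
  interpret C: sigma_finite_measure ?M by (rule sigma_finite_conic_measure)
  interpret CC: pair_sigma_finite ?M ?M ..
  define N1 N2 where "N1 = norm1_half_line (2 * alpha \<kappa>) g" and "N2 = norm1_half_line (2 * alpha \<kappa> + 1/2) g"
  define W where "W = cone_const \<kappa>"
  define b where "b = b_const \<kappa>"
  have W: "0 < W" unfolding W_def by (rule cone_const_pos[OF d \<kappa>])
  have b: "b = 1 / W" unfolding b_def W_def by (rule b_const_eq[OF d \<kappa>])
  have b0: "0 < b" using W by (simp add: b)
  \<comment> \<open>The convolution and the outer norm each carry a factor b. One of them is used up
    by the W of the averaged translation; the other normalises the norms of f.\<close>
  have bW: "ennreal b * ennreal W = 1" using W by (simp add: b ennreal_mult[symmetric])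
  have id2: "(\<lambda>w. w) \<in> ?M \<Otimes>\<^sub>M ?M \<rightarrow>\<^sub>M borel \<Otimes>\<^sub>M borel"
    using measurable_Pair[OF measurable_compose[OF measurable_fst measurable_ident_conic] measurable_compose[OF measurable_snd measurable_ident_conic]]
    by simp
  define TA where "TA p q = abs_translation \<kappa> g p q" for p q
  have TAm: "(\<lambda>w. TA (fst w) (snd w)) \<in> borel_measurable (?M \<Otimes>\<^sub>M ?M)"
    unfolding TA_def using measurable_compose[OF id2 translation_measurable(2)[OF \<kappa> g]] .
  have Tm: "(\<lambda>w. translation \<kappa> g (fst w) (snd w)) \<in> borel_measurable (?M \<Otimes>\<^sub>M ?M)"
    using measurable_compose[OF id2 translation_measurable(1)[OF \<kappa> g]] .
  have um: "u_weight \<kappa> \<in> borel_measurable ?M" by (rule borel_measurable_conic_measureI) measurable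
  have sm: "snd \<in> borel_measurable ?M" by (rule borel_measurable_conic_measureI) measurable
  note [measurable] = TAm Tm um sm
  have w: "w_weight \<kappa> p = u_weight \<kappa> p * exp (- snd p)" for p
    by (simp add: w_weight_def u_weight_def split: prod.split)
  have un: "0 \<le> u_weight \<kappa> p" "0 \<le> snd p" if "p \<in> space ?M" for p
    using that by (auto simp: space_conic_measure conic_surface_def u_weight_def)
  define E where "E p = ennreal (exp (- snd p / 2) * u_weight \<kappa> p)" for p
  define F where "F q = ennreal (\<bar>f q\<bar> * w_weight \<kappa> q)" for q
  have [measurable]: "E \<in> borel_measurable ?M" unfolding E_def by measurable
  have [measurable]: "F \<in> borel_measurable ?M" unfolding F_def w by measurable
  define R where "R q = ennreal (exp (snd q / 2)) * (N1 + ennreal (sqrt (snd q)) * N2)" for q :: "(real ^ 'n) \<times> real"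
  have pw: "(\<integral>\<^sup>+p. E p * TA p q \<partial>?M) \<le> ennreal W * R q" if "q \<in> space ?M" "0 < snd q" for q
    unfolding E_def TA_def W_def R_def N1_def N2_def
    using that by (intro abs_translation_bound[OF d \<kappa> le g]) (simp_all add: space_conic_measure)
  define B where "B p = (\<integral>\<^sup>+q. F q * TA p q \<partial>?M)" for p
  have [measurable]: "B \<in> borel_measurable ?M" unfolding B_def by measurable
  define I1 I2 where "I1 = (\<integral>\<^sup>+p. ennreal (\<bar>f p\<bar> * exp (- snd p / 2) * u_weight \<kappa> p) \<partial>?M)"
    and "I2 = (\<integral>\<^sup>+p. ennreal (\<bar>f p\<bar> * exp (- snd p / 2) * sqrt (snd p) * u_weight \<kappa> p) \<partial>?M)"
  have total: "(\<integral>\<^sup>+p. E p * B p \<partial>?M) \<le> ennreal W * (I1 * N1 + I2 * N2)"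
  proof -
    have "(\<integral>\<^sup>+p. E p * B p \<partial>?M) = (\<integral>\<^sup>+p. \<integral>\<^sup>+q. E p * (F q * TA p q) \<partial>?M \<partial>?M)"
      unfolding B_def
    proof (intro nn_integral_cong nn_integral_cmult[symmetric])
      fix p assume p: "p \<in> space ?M"
      have [measurable]: "TA p \<in> borel_measurable ?M"
        using measurable_compose[OF measurable_Pair1'[OF p] TAm] by simp
      show "(\<lambda>q. F q * TA p q) \<in> borel_measurable ?M" by measurable
    qed
    also have "\<dots> = (\<integral>\<^sup>+q. \<integral>\<^sup>+p. E p * (F q * TA p q) \<partial>?M \<partial>?M)"
      by (intro nn_integral_swap C.sigma_finite_measure_axioms) measurable
    also have "\<dots> = (\<integral>\<^sup>+q. F q * (\<integral>\<^sup>+p. E p * TA p q \<partial>?M) \<partial>?M)"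
    proof (rule nn_integral_cong)
      fix q assume q: "q \<in> space ?M"
      have [measurable]: "(\<lambda>p. TA p q) \<in> borel_measurable ?M"
        using measurable_compose[OF measurable_Pair2'[OF q] TAm] by simp
      have "(\<integral>\<^sup>+p. F q * (E p * TA p q) \<partial>?M) = F q * (\<integral>\<^sup>+p. E p * TA p q \<partial>?M)"
        by (rule nn_integral_cmult) measurable
      then show "(\<integral>\<^sup>+p. E p * (F q * TA p q) \<partial>?M) = F q * (\<integral>\<^sup>+p. E p * TA p q \<partial>?M)"
        by (simp only: mult.left_commute)
    qed
    \<comment> \<open>The pointwise bound excludes the apex, which is a null set.\<close>
    also have "\<dots> \<le> (\<integral>\<^sup>+q. F q * (ennreal W * R q) \<partial>?M)"
      using AE_u_weight_pos[of \<kappa>] AE_space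
      by (intro nn_integral_mono_AE) (auto elim!: eventually_elim2 intro!: mult_left_mono pw)
    also have "\<dots> = (\<integral>\<^sup>+q. ennreal W * (ennreal (\<bar>f q\<bar> * exp (- snd q / 2) * u_weight \<kappa> q) * N1
        + ennreal (\<bar>f q\<bar> * exp (- snd q / 2) * sqrt (snd q) * u_weight \<kappa> q) * N2) \<partial>?M)"
    proof (rule nn_integral_cong)
      fix q assume q: "q \<in> space ?M"
      let ?z = "\<bar>f q\<bar> * exp (- snd q / 2) * u_weight \<kappa> q"
      have z: "0 \<le> ?z" using un[OF q] by simp
      \<comment> \<open>The e^(-s) of the convolution weight and the e^(s/2) of the translation
        bound leave the e^(-s/2) of the norms of f.\<close>
      have "\<bar>f q\<bar> * w_weight \<kappa> q * exp (snd q / 2) = ?z"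
      proof -
        have "exp (- snd q) * exp (snd q / 2) = exp (- snd q / 2)" by (simp add: exp_add[symmetric])
        then show ?thesis unfolding w by (simp add: mult_ac)
      qed
      then have 1: "F q * ennreal (exp (snd q / 2)) = ennreal ?z"
        unfolding F_def w using un[OF q] by (simp add: ennreal_mult[symmetric])
      have 2: "ennreal ?z * ennreal (sqrt (snd q)) = ennreal (\<bar>f q\<bar> * exp (- snd q / 2) * sqrt (snd q) * u_weight \<kappa> q)"
        using z un[OF q] by (subst ennreal_mult[symmetric]) (simp_all add: mult_ac)
      have "F q * (ennreal W * R q) = ennreal W * ((F q * ennreal (exp (snd q / 2))) * (N1 + ennreal (sqrt (snd q)) * N2))"
        unfolding R_def by (simp only: mult_ac)
      also have "\<dots> = ennreal W * (ennreal ?z * N1 + (ennreal ?z * ennreal (sqrt (snd q))) * N2)"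
        unfolding 1 by (simp only: distrib_left mult.assoc)
      finally show "F q * (ennreal W * R q) = ennreal W * (ennreal ?z * N1
        + ennreal (\<bar>f q\<bar> * exp (- snd q / 2) * sqrt (snd q) * u_weight \<kappa> q) * N2)" unfolding 2 .
    qed
    also have "\<dots> = ennreal W * (I1 * N1 + I2 * N2)"
      unfolding I1_def I2_def by (simp add: nn_integral_cmult nn_integral_add nn_integral_multc)
    finally show ?thesis .
  qed
  have fin: "I1 < \<infinity>" "I2 < \<infinity>"
    using f1 f2 b0 unfolding norm1_eq norm1_star_eq b_def[symmetric] I1_def[symmetric] I2_def[symmetric]
    by (auto simp: ennreal_mult_less_top)
  have Ntop: "N1 < \<infinity>" "N2 < \<infinity>" using g1 g2 by (simp_all add: N1_def N2_def)
  have Epos: "AE p in ?M. 0 < E p"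
    using AE_u_weight_pos[of \<kappa>] by (auto elim!: eventually_mono simp: E_def)
  have AE_B: "AE p in ?M. B p < \<infinity>"
  proof -
    have "(\<integral>\<^sup>+p. E p * B p \<partial>?M) < \<infinity>"
      by (rule le_less_trans[OF total]) (use fin Ntop in \<open>simp add: ennreal_mult_less_top\<close>)
    then have "AE p in ?M. E p * B p \<noteq> \<infinity>" by (intro nn_integral_PInf_AE) auto
    with Epos show ?thesis
      by eventually_elim (auto simp: ennreal_mult_eq_top_iff less_top)
  qed
  \<comment> \<open>The bound is available for fixed q, so the two almost-everywhere quantifiers are
    exchanged first.\<close>
  have AE_TA: "AE p in ?M. AE q in ?M. TA p q < \<infinity>"
  proof (subst CC.AE_commute)
    show "{x \<in> space (?M \<Otimes>\<^sub>M ?M). TA (fst x) (snd x) < \<infinity>} \<in> sets (?M \<Otimes>\<^sub>M ?M)" by measurable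
    show "AE q in ?M. AE p in ?M. TA p q < \<infinity>"
      using AE_u_weight_pos[of \<kappa>] AE_space
    proof eventually_elim
      case (elim q)
      have "(\<integral>\<^sup>+p. E p * TA p q \<partial>?M) < \<infinity>"
        by (rule le_less_trans[OF pw]) (use elim Ntop in \<open>auto simp: R_def ennreal_mult_less_top\<close>)
      moreover have "(\<lambda>p. E p * TA p q) \<in> borel_measurable ?M"
        using measurable_compose[OF measurable_Pair2'[OF elim(2)] TAm] by simp
      ultimately have "AE p in ?M. E p * TA p q \<noteq> \<infinity>" by (intro nn_integral_PInf_AE) auto
      with Epos show ?case
        by eventually_elim (auto simp: ennreal_mult_eq_top_iff less_top)
    qed
  qed
  have FT: "ennreal \<bar>f q * translation \<kappa> g p q * w_weight \<kappa> q\<bar> \<le> F q * TA p q" if q: "q \<in> space ?M" for p q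
  proof -
    have "0 \<le> w_weight \<kappa> q" unfolding w using un[OF q] by simp
    then have "ennreal \<bar>f q * translation \<kappa> g p q * w_weight \<kappa> q\<bar> = F q * ennreal \<bar>translation \<kappa> g p q\<bar>"
      unfolding F_def by (subst ennreal_mult[symmetric]) (simp_all add: abs_mult mult_ac)
    then show ?thesis
      unfolding TA_def by (simp add: mult_left_mono translation_le_abs_translation[OF d \<kappa>])
  qed
  have FTB: "(\<integral>\<^sup>+q. ennreal \<bar>f q * translation \<kappa> g p q * w_weight \<kappa> q\<bar> \<partial>?M) \<le> B p" for p
    unfolding B_def by (intro nn_integral_mono FT)
  show "AE p in ?M. pseudo_conv_defined \<kappa> f g p"
    using AE_B AE_TA AE_space
  proof eventually_elim
    case (elim p)
    have "AE q in ?M. translation_defined \<kappa> g p q"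
      using elim(2) by eventually_elim (simp add: TA_def translation_definedI[OF d \<kappa> g])
    moreover have "integrable ?M (\<lambda>q. f q * translation \<kappa> g p q * w_weight \<kappa> q)"
    proof (rule integrableI_bounded)
      show "(\<lambda>q. f q * translation \<kappa> g p q * w_weight \<kappa> q) \<in> borel_measurable ?M"
        using measurable_compose[OF measurable_Pair1'[OF elim(3)] Tm] unfolding w by simp
      show "(\<integral>\<^sup>+q. ennreal (norm (f q * translation \<kappa> g p q * w_weight \<kappa> q)) \<partial>?M) < \<infinity>"
        using le_less_trans[OF FTB elim(1)] by simp
    qed
    ultimately show ?case by (simp add: pseudo_conv_defined_def)
  qed
  \<comment> \<open>Valid at every p: where the integral does not converge absolutely, its value is
    0 by convention.\<close>
  have pc: "ennreal \<bar>pseudo_conv \<kappa> f g p\<bar> \<le> ennreal b * B p" for p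
  proof -
    have "ennreal \<bar>pseudo_conv \<kappa> f g p\<bar> = ennreal b * ennreal \<bar>LINT q|?M. f q * translation \<kappa> g p q * w_weight \<kappa> q\<bar>"
      using b0 by (simp add: pseudo_conv_def b_def[symmetric] abs_mult ennreal_mult)
    also have "\<dots> \<le> ennreal b * B p"
      by (intro mult_left_mono order_trans[OF norm_integral_le_nn_integral FTB]) simp
    finally show ?thesis .
  qed
  have "norm1 \<kappa> (pseudo_conv \<kappa> f g) = ennreal b * (\<integral>\<^sup>+p. ennreal (\<bar>pseudo_conv \<kappa> f g p\<bar> * exp (- snd p / 2) * u_weight \<kappa> p) \<partial>?M)"
    by (simp add: norm1_eq b_def)
  also have "\<dots> \<le> ennreal b * (\<integral>\<^sup>+p. ennreal b * (E p * B p) \<partial>?M)"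
  proof (intro mult_left_mono nn_integral_mono)
    fix p assume p: "p \<in> space ?M"
    have "ennreal (\<bar>pseudo_conv \<kappa> f g p\<bar> * exp (- snd p / 2) * u_weight \<kappa> p) = ennreal \<bar>pseudo_conv \<kappa> f g p\<bar> * E p"
      unfolding E_def using un[OF p] by (subst ennreal_mult[symmetric]) (simp_all add: mult_ac)
    also have "\<dots> \<le> ennreal b * B p * E p" by (rule mult_right_mono[OF pc]) simp
    finally show "ennreal (\<bar>pseudo_conv \<kappa> f g p\<bar> * exp (- snd p / 2) * u_weight \<kappa> p) \<le> ennreal b * (E p * B p)"
      by (simp only: mult_ac)
  qed simp
  also have "(\<integral>\<^sup>+p. ennreal b * (E p * B p) \<partial>?M) = ennreal b * (\<integral>\<^sup>+p. E p * B p \<partial>?M)"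
    by (rule nn_integral_cmult) measurable
  also have "ennreal b * (ennreal b * (\<integral>\<^sup>+p. E p * B p \<partial>?M)) \<le> ennreal b * (ennreal b * (ennreal W * (I1 * N1 + I2 * N2)))"
    by (intro mult_left_mono total) simp_all
  also have "\<dots> = ennreal b * (I1 * N1 + I2 * N2)"
    by (simp only: mult.assoc[symmetric] bW) (simp only: mult.assoc bW mult_1_right)
  also have "\<dots> = norm1 \<kappa> f * N1 + norm1_star \<kappa> f * N2"
    unfolding norm1_eq norm1_star_eq I1_def I2_def b_def by (simp only: distrib_left mult.assoc)
  finally show "norm1 \<kappa> (pseudo_conv \<kappa> f g) \<le> norm1 \<kappa> f * norm1_half_line (2 * alpha \<kappa>) g
        + norm1_star \<kappa> f * norm1_half_line (2 * alpha \<kappa> + 1/2) g"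
    unfolding N1_def N2_def .
qed

theorem theorem4p9:
  fixes \<kappa> :: "real ^ 'n"
    and f :: "(real ^ 'n) \<times> real \<Rightarrow> real"
    and g :: "real \<Rightarrow> real"
  assumes "CARD('n) \<ge> 2"
    and "\<And>i. \<kappa> $ i \<ge> 0"
    and "alpha \<kappa> \<le> 1 / 2"
    and "f \<in> L1_cone \<kappa> \<inter> L1_cone_star \<kappa>"
    and "g \<in> L1_half_line (2 * alpha \<kappa>) \<inter> L1_half_line (2 * alpha \<kappa> + 1 / 2)"
  shows "(AE p in conic_measure. pseudo_conv_defined \<kappa> f g p) \<and>
    norm1 \<kappa> (pseudo_conv \<kappa> f g)
      \<le> norm1 \<kappa> f * norm1_half_line (2 * alpha \<kappa>) g
        + norm1_star \<kappa> f * norm1_half_line (2 * alpha \<kappa> + 1 / 2) g"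
proof -
  let ?M = "conic_measure :: ((real ^ 'n) \<times> real) measure"
  \<comment> \<open>\<open>g\<close> is measurable only on \<open>[0, \<infinity>)\<close>, but the translation never evaluates it elsewhere.\<close>
  define h where "h x = (if 0 \<le> x then g x else 0)" for x
  have gh: "g x = h x" if "0 \<le> x" for x using that by (simp add: h_def)
  have "g \<in> borel_measurable (restrict_space lborel {0..})"
    using assms(5) by (simp add: L1_half_line_def)
  then have "(\<lambda>x. indicator {0..} x *\<^sub>R g x) \<in> borel_measurable lborel"
    by (subst (asm) borel_measurable_restrict_space_iff) simp_all
  also have "(\<lambda>x. indicator {0..} x *\<^sub>R g x) = h" by (auto simp: h_def indicator_def fun_eq_iff)
  finally have hm: "h \<in> borel_measurable borel" by simp
  have nh: "norm1_half_line a g = norm1_half_line a h" for a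
    unfolding norm1_half_line_def
    by (intro arg_cong2[where f = "(*)"] refl nn_integral_cong) (simp add: space_restrict_space gh)
  have tr: "translation \<kappa> g p q = translation \<kappa> h p q" "translation_defined \<kappa> g p q \<longleftrightarrow> translation_defined \<kappa> h p q"
    if "p \<in> space ?M" "q \<in> space ?M" for p q
    using translation_cong[OF _ _ gh] that by (simp_all add: space_conic_measure)
  have pc: "pseudo_conv \<kappa> f g p = pseudo_conv \<kappa> f h p" if "p \<in> space ?M" for p
    unfolding pseudo_conv_def using tr[OF that]
    by (intro arg_cong2[where f = "(*)"] refl Bochner_Integration.integral_cong) simp_all
  have pd: "pseudo_conv_defined \<kappa> f g p \<longleftrightarrow> pseudo_conv_defined \<kappa> f h p" if "p \<in> space ?M" for p
  proof -
    have "(AE q in ?M. translation_defined \<kappa> g p q) \<longleftrightarrow> (AE q in ?M. translation_defined \<kappa> h p q)"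
      using tr[OF that] by (intro AE_cong) simp_all
    moreover have "integrable ?M (\<lambda>q. f q * translation \<kappa> g p q * w_weight \<kappa> q) \<longleftrightarrow> integrable ?M (\<lambda>q. f q * translation \<kappa> h p q * w_weight \<kappa> q)"
      using tr[OF that] by (intro Bochner_Integration.integrable_cong) simp_all
    ultimately show ?thesis by (simp add: pseudo_conv_defined_def)
  qed
  have f: "f \<in> borel_measurable ?M" "norm1 \<kappa> f < \<infinity>" "norm1_star \<kappa> f < \<infinity>"
    using assms(4) by (simp_all add: L1_cone_def L1_cone_star_def)
  have h12: "norm1_half_line (2 * alpha \<kappa>) h < \<infinity>" "norm1_half_line (2 * alpha \<kappa> + 1/2) h < \<infinity>"
    using assms(5) by (simp_all add: L1_half_line_def nh)
  note * = pseudo_conv_bound[OF assms(1,2,3) f hm h12]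
  have "AE p in ?M. pseudo_conv_defined \<kappa> f g p"
    using *(1) AE_space by eventually_elim (simp add: pd)
  moreover have "norm1 \<kappa> (pseudo_conv \<kappa> f g) = norm1 \<kappa> (pseudo_conv \<kappa> f h)"
    unfolding norm1_eq by (intro arg_cong2[where f = "(*)"] refl nn_integral_cong) (simp add: pc)
  ultimately show ?thesis using *(2) by (simp add: nh)
qed

end
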